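(* Let $\Omega \subset \mathbb{R}^d$, $d\geq 2$, be a bounded domain with $\mathrm{C}^4$-boundary, $\theta \in (\pi / 2 , \pi)$, and $0 \leq \alpha < 1 / 4$. Then for all $n \in \mathbb{N}$ there exist $F_n \in \mathrm{H}^{-1} (\Omega ; \mathbb{C}^d)$ and $\lambda_n \in \mathrm{S}_{\theta}$ with $\lvert \lambda_n \rvert \geq 1$ such that the pressure $\phi_n \in \mathrm{L}^2_0 (\Omega)$ associated to the Stokes resolvent problem with parameter $\lambda_n$ subject to homogeneous Dirichlet boundary conditions and right-hand side $F_n$ satisfies $$\| \phi_n \|_{\mathrm{L}^2 (\Omega)} > n \lvert \lambda_n \rvert^{\alpha} \| F_n \|_{\mathrm{H}^{-1} (\Omega ; \mathbb{C}^d)}.$$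
   Context: Sector: $\mathrm{S}_{\theta} := \{ z \in \mathbb{C} \setminus \{0\} : \lvert \arg(z) \rvert < \theta \}$ for $\theta \in (0,\pi)$. Spaces: $\mathrm{H}^{-1}(\Omega;\mathbb{C}^d) := \mathrm{H}^1_0(\Omega;\mathbb{C}^d)^*$ is the space of bounded antilinear functionals on $\mathrm{H}^1_0(\Omega;\mathbb{C}^d)$; $\mathrm{H}^1_{0,\sigma}(\Omega)$ is the closure in $\mathrm{H}^1(\Omega;\mathbb{C}^d)$ of $\{\varphi\in \mathrm{C}_c^\infty(\Omega;\mathbb{C}^d):\operatorname{div}(\varphi)=0\}$; $\mathrm{L}^2_0(\Omega)$ is the space of $\mathrm{L}^2$-functions on $\Omega$ with mean value zero. Associated pressure: for $F \in \mathrm{H}^{-1}(\Omega;\mathbb{C}^d)$ and $\lambda\in \mathrm{S}_\theta$ there is a unique pair $u \in \mathrm{H}^1_{0,\sigma}(\Omega)$, $\phi\in \mathrm{L}^2_0(\Omega)$ such that $$\lambda\int_\Omega u\cdot\overline{v}\,dx + \int_\Omega \nabla u\cdot\overline{\nabla v}\,dx - \int_\Omega \phi\,\overline{\operatorname{div}(v)}\,dx = \langle F,v\rangle \qquad \text{for all } v\in \mathrm{H}^1_0(\Omega;\mathbb{C}^d),$$ i.e. the weak form of $\lambda u-\Delta u+\nabla\phi=F$, $\operatorname{div}(u)=0$ in $\Omega$, $u=0$ on $\partial\Omega$; $\phi$ is the pressure associated to the problem with right-hand side $F$. *)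

theory Defs
  imports "HOL-Analysis.Analysis"
begin

definition sector :: "real \<Rightarrow> complex set" where
  "sector \<theta> = {z. z \<noteq> 0 \<and> \<bar>Arg z\<bar> < \<theta>}"


section \<open>Differentiability classes and domains\<close>

primrec Ck :: "nat \<Rightarrow> ('a::euclidean_space \<Rightarrow> 'b::real_normed_vector) \<Rightarrow> bool" where
  "Ck 0 f \<longleftrightarrow> continuous_on UNIV f"
| "Ck (Suc k) f \<longleftrightarrow> (\<forall>x. f differentiable (at x)) \<and>
     (\<forall>b\<in>Basis. Ck k (\<lambda>x. frechet_derivative f (at x) b))"

definition bounded_domain :: "'a::euclidean_space set \<Rightarrow> bool" where
  "bounded_domain \<Omega> \<longleftrightarrow> open \<Omega> \<and> connected \<Omega> \<and> \<Omega> \<noteq> {} \<and> bounded \<Omega>"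

text \<open>Near each boundary point the set is the strict epigraph of a \<open>C\<^sup>k\<close> function in suitable
  rotated coordinates: the unit vector \<open>e\<close> is the direction of the last coordinate axis, and the
  argument \<open>x - (x \<bullet> e) *\<^sub>R e\<close> of \<open>\<gamma>\<close> is the vector of the remaining coordinates.  Only the values
  of \<open>\<gamma>\<close> on the hyperplane orthogonal to \<open>e\<close> matter; a \<open>C\<^sup>k\<close> function on that hyperplane
  extends to the whole space, constantly in direction \<open>e\<close>.\<close>

definition Ck_boundary :: "nat \<Rightarrow> 'a::euclidean_space set \<Rightarrow> bool" where
  "Ck_boundary k \<Omega> \<longleftrightarrow> (\<forall>p\<in>frontier \<Omega>. \<exists>r>0. \<exists>e. \<exists>\<gamma> :: 'a \<Rightarrow> real.
     norm e = 1 \<and> Ck k \<gamma> \<and>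
     \<Omega> \<inter> ball p r = {x \<in> ball p r. \<gamma> (x - (x \<bullet> e) *\<^sub>R e) < x \<bullet> e})"


section \<open>Square-integrable functions and weak derivatives\<close>

text \<open>Elements of function spaces are represented by functions on the whole space; only their
  values on \<open>\<Omega>\<close> matter, and functions equal almost everywhere on \<open>\<Omega>\<close> are not identified, so the
  norms below are seminorms.\<close>

definition L2 :: "'a::euclidean_space set \<Rightarrow> ('a \<Rightarrow> 'b::euclidean_space) set" where
  "L2 \<Omega> = {f. f \<in> borel_measurable (lebesgue_on \<Omega>) \<and>
              integrable (lebesgue_on \<Omega>) (\<lambda>x. (norm (f x))\<^sup>2)}"

definition L2_norm :: "'a::euclidean_space set \<Rightarrow> ('a \<Rightarrow> 'b::euclidean_space) \<Rightarrow> real" where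
  "L2_norm \<Omega> f = sqrt (\<integral>x. (norm (f x))\<^sup>2 \<partial>lebesgue_on \<Omega>)"

definition L2_mean0 :: "'a::euclidean_space set \<Rightarrow> ('a \<Rightarrow> complex) set" where
  "L2_mean0 \<Omega> = {f \<in> L2 \<Omega>. (\<integral>x. f x \<partial>lebesgue_on \<Omega>) = 0}"

definition test_functions ::
    "'a::euclidean_space set \<Rightarrow> ('a \<Rightarrow> 'b::real_normed_vector) set" where
  "test_functions \<Omega> = {\<phi>. (\<forall>k. Ck k \<phi>) \<and>
     compact (closure {x. \<phi> x \<noteq> 0}) \<and> closure {x. \<phi> x \<noteq> 0} \<subseteq> \<Omega>}"

definition classical_partial ::
    "'d::finite \<Rightarrow> (real^'d \<Rightarrow> complex) \<Rightarrow> real^'d \<Rightarrow> complex" where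
  "classical_partial i f x = frechet_derivative f (at x) (axis i 1)"

definition is_weak_partial ::
    "(real^'d) set \<Rightarrow> 'd::finite \<Rightarrow> (real^'d \<Rightarrow> complex) \<Rightarrow> (real^'d \<Rightarrow> complex) \<Rightarrow> bool" where
  "is_weak_partial \<Omega> i f g \<longleftrightarrow> f \<in> L2 \<Omega> \<and> g \<in> L2 \<Omega> \<and> (\<forall>\<psi>\<in>test_functions \<Omega>.
     (\<integral>x. f x * classical_partial i \<psi> x \<partial>lebesgue_on \<Omega>) = - (\<integral>x. g x * \<psi> x \<partial>lebesgue_on \<Omega>))"

text \<open>A weak partial derivative is unique up to null sets; one representative is chosen.\<close>

definition weak_partial ::
    "(real^'d) set \<Rightarrow> 'd::finite \<Rightarrow> (real^'d \<Rightarrow> complex) \<Rightarrow> real^'d \<Rightarrow> complex" where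
  "weak_partial \<Omega> i f = (SOME g. is_weak_partial \<Omega> i f g)"

definition weak_grad ::
    "(real^'d) set \<Rightarrow> (real^'d \<Rightarrow> complex^'d) \<Rightarrow> real^'d \<Rightarrow> complex^'d^'d::finite" where
  "weak_grad \<Omega> u x = (\<chi> j i. weak_partial \<Omega> i (\<lambda>y. u y $ j) x)"

definition weak_div ::
    "(real^'d) set \<Rightarrow> (real^'d \<Rightarrow> complex^'d::finite) \<Rightarrow> real^'d \<Rightarrow> complex" where
  "weak_div \<Omega> u x = (\<Sum>i\<in>UNIV. weak_partial \<Omega> i (\<lambda>y. u y $ i) x)"


section \<open>Sobolev spaces\<close>

definition H1 :: "(real^'d) set \<Rightarrow> (real^'d \<Rightarrow> complex^'d::finite) set" where
  "H1 \<Omega> = {u \<in> L2 \<Omega>. \<forall>i j. \<exists>g. is_weak_partial \<Omega> i (\<lambda>x. u x $ j) g}"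

definition H1_norm :: "(real^'d) set \<Rightarrow> (real^'d \<Rightarrow> complex^'d::finite) \<Rightarrow> real" where
  "H1_norm \<Omega> u = sqrt ((L2_norm \<Omega> u)\<^sup>2 + (L2_norm \<Omega> (weak_grad \<Omega> u))\<^sup>2)"

definition H1_closure ::
    "(real^'d) set \<Rightarrow> (real^'d \<Rightarrow> complex^'d::finite) set \<Rightarrow> (real^'d \<Rightarrow> complex^'d) set" where
  "H1_closure \<Omega> A = {u \<in> H1 \<Omega>. \<forall>\<epsilon>>0. \<exists>\<phi>\<in>A. H1_norm \<Omega> (\<lambda>x. u x - \<phi> x) < \<epsilon>}"

definition H10 :: "(real^'d) set \<Rightarrow> (real^'d \<Rightarrow> complex^'d::finite) set" where
  "H10 \<Omega> = H1_closure \<Omega> (test_functions \<Omega>)"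

definition H10_solenoidal :: "(real^'d) set \<Rightarrow> (real^'d \<Rightarrow> complex^'d::finite) set" where
  "H10_solenoidal \<Omega> = H1_closure \<Omega>
     {\<phi> \<in> test_functions \<Omega>. \<forall>x. (\<Sum>i\<in>UNIV. classical_partial i (\<lambda>y. \<phi> y $ i) x) = 0}"

text \<open>Boundedness forces the functionals to respect equality almost everywhere on \<open>\<Omega>\<close>.\<close>

definition Hneg1 :: "(real^'d) set \<Rightarrow> ((real^'d \<Rightarrow> complex^'d::finite) \<Rightarrow> complex) set" where
  "Hneg1 \<Omega> = {F.
     (\<forall>u\<in>H10 \<Omega>. \<forall>v\<in>H10 \<Omega>. F (\<lambda>x. u x + v x) = F u + F v) \<and>
     (\<forall>c. \<forall>u\<in>H10 \<Omega>. F (\<lambda>x. c *s u x) = cnj c * F u) \<and>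
     (\<exists>C. \<forall>u\<in>H10 \<Omega>. norm (F u) \<le> C * H1_norm \<Omega> u)}"

definition Hneg1_norm ::
    "(real^'d) set \<Rightarrow> ((real^'d \<Rightarrow> complex^'d::finite) \<Rightarrow> complex) \<Rightarrow> real" where
  "Hneg1_norm \<Omega> F = (SUP v\<in>{v \<in> H10 \<Omega>. H1_norm \<Omega> v \<le> 1}. norm (F v))"


section \<open>The Stokes resolvent problem\<close>

definition stokes_solution ::
    "(real^'d) set \<Rightarrow> complex \<Rightarrow> ((real^'d \<Rightarrow> complex^'d::finite) \<Rightarrow> complex) \<Rightarrow>
     (real^'d \<Rightarrow> complex^'d) \<Rightarrow> (real^'d \<Rightarrow> complex) \<Rightarrow> bool" where
  "stokes_solution \<Omega> \<mu> F u \<phi> \<longleftrightarrow> u \<in> H10_solenoidal \<Omega> \<and> \<phi> \<in> L2_mean0 \<Omega> \<and>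
     (\<forall>v\<in>H10 \<Omega>.
        \<mu> * (\<integral>x. (\<Sum>j\<in>UNIV. u x $ j * cnj (v x $ j)) \<partial>lebesgue_on \<Omega>)
        + (\<integral>x. (\<Sum>j\<in>UNIV. \<Sum>i\<in>UNIV. weak_grad \<Omega> u x $ j $ i * cnj (weak_grad \<Omega> v x $ j $ i))
             \<partial>lebesgue_on \<Omega>)
        - (\<integral>x. \<phi> x * cnj (weak_div \<Omega> v x) \<partial>lebesgue_on \<Omega>) = F v)"

text \<open>For \<open>F \<in> Hneg1 \<Omega>\<close> and \<open>\<mu>\<close> in a sector the pressure is unique up to null sets.\<close>

definition associated_pressure ::
    "(real^'d) set \<Rightarrow> complex \<Rightarrow> ((real^'d \<Rightarrow> complex^'d::finite) \<Rightarrow> complex) \<Rightarrow>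
     (real^'d \<Rightarrow> complex) \<Rightarrow> bool" where
  "associated_pressure \<Omega> \<mu> F \<phi> \<longleftrightarrow> (\<exists>u. stokes_solution \<Omega> \<mu> F u \<phi>)"

end

theory Submission
  imports Defs
begin

text \<open>
  Instead of solving the Stokes resolvent problem for a given right-hand side, a velocity \<open>u\<close> and a
  pressure \<open>\<phi>\<close> are chosen and the right-hand side \<open>F = \<lambda> u - \<Delta> u + \<nabla> \<phi>\<close> is computed from them; the pair
  is then a solution for \<open>F\<close>, and the task is to make \<open>F\<close> much smaller than \<open>\<phi>\<close>.

  Take \<open>\<lambda> = s\<^sup>2\<close> with \<open>s\<close> real and large, and two coordinates \<open>a \<noteq> b\<close>.  The pressure is
  \<open>\<phi> = - s (x\<^sub>a - m)\<close>, where \<open>m\<close> is the mean of \<open>x\<^sub>a\<close>, so that its norm is a positive multiple of \<open>s\<close>.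
  The constant velocity \<open>e\<^sub>a / s\<close> would solve the equation with \<open>F = 0\<close>, but it violates the boundary
  condition.  It has the stream function \<open>x\<^sub>b / s\<close>, which is cut off by a smooth \<open>\<eta>\<close> that vanishes near
  the boundary and equals \<open>1\<close> outside a boundary layer of width comparable to \<open>1 / s\<close>; the resulting
  velocity \<open>u = (d\<^sub>b (\<eta> x\<^sub>b) e\<^sub>a - d\<^sub>a (\<eta> x\<^sub>b) e\<^sub>b) / s\<close> is divergence-free and compactly supported.

  Then \<open>\<lambda> u + \<nabla> \<phi>\<close> is \<open>s\<close> times the rotated gradient of \<open>(\<eta> - 1) x\<^sub>b\<close>, hence the divergence of an
  antisymmetric matrix field of size \<open>O(s)\<close> supported in the layer.  Likewise \<open>\<Delta> u\<close> is the
  divergence of \<open>\<nabla> u\<close>, which also lives in the layer and is \<open>1 / s\<close> times second derivatives of size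
  \<open>O(s\<^sup>2)\<close>.  So \<open>F\<close> is the divergence of a matrix field of size \<open>O(s)\<close> that lives
  on a set of measure \<open>O(1 / s)\<close>, and its norm in the dual space is at most the \<open>L\<^sup>2\<close> norm of that
  field, which is \<open>O(s\<^sup>1\<^sup>/\<^sup>2)\<close>.  The quotient of the norms of \<open>\<phi>\<close> and \<open>F\<close> is at least of order
  \<open>s\<^sup>1\<^sup>/\<^sup>2 = \<bar>\<lambda>\<bar>\<^sup>1\<^sup>/\<^sup>4\<close>, which eventually exceeds \<open>n \<bar>\<lambda>\<bar>\<^sup>\<alpha>\<close> whenever \<open>\<alpha> < 1 / 4\<close>.

  Geometrically, only the measure of thin boundary layers matters (\<open>layer_measure\<close>); the cut-off functions
  with the required derivative bounds come from a partition of unity on a lattice of mesh size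
  comparable to \<open>1 / s\<close> (\<open>boundary_cutoff_exists\<close>).  The analytic input consists of the uniqueness of weak
  derivatives (\<open>is_weak_partial_unique\<close>) and an integration by parts without boundary terms
  (\<open>H10_integration_by_parts\<close>), which identify \<open>F\<close> with the divergence of the matrix field
  (\<open>layer_stokes_solution\<close>); the norm of that field is estimated in \<open>layer_flux_L2_norm\<close>.
\<close>


section \<open>Functions of class \<open>C\<^sup>k\<close>\<close>

lemma linear_eq_sum_Basis:
  fixes L :: "'a::euclidean_space \<Rightarrow> 'b::real_vector"
  assumes "linear L"
  shows "L h = (\<Sum>b\<in>Basis. (h \<bullet> b) *\<^sub>R L b)"
proof -
  have "L h = L (\<Sum>b\<in>Basis. (h \<bullet> b) *\<^sub>R b)" by (simp add: euclidean_representation)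
  also have "\<dots> = (\<Sum>b\<in>Basis. (h \<bullet> b) *\<^sub>R L b)"
    by (simp add: linear_sum[OF assms] linear_scale[OF assms])
  finally show ?thesis .
qed

text \<open>Any derivative may be used to verify differentiability of class \<open>C\<^sup>k\<close>; this is how the closure
properties below avoid computing with \<^const>\<open>frechet_derivative\<close>.\<close>

lemma Ck_SucI:
  assumes "\<And>x. (f has_derivative D x) (at x)" "\<And>b. b \<in> Basis \<Longrightarrow> Ck k (\<lambda>x. D x b)"
  shows "Ck (Suc k) f"
proof -
  have "frechet_derivative f (at x) = D x" for x
    using frechet_derivative_at[OF assms(1)] by simp
  then show ?thesis
    using assms by (auto simp: differentiable_def)
qed

lemma Ck_Suc_has_derivative:
  "Ck (Suc k) f \<Longrightarrow> (f has_derivative frechet_derivative f (at x)) (at x)"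
  by (simp flip: frechet_derivative_works)

lemma Ck_SucD: "Ck (Suc k) f \<Longrightarrow> Ck k f"
proof (induction k arbitrary: f)
  case 0
  then show ?case
    by (auto simp: continuous_on_eq_continuous_at differentiable_imp_continuous_within)
next
  case (Suc k)
  then show ?case by auto
qed

lemma Ck_continuous: "Ck k f \<Longrightarrow> continuous_on UNIV f"
  by (induction k) (auto dest: Ck_SucD simp del: Ck.simps(2))

lemma Ck_const: "Ck k (\<lambda>x. c)"
proof (induction k arbitrary: c)
  case (Suc k)
  show ?case by (rule Ck_SucI[where D="\<lambda>x h. 0"]) (auto intro: Suc)
qed auto

lemma Ck_add: "Ck k f \<Longrightarrow> Ck k g \<Longrightarrow> Ck k (\<lambda>x. f x + g x)"
proof (induction k arbitrary: f g)
  case (Suc k)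
  show ?case
    using Suc.prems
    by (intro Ck_SucI[OF has_derivative_add[OF Ck_Suc_has_derivative Ck_Suc_has_derivative]] Suc.IH) auto
qed (auto intro: continuous_intros)

lemma Ck_sum: "(\<And>i. i \<in> I \<Longrightarrow> Ck k (f i)) \<Longrightarrow> Ck k (\<lambda>x. \<Sum>i\<in>I. f i x)"
  by (induction I rule: infinite_finite_induct) (auto intro: Ck_const Ck_add)

lemma Ck_bounded_linear:
  assumes L: "bounded_linear L"
  shows "Ck k f \<Longrightarrow> Ck k (\<lambda>x. L (f x))"
proof (induction k arbitrary: f)
  case (Suc k)
  show ?case
    using Suc.prems
    by (intro Ck_SucI[OF bounded_linear.has_derivative[OF L Ck_Suc_has_derivative]] Suc.IH) auto
qed (auto intro: bounded_linear.continuous_on[OF L])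

text \<open>The product rule reproduces the same shape with \<open>f\<close> or \<open>g\<close> replaced by a derivative, and the
undifferentiated factor is of class \<open>C\<^sup>k\<close> because it is of class \<open>C\<^sup>k\<^sup>+\<^sup>1\<close>.\<close>

lemma Ck_bilinear:
  assumes B: "bounded_bilinear B"
  shows "Ck k f \<Longrightarrow> Ck k g \<Longrightarrow> Ck k (\<lambda>x. B (f x) (g x))"
proof (induction k arbitrary: f g)
  case (Suc k)
  show ?case
    using Suc.prems Ck_SucD[of k f] Ck_SucD[of k g]
    by (intro Ck_SucI[OF bounded_bilinear.FDERIV[OF B Ck_Suc_has_derivative Ck_Suc_has_derivative]]
        Ck_add Suc.IH) auto
qed (auto intro: bounded_bilinear.continuous_on[OF B])

lemmas Ck_mult = Ck_bilinear[OF bounded_bilinear_mult]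

lemma Ck_prod:
  fixes f :: "'i \<Rightarrow> 'a::euclidean_space \<Rightarrow> 'b::{real_normed_algebra,comm_ring_1}"
  shows "(\<And>i. i \<in> I \<Longrightarrow> Ck k (f i)) \<Longrightarrow> Ck k (\<lambda>x. \<Prod>i\<in>I. f i x)"
  by (induction I rule: infinite_finite_induct) (auto intro: Ck_const Ck_mult)

text \<open>The derivative \<open>- f' / f\<^sup>2\<close> is a product of \<open>f'\<close> and two copies of the function itself, which the
induction hypothesis covers.\<close>

lemma Ck_inverse:
  fixes f :: "'a::euclidean_space \<Rightarrow> 'b::real_normed_field"
  assumes nz: "\<And>x. f x \<noteq> 0"
  shows "Ck k f \<Longrightarrow> Ck k (\<lambda>x. inverse (f x))"
proof (induction k)
  case (Suc k)
  have D: "((\<lambda>x. inverse (f x)) has_derivative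
      (\<lambda>h. - (inverse (f x) * frechet_derivative f (at x) h * inverse (f x)))) (at x)" for x
    using Deriv.has_derivative_inverse[OF nz Ck_Suc_has_derivative[OF Suc.prems]] .
  have "Ck k (\<lambda>x. inverse (f x))"
    using Suc Ck_SucD by blast
  with Suc.prems show ?case
    by (intro Ck_SucI[OF D] Ck_bounded_linear[OF bounded_linear_minus[OF bounded_linear_ident]] Ck_mult)
      auto
qed (auto intro!: continuous_intros nz)

text \<open>The chain rule produces a derivative in a direction that need not be a basis vector; it is
expanded into the basis directions, to which the definition of \<open>C\<^sup>k\<close> refers.\<close>

lemma Ck_affine:
  fixes f :: "'a::euclidean_space \<Rightarrow> 'b::real_normed_vector"
  assumes L: "bounded_linear (L :: 'c::euclidean_space \<Rightarrow> 'a)"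
  shows "Ck k f \<Longrightarrow> Ck k (\<lambda>x. f (L x + a))"
proof (induction k arbitrary: f)
  case 0
  have "continuous_on UNIV ((\<lambda>x. f x) \<circ> (\<lambda>x. L x + a))"
    using 0 by (intro continuous_on_compose continuous_intros bounded_linear.continuous_on[OF L])
      (auto elim: continuous_on_subset)
  then show ?case by (simp add: o_def)
next
  case (Suc k)
  let ?D = "\<lambda>x. frechet_derivative f (at x)"
  have "((\<lambda>x. f (L x + a)) has_derivative (\<lambda>h. ?D (L x + a) (L h))) (at x)" for x
    using diff_chain_at[of "\<lambda>x. L x + a" L x f] Ck_Suc_has_derivative[OF Suc.prems, of "L x + a"]
      has_derivative_add_const[OF bounded_linear_imp_has_derivative[OF L]]
    by (simp add: o_def)
  moreover have "(\<lambda>x. ?D (L x + a) (L h)) = (\<lambda>x. \<Sum>b\<in>Basis. (L h \<bullet> b) *\<^sub>R ?D (L x + a) b)" for h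
    using Suc.prems by (intro ext linear_eq_sum_Basis linear_frechet_derivative) auto
  ultimately show ?case
    using Suc.prems
    by (intro Ck_SucI[where D="\<lambda>x h. ?D (L x + a) (L h)"])
      (auto intro!: Ck_sum Ck_bounded_linear[OF bounded_linear_scaleR_right] Suc.IH)
qed

definition smooth :: "('a::euclidean_space \<Rightarrow> 'b::real_normed_vector) \<Rightarrow> bool" where
  "smooth f \<longleftrightarrow> (\<forall>k. Ck k f)"

lemma smooth_has_derivative: "smooth f \<Longrightarrow> (f has_derivative frechet_derivative f (at x)) (at x)"
  unfolding smooth_def using Ck_Suc_has_derivative by blast

lemma smooth_continuous: "smooth f \<Longrightarrow> continuous_on S f"
  unfolding smooth_def by (metis Ck.simps(1) continuous_on_subset subset_UNIV)

lemma smooth_directional: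
  assumes "smooth f"
  shows "smooth (\<lambda>x. frechet_derivative f (at x) h)"
proof -
  have "(\<lambda>x. frechet_derivative f (at x) h) = (\<lambda>x. \<Sum>b\<in>Basis. (h \<bullet> b) *\<^sub>R frechet_derivative f (at x) b)"
    by (intro ext linear_eq_sum_Basis has_derivative_linear[OF smooth_has_derivative[OF assms]])
  moreover have "Ck (Suc k) f" for k using assms unfolding smooth_def by blast
  ultimately show ?thesis
    unfolding smooth_def by (auto intro!: Ck_sum Ck_bounded_linear[OF bounded_linear_scaleR_right])
qed

lemma smooth_const: "smooth (\<lambda>x. c)"
  and smooth_add: "smooth f \<Longrightarrow> smooth g \<Longrightarrow> smooth (\<lambda>x. f x + g x)"
  and smooth_sum: "(\<And>i. i \<in> I \<Longrightarrow> smooth (F i)) \<Longrightarrow> smooth (\<lambda>x. \<Sum>i\<in>I. F i x)"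
  and smooth_bounded_linear: "bounded_linear L \<Longrightarrow> smooth f \<Longrightarrow> smooth (\<lambda>x. L (f x))"
  unfolding smooth_def by (auto intro: Ck_const Ck_add Ck_sum Ck_bounded_linear)

lemma smooth_mult:
  fixes f g :: "'a::euclidean_space \<Rightarrow> 'b::real_normed_algebra"
  shows "smooth f \<Longrightarrow> smooth g \<Longrightarrow> smooth (\<lambda>x. f x * g x)"
  unfolding smooth_def by (auto intro: Ck_mult)

lemma smooth_cmult: "smooth f \<Longrightarrow> smooth (\<lambda>x. c * f x)" for f :: "'a::euclidean_space \<Rightarrow> real"
  by (rule smooth_bounded_linear[OF bounded_linear_mult_right])

lemma smooth_diff: "smooth f \<Longrightarrow> smooth g \<Longrightarrow> smooth (\<lambda>x. f x - g x)"
  using smooth_add[of f "\<lambda>x. - g x"] smooth_bounded_linear[OF bounded_linear_minus[OF bounded_linear_ident], of g]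
  by simp

lemma smooth_prod:
  fixes f :: "'i \<Rightarrow> 'a::euclidean_space \<Rightarrow> 'b::{real_normed_algebra,comm_ring_1}"
  shows "(\<And>i. i \<in> I \<Longrightarrow> smooth (f i)) \<Longrightarrow> smooth (\<lambda>x. \<Prod>i\<in>I. f i x)"
  unfolding smooth_def by (auto intro: Ck_prod)

lemma smooth_inverse:
  fixes f :: "'a::euclidean_space \<Rightarrow> 'b::real_normed_field"
  shows "smooth f \<Longrightarrow> (\<And>x. f x \<noteq> 0) \<Longrightarrow> smooth (\<lambda>x. inverse (f x))"
  unfolding smooth_def by (auto intro: Ck_inverse)

lemma smooth_affine:
  "smooth f \<Longrightarrow> bounded_linear L \<Longrightarrow> smooth (\<lambda>x. f (L x + a))"
  unfolding smooth_def by (auto intro: Ck_affine)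

lemma smooth_scaled_shift: "smooth f \<Longrightarrow> smooth (\<lambda>x. f (c *\<^sub>R x - a))"
  using smooth_affine[OF _ bounded_linear_scaleR_right[of c], of f "- a"] by simp

lemma smooth_linear: "bounded_linear L \<Longrightarrow> smooth L"
proof -
  assume L: "bounded_linear L"
  have "Ck k L" for k
  proof (cases k)
    case 0
    then show ?thesis using L by (simp add: linear_continuous_on)
  next
    case (Suc k')
    show ?thesis unfolding Suc
      by (rule Ck_SucI[where D="\<lambda>x. L"]) (auto intro: bounded_linear_imp_has_derivative L Ck_const)
  qed
  then show ?thesis by (simp add: smooth_def)
qed

lemma smooth_coord: "smooth (\<lambda>x :: real^'d::finite. x $ b)"
  by (rule smooth_linear[OF bounded_linear_vec_nth])

lemma smooth_nth: "smooth f \<Longrightarrow> smooth (\<lambda>x. f x $ j)"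
  by (rule smooth_bounded_linear[OF bounded_linear_vec_nth])

lemma smooth_vec:
  fixes u :: "'a::euclidean_space \<Rightarrow> complex^'d::finite"
  assumes "\<And>j. smooth (\<lambda>x. u x $ j)"
  shows "smooth u"
proof -
  have "bounded_linear (axis j :: complex \<Rightarrow> complex^'d)" for j
    unfolding linear_conv_bounded_linear[symmetric]
    by (rule linearI) (simp_all add: vec_eq_iff axis_def)
  then have "smooth (\<lambda>x. \<Sum>j\<in>UNIV. axis j (u x $ j))"
    using assms by (intro smooth_sum smooth_bounded_linear[of "axis _"])
  moreover have "(\<lambda>x. \<Sum>j\<in>UNIV. axis j (u x $ j)) = u"
    by (simp add: fun_eq_iff vec_eq_iff axis_def)
  ultimately show ?thesis by simp
qed

lemma test_functions_iff:
  "f \<in> test_functions \<Omega> \<longleftrightarrow> smooth f \<and> compact (closure {x. f x \<noteq> 0}) \<and> closure {x. f x \<noteq> 0} \<subseteq> \<Omega>"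
  by (simp add: test_functions_def smooth_def)

lemma test_function_smooth: "\<psi> \<in> test_functions \<Omega> \<Longrightarrow> smooth \<psi>"
  by (simp add: test_functions_iff)


section \<open>Partial derivatives\<close>

definition pdiff :: "'d \<Rightarrow> (real^'d::finite \<Rightarrow> 'b::real_normed_vector) \<Rightarrow> real^'d \<Rightarrow> 'b" where
  "pdiff i f x = frechet_derivative f (at x) (axis i 1)"

lemma smooth_pdiff: "smooth f \<Longrightarrow> smooth (pdiff i f)"
  unfolding pdiff_def[abs_def] by (rule smooth_directional)

lemma classical_partial_eq: "classical_partial i f = pdiff i f"
  by (simp add: classical_partial_def pdiff_def fun_eq_iff)

lemma pdiff_bounded_linear:
  assumes "bounded_linear L" "smooth f"
  shows "pdiff i (\<lambda>x. L (f x)) x = L (pdiff i f x)"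
  using frechet_derivative_at[OF bounded_linear.has_derivative[OF assms(1) smooth_has_derivative[OF assms(2)]]]
  unfolding pdiff_def by metis

lemma pdiff_add:
  assumes "smooth f" "smooth g"
  shows "pdiff i (\<lambda>x. f x + g x) x = pdiff i f x + pdiff i g x"
  using frechet_derivative_at[OF has_derivative_add[OF smooth_has_derivative[OF assms(1)] smooth_has_derivative[OF assms(2)]]]
  unfolding pdiff_def by metis

lemma pdiff_diff:
  assumes "smooth f" "smooth g"
  shows "pdiff i (\<lambda>x. f x - g x) x = pdiff i f x - pdiff i g x"
  using frechet_derivative_at[OF has_derivative_diff[OF smooth_has_derivative[OF assms(1)] smooth_has_derivative[OF assms(2)]]]
  unfolding pdiff_def by metis

lemma pdiff_mult:
  fixes f g :: "real^'d::finite \<Rightarrow> 'b::real_normed_algebra"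
  assumes "smooth f" "smooth g"
  shows "pdiff i (\<lambda>x. f x * g x) x = f x * pdiff i g x + pdiff i f x * g x"
  using frechet_derivative_at[OF has_derivative_mult[OF smooth_has_derivative[OF assms(1)] smooth_has_derivative[OF assms(2)]]]
  unfolding pdiff_def by metis

lemma pdiff_const: "pdiff i (\<lambda>x. c) x = 0"
  by (simp add: pdiff_def)

lemma pdiff_nth: "pdiff i (\<lambda>x. x $ b) x = (if i = b then 1 else 0)" for x :: "real^'d::finite"
proof -
  have "((\<lambda>x. x $ b) has_derivative (\<lambda>x::real^'d. x $ b)) (at x)"
    by (intro bounded_linear_imp_has_derivative bounded_linear_vec_nth)
  then show ?thesis by (simp add: pdiff_def axis_def flip: frechet_derivative_at)
qed

lemma frechet_derivative_zero_on_open: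
  assumes "open S" "x \<in> S" "\<And>y. y \<in> S \<Longrightarrow> f y = c"
  shows "frechet_derivative f (at x) v = 0"
proof -
  have "((\<lambda>y. c) has_derivative (\<lambda>h. 0)) (at x)" by simp
  then have "(f has_derivative (\<lambda>h. 0)) (at x)"
    by (rule has_derivative_transform_within_open[OF _ assms(1,2)]) (simp add: assms(3))
  then show ?thesis by (simp flip: frechet_derivative_at)
qed

lemma pdiff_zero_outside_support:
  assumes "x \<notin> closure {x. f x \<noteq> 0}"
  shows "pdiff i f x = 0"
  unfolding pdiff_def
proof (rule frechet_derivative_zero_on_open)
  show "open (- closure {x. f x \<noteq> 0})" by (rule open_Compl[OF closed_closure])
  show "x \<in> - closure {x. f x \<noteq> 0}" using assms by simp
  show "f y = 0" if "y \<in> - closure {x. f x \<noteq> 0}" for y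
    using that closure_subset[of "{x. f x \<noteq> 0}"] by blast
qed

lemma frechet_derivative_scaled_shift:
  assumes f: "smooth f"
  shows "frechet_derivative (\<lambda>x. f (c *\<^sub>R x - a)) (at x) v = c *\<^sub>R frechet_derivative f (at (c *\<^sub>R x - a)) v"
proof -
  let ?D = "frechet_derivative f (at (c *\<^sub>R x - a))"
  have "((\<lambda>x. c *\<^sub>R x - a) has_derivative (\<lambda>h. c *\<^sub>R h)) (at x)"
    by (auto intro!: derivative_eq_intros)
  from diff_chain_at[OF this smooth_has_derivative[OF f]]
  have "((\<lambda>x. f (c *\<^sub>R x - a)) has_derivative (\<lambda>h. ?D (c *\<^sub>R h))) (at x)"
    by (simp add: o_def)
  then have "frechet_derivative (\<lambda>x. f (c *\<^sub>R x - a)) (at x) v = ?D (c *\<^sub>R v)"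
    by (simp flip: frechet_derivative_at)
  moreover have "linear ?D"
    using smooth_has_derivative[OF f] has_derivative_linear by blast
  ultimately show ?thesis by (simp add: linear_scale)
qed

lemma frechet_derivative_sum:
  assumes "\<And>i. i \<in> I \<Longrightarrow> smooth (f i)"
  shows "frechet_derivative (\<lambda>x. \<Sum>i\<in>I. f i x) (at x) v = (\<Sum>i\<in>I. frechet_derivative (f i) (at x) v)"
proof -
  have "((\<lambda>x. \<Sum>i\<in>I. f i x) has_derivative (\<lambda>v. \<Sum>i\<in>I. frechet_derivative (f i) (at x) v)) (at x)"
    by (intro has_derivative_sum smooth_has_derivative assms)
  then show ?thesis by (simp flip: frechet_derivative_at)
qed

lemma DERIV_along_axis:
  fixes f :: "real^'d::finite \<Rightarrow> real"
  assumes "smooth f"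
  shows "((\<lambda>t. f (x + t *\<^sub>R axis i 1)) has_field_derivative pdiff i f (x + t *\<^sub>R axis i 1)) (at t)"
proof -
  let ?y = "x + t *\<^sub>R axis i 1"
  let ?D = "frechet_derivative f (at ?y)"
  have "((\<lambda>t. x + t *\<^sub>R axis i 1) has_derivative (\<lambda>h. h *\<^sub>R axis i 1)) (at t)"
    by (auto intro!: derivative_eq_intros)
  from diff_chain_at[OF this smooth_has_derivative[OF assms]]
  have "((\<lambda>t. f (x + t *\<^sub>R axis i 1)) has_derivative (\<lambda>h. ?D (h *\<^sub>R axis i 1))) (at t)"
    by (simp add: o_def)
  moreover have "linear ?D"
    using smooth_has_derivative[OF assms] has_derivative_linear by blast
  then have "(\<lambda>h. ?D (h *\<^sub>R axis i 1)) = (*) (pdiff i f ?y)"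
    by (simp add: fun_eq_iff linear_scale pdiff_def mult.commute)
  ultimately show ?thesis by (simp add: has_field_derivative_def)
qed

lemma mixed_difference_mean_value:
  fixes f :: "real^'d::finite \<Rightarrow> real"
  assumes f: "smooth f" and h: "h > 0"
  shows "\<exists>y. dist y x \<le> 2 * h \<and>
    f (x + h *\<^sub>R axis i 1 + h *\<^sub>R axis j 1) - f (x + h *\<^sub>R axis i 1) - f (x + h *\<^sub>R axis j 1) + f x
      = h * (h * pdiff j (pdiff i f) y)"
proof -
  let ?a = "axis i 1 :: real^'d" and ?b = "axis j 1 :: real^'d"
  have "((\<lambda>t. f (x + h *\<^sub>R ?b + t *\<^sub>R ?a) - f (x + t *\<^sub>R ?a)) has_field_derivative
      pdiff i f (x + h *\<^sub>R ?b + t *\<^sub>R ?a) - pdiff i f (x + t *\<^sub>R ?a)) (at t)" for t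
    by (intro DERIV_diff DERIV_along_axis f)
  from MVT2[OF h this] obtain s where s: "0 < s" "s < h" and
    1: "(f (x + h *\<^sub>R ?b + h *\<^sub>R ?a) - f (x + h *\<^sub>R ?a)) - (f (x + h *\<^sub>R ?b + 0 *\<^sub>R ?a) - f (x + 0 *\<^sub>R ?a))
       = (h - 0) * (pdiff i f (x + h *\<^sub>R ?b + s *\<^sub>R ?a) - pdiff i f (x + s *\<^sub>R ?a))" by blast
  have "((\<lambda>t. pdiff i f (x + s *\<^sub>R ?a + t *\<^sub>R ?b)) has_field_derivative
      pdiff j (pdiff i f) (x + s *\<^sub>R ?a + t *\<^sub>R ?b)) (at t)" for t
    by (intro DERIV_along_axis smooth_pdiff f)
  from MVT2[OF h this] obtain t where t: "0 < t" "t < h" and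
    2: "pdiff i f (x + s *\<^sub>R ?a + h *\<^sub>R ?b) - pdiff i f (x + s *\<^sub>R ?a + 0 *\<^sub>R ?b)
       = (h - 0) * pdiff j (pdiff i f) (x + s *\<^sub>R ?a + t *\<^sub>R ?b)" by blast
  let ?y = "x + s *\<^sub>R ?a + t *\<^sub>R ?b"
  have "dist ?y x \<le> norm (s *\<^sub>R ?a) + norm (t *\<^sub>R ?b)"
    using norm_triangle_ineq[of "s *\<^sub>R ?a" "t *\<^sub>R ?b"] by (simp add: dist_norm add.assoc)
  also have "\<dots> \<le> 2 * h" using s t by simp
  finally have "dist ?y x \<le> 2 * h" .
  moreover have swap: "x + h *\<^sub>R ?b + c *\<^sub>R ?a = x + c *\<^sub>R ?a + h *\<^sub>R ?b" for c
    by (rule add.commute[THEN add_left_cancel[THEN iffD2], folded add.assoc])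
  ultimately show ?thesis using 1[unfolded swap] 2 by (intro exI[of _ ?y]) simp
qed

text \<open>Both mixed derivatives are limits of the same second difference quotient, which is symmetric in
the two directions; the mean value theorem, applied twice, evaluates it by either of them at a
nearby point.\<close>

lemma pdiff_commute:
  fixes f :: "real^'d::finite \<Rightarrow> real"
  assumes f: "smooth f"
  shows "pdiff j (pdiff i f) x = pdiff i (pdiff j f) x"
proof -
  define h where "h n = inverse (real (Suc n))" for n
  have h: "h n > 0" for n by (simp add: h_def)
  have "\<exists>y. dist y x \<le> 2 * h n \<and>
    f (x + h n *\<^sub>R axis k 1 + h n *\<^sub>R axis l 1) - f (x + h n *\<^sub>R axis k 1) - f (x + h n *\<^sub>R axis l 1) + f x
      = h n * (h n * pdiff l (pdiff k f) y)" for n k l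
    by (rule mixed_difference_mean_value[OF f h])
  then obtain y where y: "\<And>n k l. dist (y n k l) x \<le> 2 * h n"
    and eq: "\<And>n k l. f (x + h n *\<^sub>R axis k 1 + h n *\<^sub>R axis l 1) - f (x + h n *\<^sub>R axis k 1) - f (x + h n *\<^sub>R axis l 1) + f x
      = h n * (h n * pdiff l (pdiff k f) (y n k l))" by metis
  have h0: "(\<lambda>n. 2 * h n) \<longlonglongrightarrow> 0"
    unfolding h_def using tendsto_mult[OF tendsto_const LIMSEQ_inverse_real_of_nat, of 2] by simp
  have lim: "(\<lambda>n. pdiff l (pdiff k f) (y n k l)) \<longlonglongrightarrow> pdiff l (pdiff k f) x" for k l
  proof -
    have "continuous_on UNIV (pdiff l (pdiff k f))" by (intro smooth_continuous smooth_pdiff f)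
    then have c: "isCont (pdiff l (pdiff k f)) x" by (simp add: continuous_on_eq_continuous_at)
    have "(\<lambda>n. dist (y n k l) x) \<longlonglongrightarrow> 0"
      by (rule tendsto_sandwich[OF _ _ tendsto_const h0]) (use y in auto)
    then have "(\<lambda>n. y n k l) \<longlonglongrightarrow> x" by (rule tendsto_dist_iff[THEN iffD2])
    then show ?thesis by (rule isCont_tendsto_compose[OF c])
  qed
  have "pdiff j (pdiff i f) (y n i j) = pdiff i (pdiff j f) (y n j i)" for n
  proof -
    have "x + h n *\<^sub>R axis i 1 + h n *\<^sub>R axis j 1 = x + h n *\<^sub>R axis j 1 + h n *\<^sub>R axis i 1"
      by (simp add: algebra_simps)
    from arg_cong[OF this, of f]
    have "h n * (h n * pdiff j (pdiff i f) (y n i j)) = h n * (h n * pdiff i (pdiff j f) (y n j i))"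
      using eq[of n i j] eq[of n j i] by linarith
    then show ?thesis using h[of n] by simp
  qed
  then have "(\<lambda>n. pdiff j (pdiff i f) (y n i j)) \<longlonglongrightarrow> pdiff i (pdiff j f) x"
    using lim[of i j] by simp
  then show ?thesis using lim[of j i] LIMSEQ_unique by blast
qed


section \<open>The measure of boundary layers\<close>

lemma closed_lebesgue: "closed (S :: 'a::euclidean_space set) \<Longrightarrow> S \<in> sets lebesgue"
  by (metis borel_closed sets_completionI_sets sets_lborel)

text \<open>A slab of half-width \<open>t\<close> around the graph of \<open>g\<close> over the hyperplane orthogonal to \<open>e\<close>, cut off by a
ball.  Its translates by multiples of \<open>3 * t\<close> in direction \<open>e\<close> are pairwise disjoint, and about
\<open>1 / (3 * t)\<close> of them fit into the ball of radius \<open>r + 1\<close>, so each of them has measure \<open>O(t)\<close>.\<close>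

lemma graph_slab_measure:
  fixes g :: "'a::euclidean_space \<Rightarrow> real"
  assumes e: "norm e = 1" and g: "continuous_on UNIV g"
    and inv: "\<And>x t. g (x + t *\<^sub>R e) = g x" and t: "0 < t" "t \<le> 1 / 6"
  shows "{x \<in> ball p r. \<bar>x \<bullet> e - g x\<bar> \<le> t} \<in> lmeasurable" (is "?S \<in> _")
    and "measure lebesgue {x \<in> ball p r. \<bar>x \<bullet> e - g x\<bar> \<le> t} \<le> 6 * measure lebesgue (ball p (r + 1)) * t"
proof -
  have "closed {x. \<bar>x \<bullet> e - g x\<bar> \<le> t}"
    using g by (intro closed_Collect_le continuous_intros)
  then have "{x. \<bar>x \<bullet> e - g x\<bar> \<le> t} \<in> sets lebesgue" by (rule closed_lebesgue)
  moreover have "?S = ball p r \<inter> {x. \<bar>x \<bullet> e - g x\<bar> \<le> t}" by auto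
  ultimately show S: "?S \<in> lmeasurable"
    by (metis fmeasurable_Int_fmeasurable lmeasurable_ball)
  \<comment> \<open>the number of shifts by multiples of \<open>3 * t\<close> that move a point by at most \<open>1\<close>\<close>
  define N where "N = nat \<lfloor>1 / (3 * t)\<rfloor>"
  have N: "real N \<le> 1 / (3 * t)" "1 / (6 * t) \<le> real N"
  proof -
    have "1 / (3 * t) \<ge> 2" using t by (simp add: field_simps)
    then have "real N = of_int \<lfloor>1 / (3 * t)\<rfloor>" unfolding N_def by linarith
    moreover have "1 / (6 * t) \<le> 1 / (3 * t) - 1" using t by (simp add: field_simps)
    ultimately show "real N \<le> 1 / (3 * t)" "1 / (6 * t) \<le> real N" by linarith+
  qed
  let ?T = "\<lambda>j::nat. (+) ((3 * t * real j) *\<^sub>R e) ` ?S"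
  have ee: "e \<bullet> e = 1" using e by (simp add: norm_eq_1)
  \<comment> \<open>the shift is read off from the height over the graph, so different shifts cannot meet\<close>
  have height: "\<bar>(x \<bullet> e - g x) - 3 * t * real j\<bar> \<le> t" if "x \<in> ?T j" for x j
    using that inv[of _ "3 * t * real j"] ee by (auto simp: inner_add_left add.commute)
  have "i = j" if "x \<in> ?T i" "x \<in> ?T j" for x i j
  proof -
    have "\<bar>3 * t * real i - 3 * t * real j\<bar> \<le> 2 * t"
      using height[OF that(1)] height[OF that(2)] by linarith
    moreover have "3 * t * real i - 3 * t * real j = t * (3 * (real i - real j))"
      by (simp add: algebra_simps)
    ultimately have "t * (3 * \<bar>real i - real j\<bar>) \<le> t * 2"
      using t by (simp add: abs_mult)
    then have "3 * \<bar>real i - real j\<bar> \<le> 2" using t by simp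
    moreover have "real a + 1 \<le> real b" if "a < b" for a b :: nat using that by linarith
    ultimately have "\<not> i < j" "\<not> j < i" by (fastforce simp: abs_le_iff)+
    then show ?thesis by simp
  qed
  then have disj: "pairwise (\<lambda>i j. disjnt (?T i) (?T j)) {..<N}"
    unfolding pairwise_def disjnt_iff by blast
  have sub: "(\<Union>j<N. ?T j) \<subseteq> ball p (r + 1)"
  proof
    fix x assume "x \<in> (\<Union>j<N. ?T j)"
    then obtain j y where j: "j < N" and y: "y \<in> ball p r" and x: "x = (3 * t * real j) *\<^sub>R e + y"
      by auto
    have "3 * t * real j \<le> 3 * t * real N" using j t by simp
    also have "\<dots> \<le> 1" using N(1) t by (simp add: field_simps)
    finally have "dist x y \<le> 1" using e t by (simp add: x dist_norm)
    then show "x \<in> ball p (r + 1)"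
      using y dist_triangle[of p x y] by (auto simp: dist_commute)
  qed
  have T: "?T j \<in> lmeasurable" for j
    using measurable_translation[OF S] .
  have "real N * measure lebesgue ?S = (\<Sum>j<N. measure lebesgue (?T j))"
    by (simp add: measure_translation)
  also have "\<dots> = measure lebesgue (\<Union>j<N. ?T j)"
    using measure_UNION'[OF _ T disj] by simp
  also have "\<dots> \<le> measure lebesgue (ball p (r + 1))"
    using sub T by (intro measure_mono_fmeasurable) (auto intro: fmeasurable.finite_UN)
  finally have "real N * measure lebesgue ?S \<le> measure lebesgue (ball p (r + 1))" .
  moreover have "1 / (6 * t) * measure lebesgue ?S \<le> real N * measure lebesgue ?S"
    using N(2) by (intro mult_right_mono) auto
  ultimately have "1 / (6 * t) * measure lebesgue ?S \<le> measure lebesgue (ball p (r + 1))"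
    by (rule order_trans[rotated])
  then show "measure lebesgue ?S \<le> 6 * measure lebesgue (ball p (r + 1)) * t"
    using t by (simp add: field_simps)
qed

lemma Ck_Lipschitz_cball:
  fixes f :: "'a::euclidean_space \<Rightarrow> real"
  assumes f: "Ck (Suc k) f"
  obtains M where "M \<ge> 0" "\<And>x y. x \<in> cball a R \<Longrightarrow> y \<in> cball a R \<Longrightarrow> \<bar>f x - f y\<bar> \<le> M * norm (x - y)"
proof -
  let ?D = "\<lambda>x. frechet_derivative f (at x)"
  have D: "(f has_derivative ?D x) (at x)" for x
    using Ck_Suc_has_derivative[OF f] .
  have "\<exists>M. \<forall>x\<in>cball a R. \<bar>?D x b\<bar> \<le> M" if "b \<in> Basis" for b
  proof -
    have "continuous_on UNIV (\<lambda>x. ?D x b)"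
      using f that by (auto intro: Ck_continuous)
    then have "continuous_on (cball a R) (\<lambda>x. ?D x b)" by (rule continuous_on_subset) auto
    then have "bounded ((\<lambda>x. ?D x b) ` cball a R)"
      by (intro compact_imp_bounded compact_continuous_image) auto
    then show ?thesis by (auto simp: bounded_iff)
  qed
  then obtain M where M: "\<And>b x. b \<in> Basis \<Longrightarrow> x \<in> cball a R \<Longrightarrow> \<bar>?D x b\<bar> \<le> M b" by metis
  define B where "B = (\<Sum>b\<in>Basis. \<bar>M b\<bar>)"
  have "onorm (?D x) \<le> B" if x: "x \<in> cball a R" for x
  proof (rule onorm_le)
    fix h
    have "?D x h = (\<Sum>b\<in>Basis. (h \<bullet> b) * ?D x b)"
      using linear_eq_sum_Basis[OF has_derivative_linear[OF D], of x h] by simp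
    also have "\<bar>\<dots>\<bar> \<le> (\<Sum>b\<in>Basis. \<bar>M b\<bar> * norm h)"
    proof (intro order_trans[OF sum_abs] sum_mono)
      fix b :: 'a assume b: "b \<in> Basis"
      have "\<bar>h \<bullet> b\<bar> * \<bar>?D x b\<bar> \<le> norm h * \<bar>M b\<bar>"
        using M[OF b x] Basis_le_norm[OF b, of h] by (intro mult_mono) auto
      then show "\<bar>(h \<bullet> b) * ?D x b\<bar> \<le> \<bar>M b\<bar> * norm h"
        by (simp add: abs_mult mult.commute)
    qed
    finally show "norm (?D x h) \<le> B * norm h"
      by (simp add: B_def sum_distrib_right)
  qed
  then have "norm (f x - f y) \<le> B * norm (x - y)" if "x \<in> cball a R" "y \<in> cball a R" for x y
    using that differentiable_bound[OF convex_cball has_derivative_at_withinI[OF D], of a R B] by blast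
  moreover have "B \<ge> 0" unfolding B_def by (intro sum_nonneg) auto
  ultimately show thesis using that by auto
qed

text \<open>In a boundary chart the frontier lies on the graph of the chart function, which is Lipschitz on
bounded sets.  Points at distance at most \<open>h\<close> from the frontier therefore lie in a slab of width
\<open>O(h)\<close> around that graph.\<close>

lemma Ck_boundary_local_layer:
  fixes \<Omega> :: "'a::euclidean_space set"
  assumes \<Omega>: "open \<Omega>" "Ck_boundary (Suc k) \<Omega>" and p: "p \<in> frontier \<Omega>"
  shows "\<exists>\<rho> C h0. \<rho> > 0 \<and> h0 > 0 \<and> C \<ge> 0 \<and>
    (\<forall>h. 0 < h \<longrightarrow> h \<le> h0 \<longrightarrow> (\<exists>S\<in>lmeasurable. measure lebesgue S \<le> C * h \<and>
       {x. \<exists>y\<in>frontier \<Omega> \<inter> ball p \<rho>. dist x y \<le> h} \<subseteq> S))"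
proof -
  obtain r e \<gamma> where r: "r > 0" and e: "norm e = 1" and \<gamma>: "Ck (Suc k) \<gamma>"
    and chart: "\<Omega> \<inter> ball p r = {x \<in> ball p r. \<gamma> (x - (x \<bullet> e) *\<^sub>R e) < x \<bullet> e}"
    using \<Omega>(2) p unfolding Ck_boundary_def by blast
  define P where "P = (\<lambda>x. x - (x \<bullet> e) *\<^sub>R e)"
  define g where "g = (\<lambda>x. \<gamma> (P x))"
  have P: "bounded_linear P"
    unfolding P_def by (intro bounded_linear_intros)
  have nP: "norm (P x) \<le> 2 * norm x" for x
    using Cauchy_Schwarz_ineq2[of x e] e norm_triangle_ineq4[of x "(x \<bullet> e) *\<^sub>R e"] by (simp add: P_def)
  have "continuous_on UNIV \<gamma>"
    using \<gamma> by (auto simp: continuous_on_eq_continuous_at differentiable_imp_continuous_within)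
  then have g: "continuous_on UNIV g"
    unfolding g_def by (rule continuous_on_compose2[OF _ linear_continuous_on[OF P]]) auto
  have "e \<bullet> e = 1" using e by (simp add: norm_eq_1)
  then have "P (x + t *\<^sub>R e) = P x" for x t
    by (simp add: P_def inner_add_left algebra_simps)
  then have inv: "g (x + t *\<^sub>R e) = g x" for x t by (simp add: g_def)
  \<comment> \<open>\<open>P\<close> maps the chart ball into this larger ball, as its norm is at most \<open>2\<close>\<close>
  obtain M where M: "M \<ge> 0" "\<And>x y. x \<in> cball 0 (2 * (norm p + r)) \<Longrightarrow> y \<in> cball 0 (2 * (norm p + r)) \<Longrightarrow>
      \<bar>\<gamma> x - \<gamma> y\<bar> \<le> M * norm (x - y)"
    using Ck_Lipschitz_cball[OF \<gamma>] by metis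
  have Lip: "\<bar>g x - g y\<bar> \<le> 2 * M * dist x y" if "x \<in> ball p r" "y \<in> ball p r" for x y
  proof -
    have "norm z \<le> norm p + r" if "z \<in> ball p r" for z
      using that norm_triangle_sub[of z p] by (auto simp: dist_norm norm_minus_commute)
    then have "P z \<in> cball 0 (2 * (norm p + r))" if "z \<in> ball p r" for z
      using nP[of z] that by (smt (verit) mem_cball_0)
    then have "\<bar>g x - g y\<bar> \<le> M * norm (P x - P y)"
      unfolding g_def using M(2) that by blast
    also have "P x - P y = P (x - y)" using P by (simp add: bounded_linear.linear linear_diff)
    also have "M * norm (P (x - y)) \<le> M * (2 * norm (x - y))"
      using nP M(1) by (intro mult_left_mono) auto
    finally show ?thesis by (simp add: dist_norm)
  qed
  have graph: "g y = y \<bullet> e" if y: "y \<in> frontier \<Omega>" "y \<in> ball p r" for y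
  proof (rule antisym)
    have "open {x \<in> ball p r. x \<bullet> e < g x}"
    proof -
      have "open (ball p r \<inter> {x. x \<bullet> e < g x})"
        using g by (intro open_Int open_Collect_less continuous_intros) auto
      then show ?thesis by (simp add: Int_def)
    qed
    moreover have "{x \<in> ball p r. x \<bullet> e < g x} \<inter> \<Omega> = {}"
      using chart unfolding g_def P_def by force
    ultimately have "{x \<in> ball p r. x \<bullet> e < g x} \<inter> closure \<Omega> = {}"
      using open_Int_closure_eq_empty by blast
    then show "g y \<le> y \<bullet> e"
      using y by (force simp: frontier_def)
    have "y \<notin> \<Omega>" using y \<Omega>(1) by (simp add: frontier_def interior_open)
    then show "y \<bullet> e \<le> g y" using y chart unfolding g_def P_def by force
  qed
  \<comment> \<open>a point within \<open>r / 2\<close> of the half ball stays in the chart, and the slab has half-width at most \<open>1 / 6\<close>\<close>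
  define h0 where "h0 = min (r / 2) (1 / (6 * (1 + 2 * M)))"
  show ?thesis
  proof (intro exI conjI allI impI)
    show "r / 2 > 0" "h0 > 0" using r M(1) by (auto simp: h0_def)
    show "6 * measure lebesgue (ball p (r + 1)) * (1 + 2 * M) \<ge> 0" using M(1) by simp
    fix h assume h: "0 < h" "h \<le> h0"
    let ?t = "(1 + 2 * M) * h"
    have t: "0 < ?t" "?t \<le> 1 / 6"
      using h M(1) by (auto simp: h0_def field_simps add_pos_nonneg)
    let ?S = "{x \<in> ball p r. \<bar>x \<bullet> e - g x\<bar> \<le> ?t}"
    have "{x. \<exists>y\<in>frontier \<Omega> \<inter> ball p (r / 2). dist x y \<le> h} \<subseteq> ?S"
    proof clarify
      fix x y assume y: "y \<in> frontier \<Omega>" "y \<in> ball p (r / 2)" and d: "dist x y \<le> h"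
      have yr: "y \<in> ball p r" using y(2) r by auto
      have "dist x y \<le> r / 2" using d h by (simp add: h0_def)
      then have xr: "x \<in> ball p r"
        using y(2) dist_triangle[of p x y] by (simp add: dist_commute)
      have "\<bar>(x - y) \<bullet> e\<bar> \<le> dist x y"
        using Cauchy_Schwarz_ineq2[of "x - y" e] e by (simp add: dist_norm)
      then have "\<bar>x \<bullet> e - g x\<bar> \<le> dist x y + 2 * M * dist x y"
        using graph[OF y(1) yr] Lip[OF xr yr] by (simp add: inner_diff_left)
      also have "\<dots> = (1 + 2 * M) * dist x y" by (simp add: algebra_simps)
      also have "\<dots> \<le> ?t" using d M(1) by (intro mult_left_mono) auto
      finally show "x \<in> ball p r \<and> \<bar>x \<bullet> e - g x\<bar> \<le> ?t" using xr by blast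
    qed
    then show "\<exists>S\<in>lmeasurable. measure lebesgue S \<le> 6 * measure lebesgue (ball p (r + 1)) * (1 + 2 * M) * h \<and>
       {x. \<exists>y\<in>frontier \<Omega> \<inter> ball p (r / 2). dist x y \<le> h} \<subseteq> S"
      using graph_slab_measure[OF e g inv t, of p r] by (intro bexI[of _ ?S] conjI) (simp_all only: mult.assoc)
  qed
qed

lemma nearest_complement_point_frontier:
  fixes \<Omega> :: "'a::euclidean_space set"
  assumes "open \<Omega>" "x \<in> \<Omega>" "- \<Omega> \<noteq> {}"
  obtains y where "y \<in> frontier \<Omega>" "dist x y = infdist x (- \<Omega>)"
proof -
  obtain y where y: "y \<in> - \<Omega>" "infdist x (- \<Omega>) = dist x y"
    using infdist_attains_inf[of "- \<Omega>" x] assms by (auto simp: closed_Compl)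
  have "ball x (dist x y) \<subseteq> \<Omega>"
    using infdist_le[of _ "- \<Omega>" x] y(2) by force
  then have "closure (ball x (dist x y)) \<subseteq> closure \<Omega>" by (rule closure_mono)
  moreover have "dist x y > 0" using y(1) assms(2) by auto
  ultimately have "y \<in> closure \<Omega>" by (simp add: subset_iff)
  then show thesis
    using that[of y] y assms(1) by (simp add: frontier_def interior_open)
qed

lemma layer_measurable:
  fixes \<Omega> :: "'a::euclidean_space set"
  assumes "open \<Omega>" "bounded \<Omega>"
  shows "{x \<in> \<Omega>. infdist x (- \<Omega>) \<le> h} \<in> lmeasurable"
proof -
  have "closed {x. infdist x (- \<Omega>) \<le> h}"
    by (intro closed_Collect_le continuous_intros)
  then have "\<Omega> \<inter> {x. infdist x (- \<Omega>) \<le> h} \<in> lmeasurable"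
    by (intro fmeasurable_Int_fmeasurable lmeasurable_open assms closed_lebesgue)
  then show ?thesis by (simp add: Int_def)
qed

text \<open>Finitely many boundary charts cover the compact frontier, and the layer is contained in the
union of the corresponding local layers.\<close>

lemma layer_measure:
  fixes \<Omega> :: "'a::euclidean_space set"
  assumes dom: "bounded_domain \<Omega>" and bd: "Ck_boundary (Suc k) \<Omega>"
  shows "\<exists>C\<ge>0. \<exists>h0>0. \<forall>h. 0 < h \<and> h \<le> h0 \<longrightarrow>
    measure lebesgue {x \<in> \<Omega>. infdist x (- \<Omega>) \<le> h} \<le> C * h"
proof -
  have \<Omega>: "open \<Omega>" "bounded \<Omega>" using dom by (auto simp: bounded_domain_def)
  have ne: "- \<Omega> \<noteq> {}" using \<Omega>(2) not_bounded_UNIV by (metis Compl_empty_eq double_compl)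
  define good where "good p \<rho> C h0 \<longleftrightarrow> \<rho> > 0 \<and> h0 > 0 \<and> C \<ge> 0 \<and>
    (\<forall>h. 0 < h \<longrightarrow> h \<le> h0 \<longrightarrow> (\<exists>S\<in>lmeasurable. measure lebesgue S \<le> C * h \<and>
       {x. \<exists>y\<in>frontier \<Omega> \<inter> ball p \<rho>. dist x y \<le> h} \<subseteq> S))" for p :: 'a and \<rho> C h0 :: real
  have "\<exists>\<rho> C h0. good p \<rho> C h0" if "p \<in> frontier \<Omega>" for p
    unfolding good_def by (rule Ck_boundary_local_layer[OF \<Omega>(1) bd that])
  then obtain \<rho> C h0 where g: "\<And>p. p \<in> frontier \<Omega> \<Longrightarrow> good p (\<rho> p) (C p) (h0 p)" by metis
  have cpt: "compact (frontier \<Omega>)" using \<Omega>(2) by (rule compact_frontier_bounded)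
  have cov: "frontier \<Omega> \<subseteq> (\<Union>p\<in>frontier \<Omega>. ball p (\<rho> p))"
    using g by (force simp: good_def)
  obtain F where F: "F \<subseteq> frontier \<Omega>" "finite F" "frontier \<Omega> \<subseteq> (\<Union>p\<in>F. ball p (\<rho> p))"
    by (rule compactE_image[OF cpt open_ball cov])
  define H where "H = Min (insert 1 (h0 ` F))"
  have H: "H > 0" "\<And>p. p \<in> F \<Longrightarrow> H \<le> h0 p"
    unfolding H_def using F g by (auto simp: good_def subset_iff)
  show ?thesis
  proof (intro exI conjI allI impI)
    show "(\<Sum>p\<in>F. C p) \<ge> 0" using g F by (intro sum_nonneg) (auto simp: good_def)
    show "H > 0" by fact
    fix h assume "0 < h \<and> h \<le> H"
    then have h: "0 < h" "h \<le> H" by auto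
    have "\<exists>S. S \<in> lmeasurable \<and> measure lebesgue S \<le> C p * h \<and>
       {x. \<exists>y\<in>frontier \<Omega> \<inter> ball p (\<rho> p). dist x y \<le> h} \<subseteq> S" if "p \<in> F" for p
      using g[of p] H(2)[OF that] h that F(1) unfolding good_def by (meson order_trans subsetD)
    then have "\<forall>p\<in>F. \<exists>S. S \<in> lmeasurable \<and> measure lebesgue S \<le> C p * h \<and>
       {x. \<exists>y\<in>frontier \<Omega> \<inter> ball p (\<rho> p). dist x y \<le> h} \<subseteq> S" by blast
    from bchoice[OF this] obtain S where S': "\<forall>p\<in>F. S p \<in> lmeasurable \<and> measure lebesgue (S p) \<le> C p * h \<and>
       {x. \<exists>y\<in>frontier \<Omega> \<inter> ball p (\<rho> p). dist x y \<le> h} \<subseteq> S p" ..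
    then have S: "\<And>p. p \<in> F \<Longrightarrow> S p \<in> lmeasurable" "\<And>p. p \<in> F \<Longrightarrow> measure lebesgue (S p) \<le> C p * h"
      by simp_all
    have sub: "{x \<in> \<Omega>. infdist x (- \<Omega>) \<le> h} \<subseteq> (\<Union>p\<in>F. S p)"
    proof clarify
      fix x assume x: "x \<in> \<Omega>" "infdist x (- \<Omega>) \<le> h"
      obtain y where y: "y \<in> frontier \<Omega>" "dist x y = infdist x (- \<Omega>)"
        using nearest_complement_point_frontier[OF \<Omega>(1) x(1) ne] .
      obtain p where p: "p \<in> F" "y \<in> ball p (\<rho> p)" using F(3) y(1) by blast
      have "x \<in> {x. \<exists>y\<in>frontier \<Omega> \<inter> ball p (\<rho> p). dist x y \<le> h}"
        using y x(2) p(2) by (intro CollectI bexI[of _ y]) simp_all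
      with S' p(1) have "x \<in> S p" by (meson subsetD)
      with p(1) show "x \<in> (\<Union>p\<in>F. S p)" by (rule UN_I)
    qed
    have "measure lebesgue {x \<in> \<Omega>. infdist x (- \<Omega>) \<le> h} \<le> measure lebesgue (\<Union>p\<in>F. S p)"
      using sub S F layer_measurable[OF \<Omega>]
      by (intro measure_mono_fmeasurable) (auto intro: fmeasurable.finite_UN)
    also have "\<dots> \<le> (\<Sum>p\<in>F. measure lebesgue (S p))"
      using F S by (intro measure_UNION_le) auto
    also have "\<dots> \<le> (\<Sum>p\<in>F. C p * h)" using S by (intro sum_mono) auto
    finally show "measure lebesgue {x \<in> \<Omega>. infdist x (- \<Omega>) \<le> h} \<le> (\<Sum>p\<in>F. C p) * h"
      by (simp add: sum_distrib_right)
  qed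
qed


section \<open>A smooth step function\<close>

text \<open>The functions \<open>x\<^sup>-\<^sup>n exp (- 1 / x)\<close>, extended by \<open>0\<close> to the left half-line: together they are closed
under differentiation, which makes the case \<open>n = 0\<close> infinitely differentiable.\<close>

definition exp_recip :: "nat \<Rightarrow> real \<Rightarrow> real" where
  "exp_recip n x = (if x > 0 then (1 / x) ^ n * exp (- (1 / x)) else 0)"

lemma exp_recip_tendsto_0: "(exp_recip n \<longlongrightarrow> 0) (at_right 0)"
proof -
  have "((\<lambda>x. (1 / x) ^ n / exp (1 / x)) \<longlongrightarrow> (0::real)) (at_right 0)"
    using filterlim_compose[OF tendsto_power_div_exp_0 filterlim_inverse_at_top_right, of n]
    by (simp add: inverse_eq_divide)
  then show ?thesis
    by (rule Lim_transform_eventually)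
      (auto simp: eventually_at_right_field exp_recip_def exp_minus field_simps intro!: exI[of _ 1])
qed

lemma exp_recip_has_derivative:
  "(exp_recip n has_field_derivative (exp_recip (n + 2) x - real n * exp_recip (n + 1) x)) (at x)"
proof -
  consider "x > 0" | "x < 0" | "x = 0" by linarith
  then show ?thesis
  proof cases
    case 1
    have recip: "((\<lambda>x. 1 / x) has_field_derivative - (1 / x)\<^sup>2) (at x)"
      using 1 by (auto intro!: derivative_eq_intros simp: power2_eq_square)
    have pw: "real n * (- q\<^sup>2 * q ^ (n - Suc 0)) = - real n * q ^ (n + 1)" for q :: real
      by (cases n) (simp_all add: power2_eq_square algebra_simps)
    have eq: "- real n * q ^ (n + 1) * E + E * q\<^sup>2 * q ^ n =
        q ^ (n + 2) * E - real n * (q ^ (n + 1) * E)" for q E :: real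
      by (simp add: algebra_simps power2_eq_square)
    have "((\<lambda>x. (1 / x) ^ n) has_field_derivative - real n * (1 / x) ^ (n + 1)) (at x)"
      by (rule DERIV_cong[OF DERIV_power[OF recip]]) (rule pw)
    moreover have "((\<lambda>x. exp (- (1 / x))) has_field_derivative exp (- (1 / x)) * (1 / x)\<^sup>2) (at x)"
      by (rule DERIV_cong[OF DERIV_chain2[OF DERIV_exp DERIV_minus[OF recip]]]) simp
    ultimately have "((\<lambda>x. (1 / x) ^ n * exp (- (1 / x))) has_field_derivative
        (1 / x) ^ (n + 2) * exp (- (1 / x)) - real n * ((1 / x) ^ (n + 1) * exp (- (1 / x)))) (at x)"
      by (rule DERIV_cong[OF DERIV_mult]) (rule eq)
    then have "(exp_recip n has_field_derivative
        (1 / x) ^ (n + 2) * exp (- (1 / x)) - real n * ((1 / x) ^ (n + 1) * exp (- (1 / x)))) (at x)"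
      by (rule has_field_derivative_transform_within_open[where S="{0<..}"])
        (use 1 in \<open>auto simp: exp_recip_def\<close>)
    then show ?thesis
      using 1 by (simp add: exp_recip_def)
  next
    case 2
    have "((\<lambda>x. 0) has_field_derivative (0::real)) (at x)" by simp
    then have "(exp_recip n has_field_derivative 0) (at x)"
      using 2 by (rule_tac has_field_derivative_transform_within_open[where S="{..<0}"])
        (auto simp: exp_recip_def)
    then show ?thesis using 2 by (simp add: exp_recip_def)
  next
    case 3
    have "((\<lambda>y. exp_recip n y / y) \<longlongrightarrow> 0) (at_right 0)"
      by (rule Lim_transform_eventually[OF exp_recip_tendsto_0[of "Suc n"]])
        (auto simp: eventually_at_right_field exp_recip_def intro!: exI[of _ 1])
    moreover have "((\<lambda>y. exp_recip n y / y) \<longlongrightarrow> 0) (at_left 0)"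
      by (rule Lim_transform_eventually[OF tendsto_const])
        (auto simp: eventually_at_left_field exp_recip_def intro!: exI[of _ "-1"])
    ultimately have "((\<lambda>y. exp_recip n y / y) \<longlongrightarrow> 0) (at 0)"
      by (simp add: filterlim_split_at)
    then show ?thesis
      using 3 by (simp add: has_field_derivative_iff exp_recip_def)
  qed
qed

lemma smooth_exp_recip: "smooth (exp_recip n)"
proof -
  \<comment> \<open>the induction needs all \<open>n\<close> at once, as differentiation raises \<open>n\<close>\<close>
  have "Ck k (exp_recip n)" for k
  proof (induction k arbitrary: n)
    case 0
    show ?case
      using DERIV_isCont[OF exp_recip_has_derivative] by (simp add: continuous_on_eq_continuous_at)
  next
    case (Suc k)
    have "Ck k (\<lambda>x. exp_recip (n + 2) x + (- real n) * exp_recip (n + 1) x)"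
      by (intro Ck_add Ck_mult Ck_const Suc)
    then show ?case
      by (intro Ck_SucI[where D="\<lambda>x. (*) (exp_recip (n + 2) x - real n * exp_recip (n + 1) x)"])
        (use exp_recip_has_derivative in \<open>auto simp: has_field_derivative_def\<close>)
  qed
  then show ?thesis by (simp add: smooth_def)
qed

text \<open>The usual smooth transition from \<open>0\<close> on the left of \<open>0\<close> to \<open>1\<close> on the right of \<open>1\<close>.\<close>

definition smooth_step :: "real \<Rightarrow> real" where
  "smooth_step x = exp_recip 0 x * inverse (exp_recip 0 x + exp_recip 0 (1 - x))"

lemma exp_recip_0: "exp_recip 0 x \<ge> 0" "exp_recip 0 x > 0 \<longleftrightarrow> x > 0"
  by (auto simp: exp_recip_def)

lemma smooth_step_denominator: "exp_recip 0 x + exp_recip 0 (1 - x) > 0"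
  by (smt (verit) exp_recip_0)

lemma smooth_smooth_step: "smooth smooth_step"
proof -
  have "smooth (\<lambda>x. exp_recip 0 ((- x) + 1))"
    by (intro smooth_affine smooth_exp_recip bounded_linear_minus bounded_linear_ident)
  then have "smooth (\<lambda>x. exp_recip 0 x * inverse (exp_recip 0 x + exp_recip 0 (1 - x)))"
    by (intro smooth_mult smooth_inverse smooth_add smooth_exp_recip)
      (auto simp: smooth_step_denominator less_imp_neq[symmetric])
  then show ?thesis by (simp add: smooth_step_def[abs_def])
qed

lemma smooth_step_simps:
  "x \<le> 0 \<Longrightarrow> smooth_step x = 0" "x \<ge> 1 \<Longrightarrow> smooth_step x = 1"
  using smooth_step_denominator[of x] by (auto simp: smooth_step_def exp_recip_def)


section \<open>Lattice partitions of unity and cut-off functions\<close>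

text \<open>A bump supported in \<open>[-1, 1]\<close>, written as a difference so that the sum of its integer translates
telescopes to \<open>1\<close>.\<close>

definition hat :: "real \<Rightarrow> real" where
  "hat t = smooth_step (t + 1) - smooth_step t"

lemma smooth_hat: "smooth hat"
proof -
  have "smooth (\<lambda>t. smooth_step (t + 1) - smooth_step t)"
    by (intro smooth_diff smooth_affine smooth_smooth_step bounded_linear_ident)
  then show ?thesis by (simp add: hat_def[abs_def])
qed

lemma hat_eq_0: "\<bar>t\<bar> > 1 \<Longrightarrow> hat t = 0"
  by (cases "t \<ge> 0") (auto simp: hat_def smooth_step_simps)

lemma sum_hat:
  assumes "of_int a \<le> y" "y \<le> of_int b"
  shows "(\<Sum>m=a..b. hat (y - of_int m)) = 1"
proof -
  have "(\<Sum>m=a..a + int n. hat (y - of_int m)) = smooth_step (y - of_int a + 1) - smooth_step (y - of_int (a + int n))" for n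
  proof (induction n)
    case (Suc n)
    have "{a..a + int (Suc n)} = insert (a + int n + 1) {a..a + int n}" by auto
    with Suc show ?case by (simp add: hat_def algebra_simps)
  qed (simp add: hat_def)
  from this[of "nat (b - a)"]
  have "(\<Sum>m=a..b. hat (y - of_int m)) = smooth_step (y - of_int a + 1) - smooth_step (y - of_int b)"
    using assms by simp
  then show ?thesis using assms by (simp add: smooth_step_simps)
qed

definition cell_bump :: "real^'d \<Rightarrow> real" where
  "cell_bump x = (\<Prod>i\<in>UNIV. hat (x $ i))"

lemma smooth_cell_bump: "smooth (cell_bump :: real^'d \<Rightarrow> real)"
proof -
  have "smooth (\<lambda>x::real^'d. hat (x $ i + 0))" for i
    by (intro smooth_affine smooth_hat bounded_linear_vec_nth)
  then have "smooth (\<lambda>x::real^'d. \<Prod>i\<in>UNIV. hat (x $ i))"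
    by (intro smooth_prod) simp
  then show ?thesis by (simp add: cell_bump_def[abs_def])
qed

text \<open>The class of functions smooth with support in the cube \<open>[-1, 1]\<^sup>d\<close>.  It is closed under differentiation, so
that one estimate for sums of lattice translates covers the partition of unity and all its
derivatives.\<close>

definition cell_supported :: "(real^'d \<Rightarrow> real) \<Rightarrow> bool" where
  "cell_supported Y \<longleftrightarrow> smooth Y \<and> (\<forall>x. (\<exists>i. \<bar>x $ i\<bar> > 1) \<longrightarrow> Y x = 0)"

lemma cell_supported_cell_bump: "cell_supported cell_bump"
  unfolding cell_supported_def by (auto simp: smooth_cell_bump cell_bump_def) (use hat_eq_0 in blast)

lemma cell_supported_directional:
  assumes "cell_supported Y"
  shows "cell_supported (\<lambda>x. frechet_derivative Y (at x) v)"
  unfolding cell_supported_def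
proof (intro conjI allI impI)
  show "smooth (\<lambda>x. frechet_derivative Y (at x) v)"
    using assms by (intro smooth_directional) (simp add: cell_supported_def)
  fix x :: "real^'a" assume "\<exists>i. \<bar>x $ i\<bar> > 1"
  then obtain i where i: "\<bar>x $ i\<bar> > 1" by blast
  have "open {x::real^'a. \<bar>x $ i\<bar> > 1}"
    by (intro open_Collect_less continuous_intros)
  then show "frechet_derivative Y (at x) v = 0"
    by (rule frechet_derivative_zero_on_open[where c=0]) (use i assms in \<open>auto simp: cell_supported_def\<close>)
qed

lemma cell_supported_pdiff: "cell_supported Y \<Longrightarrow> cell_supported (pdiff i Y)"
  unfolding pdiff_def[abs_def] by (rule cell_supported_directional)

definition lattice_point :: "('d \<Rightarrow> int) \<Rightarrow> real^'d" where
  "lattice_point k = (\<chi> i. of_int (k i))"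

lemma lattice_point_nth [simp]: "lattice_point k $ i = of_int (k i)"
  by (simp add: lattice_point_def)

text \<open>The bound does not depend on the index set \<open>K\<close>, since at most \<open>3\<^sup>d\<close> translates are nonzero at
any point.\<close>

lemma sum_translates_bounded:
  fixes Y :: "real^'d::finite \<Rightarrow> real"
  assumes Y: "cell_supported Y"
  shows "\<exists>M\<ge>0. \<forall>K x. finite K \<longrightarrow> \<bar>\<Sum>k\<in>K. Y (x - lattice_point k)\<bar> \<le> M"
proof -
  have "bounded (Y ` cbox (- 1) 1)"
    using Y by (intro compact_imp_bounded compact_continuous_image smooth_continuous)
      (auto simp: cell_supported_def)
  then obtain B where B: "\<And>x. x \<in> cbox (- 1) 1 \<Longrightarrow> \<bar>Y x\<bar> \<le> B" by (auto simp: bounded_iff)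
  have bd: "\<bar>Y x\<bar> \<le> \<bar>B\<bar>" for x
  proof (cases "x \<in> cbox (- 1) 1")
    case False
    then obtain i where "\<not> \<bar>x $ i\<bar> \<le> 1" by (auto simp: mem_box_cart abs_le_iff)
    then have "Y x = 0" using Y unfolding cell_supported_def by (meson not_le)
    then show ?thesis by simp
  qed (use B in force)
  let ?n = "3 ^ CARD('d)"
  show ?thesis
  proof (intro exI conjI allI impI)
    show "real ?n * \<bar>B\<bar> \<ge> 0" by simp
    fix K :: "('d \<Rightarrow> int) set" and x :: "real^'d" assume K: "finite K"
    \<comment> \<open>the lattice points whose cubes of side \<open>2\<close> contain \<open>x\<close>: at most three choices in each coordinate\<close>
    let ?J = "PiE UNIV (\<lambda>i. {\<lceil>x $ i - 1\<rceil>..\<lfloor>x $ i + 1\<rfloor>})"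
    have fin: "finite ?J" by (intro finite_PiE) auto
    have "card ?J = (\<Prod>i\<in>UNIV. card {\<lceil>x $ i - 1\<rceil>..\<lfloor>x $ i + 1\<rfloor>})"
      by (intro card_PiE) auto
    also have "\<dots> \<le> (\<Prod>i\<in>(UNIV::'d set). 3)"
    proof (intro prod_mono conjI)
      fix i :: 'd
      have "\<lfloor>x $ i\<rfloor> \<le> \<lceil>x $ i\<rceil>" by linarith
      then show "card {\<lceil>x $ i - 1\<rceil>..\<lfloor>x $ i + 1\<rfloor>} \<le> 3" by (simp add: nat_le_iff)
    qed simp
    finally have card: "card ?J \<le> ?n" by simp
    have "Y (x - lattice_point k) = 0" if "k \<notin> ?J" for k
    proof -
      from that obtain i where "k i \<notin> {\<lceil>x $ i - 1\<rceil>..\<lfloor>x $ i + 1\<rfloor>}"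
        unfolding PiE_UNIV_domain Pi_iff by blast
      then have "\<bar>(x - lattice_point k) $ i\<bar> > 1" by simp linarith
      then show ?thesis using Y unfolding cell_supported_def by blast
    qed
    then have "(\<Sum>k\<in>K. Y (x - lattice_point k)) = (\<Sum>k\<in>K \<inter> ?J. Y (x - lattice_point k))"
      using K by (intro sum.mono_neutral_right) auto
    also have "\<bar>\<dots>\<bar> \<le> (\<Sum>k\<in>K \<inter> ?J. \<bar>B\<bar>)"
      using bd by (intro order_trans[OF sum_abs] sum_mono)
    also have "\<dots> \<le> real ?n * \<bar>B\<bar>"
      using card card_mono[OF fin, of "K \<inter> ?J"] by (simp add: mult_right_mono)
    finally show "\<bar>\<Sum>k\<in>K. Y (x - lattice_point k)\<bar> \<le> real ?n * \<bar>B\<bar>" .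
  qed
qed

text \<open>The sum over all lattice points near \<open>x\<close> is a product of telescoping one-dimensional sums.\<close>

lemma sum_cell_bump:
  fixes x :: "real^'d::finite"
  assumes K: "finite K" "\<And>k. (\<forall>i. \<bar>x $ i - of_int (k i)\<bar> \<le> 1) \<Longrightarrow> k \<in> K"
  shows "(\<Sum>k\<in>K. cell_bump (x - lattice_point k)) = 1"
proof -
  let ?J = "PiE UNIV (\<lambda>i. {\<lfloor>x $ i\<rfloor>..\<lceil>x $ i\<rceil>})"
  let ?I = "{k. \<forall>i. \<bar>x $ i - of_int (k i)\<bar> \<le> 1}"
  have J: "?J \<subseteq> ?I"
  proof clarify
    fix k i assume "k \<in> ?J"
    then have "k i \<in> {\<lfloor>x $ i\<rfloor>..\<lceil>x $ i\<rceil>}" by auto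
    then show "\<bar>x $ i - of_int (k i)\<bar> \<le> 1" by simp linarith
  qed
  have zero: "cell_bump (x - lattice_point k) = 0" if "k \<notin> ?J" for k
  proof -
    from that obtain i where "k i \<notin> {\<lfloor>x $ i\<rfloor>..\<lceil>x $ i\<rceil>}"
      unfolding PiE_UNIV_domain Pi_iff by blast
    then have "k i < \<lfloor>x $ i\<rfloor> \<or> k i > \<lceil>x $ i\<rceil>" by auto
    then have "\<bar>x $ i - of_int (k i)\<bar> \<ge> 1" by linarith
    then have "hat (x $ i - of_int (k i)) = 0"
      by (cases "x $ i - of_int (k i) \<ge> 0") (auto simp: hat_def smooth_step_simps)
    then show ?thesis unfolding cell_bump_def by (intro prod_zero) auto
  qed
  have "(\<Sum>k\<in>K. cell_bump (x - lattice_point k)) = (\<Sum>k\<in>?J. cell_bump (x - lattice_point k))"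
    using J K zero by (intro sum.mono_neutral_right) auto
  also have "\<dots> = (\<Prod>i\<in>UNIV. \<Sum>m\<in>{\<lfloor>x $ i\<rfloor>..\<lceil>x $ i\<rceil>}. hat (x $ i - of_int m))"
    by (subst prod_sum_PiE) (auto simp: cell_bump_def)
  also have "\<dots> = 1" by (simp add: sum_hat)
  finally show ?thesis .
qed

definition cube :: "real \<Rightarrow> ('d \<Rightarrow> int) \<Rightarrow> (real^'d) set" where
  "cube h k = {x. \<forall>i. \<bar>x $ i / h - of_int (k i)\<bar> \<le> 1}"

text \<open>A translate of \<open>Y\<close>, rescaled to the mesh size \<open>h\<close>, is placed at every lattice point in \<open>A\<close>.  If
\<open>Y\<close> is supported in \<open>[-1, 1]\<^sup>d\<close>, then the summand at \<open>k\<close> is supported in \<^term>\<open>cube h k\<close>.\<close>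

definition lattice_sum :: "real \<Rightarrow> ('d \<Rightarrow> int) set \<Rightarrow> (real^'d \<Rightarrow> real) \<Rightarrow> real^'d \<Rightarrow> real" where
  "lattice_sum h A Y x = (\<Sum>k\<in>A. Y ((1 / h) *\<^sub>R x - lattice_point k))"

lemma smooth_lattice_sum: "cell_supported Y \<Longrightarrow> smooth (lattice_sum h A Y)"
  unfolding lattice_sum_def[abs_def]
  by (intro smooth_sum smooth_scaled_shift) (simp add: cell_supported_def)

lemma pdiff_lattice_sum:
  assumes "cell_supported Y"
  shows "pdiff i (lattice_sum h A Y) = (\<lambda>x. (1 / h) * lattice_sum h A (pdiff i Y) x)"
proof
  fix x
  have Y: "smooth Y" using assms by (simp add: cell_supported_def)
  show "pdiff i (lattice_sum h A Y) x = (1 / h) * lattice_sum h A (pdiff i Y) x"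
    unfolding lattice_sum_def[abs_def] pdiff_def
    by (subst frechet_derivative_sum)
      (simp_all add: smooth_scaled_shift Y frechet_derivative_scaled_shift sum_divide_distrib)
qed

lemma lattice_sum_bounded:
  assumes "cell_supported (Y :: real^'d::finite \<Rightarrow> real)"
  shows "\<exists>M\<ge>0. \<forall>h A x. finite A \<longrightarrow> \<bar>lattice_sum h A Y x\<bar> \<le> M"
  using sum_translates_bounded[OF assms] unfolding lattice_sum_def by blast

lemma dist_cube:
  fixes x y :: "real^'d::finite" and h :: real
  assumes "h > 0" "x \<in> cube h k" "y \<in> cube h k"
  shows "dist x y \<le> 2 * CARD('d) * h"
proof -
  have "\<bar>(x - y) $ i\<bar> \<le> 2 * h" for i
  proof -
    have "\<bar>x $ i / h - of_int (k i)\<bar> \<le> 1" "\<bar>y $ i / h - of_int (k i)\<bar> \<le> 1"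
      using assms by (auto simp: cube_def)
    then have "\<bar>x $ i / h - y $ i / h\<bar> \<le> 2" by linarith
    moreover have "x $ i / h - y $ i / h = (x - y) $ i / h" by (simp add: diff_divide_distrib)
    ultimately show ?thesis using assms(1) by (simp add: field_simps)
  qed
  then have "(\<Sum>i\<in>UNIV. \<bar>(x - y) $ i\<bar>) \<le> (\<Sum>i\<in>(UNIV::'d set). 2 * h)"
    by (intro sum_mono)
  then show ?thesis
    using norm_le_l1_cart[of "x - y"] by (simp add: dist_norm algebra_simps)
qed

lemma compact_cube:
  fixes k :: "'d::finite \<Rightarrow> int"
  assumes "h > 0"
  shows "compact (cube h k)"
proof -
  have "\<bar>t / h - of_int m\<bar> \<le> 1 \<longleftrightarrow> h * (of_int m - 1) \<le> t \<and> t \<le> h * (of_int m + 1)" for t m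
    using assms by (auto simp: abs_le_iff field_simps)
  then have "cube h k = cbox (\<chi> i. h * (of_int (k i) - 1)) (\<chi> i. h * (of_int (k i) + 1))"
    by (auto simp: cube_def mem_box_cart)
  then show ?thesis by simp
qed

lemma finite_cubes_meeting:
  fixes S :: "(real^'d::finite) set"
  assumes "bounded S" and h: "(h::real) > 0"
  shows "finite {k. cube h k \<inter> S \<noteq> {}}"
proof -
  obtain R where R: "\<And>x. x \<in> S \<Longrightarrow> norm x \<le> R" using assms(1) by (auto simp: bounded_iff)
  let ?N = "\<lceil>R / h + 1\<rceil>"
  have "{k. cube h k \<inter> S \<noteq> {}} \<subseteq> PiE UNIV (\<lambda>i::'d. {- ?N..?N})"
  proof
    fix k assume "k \<in> {k. cube h k \<inter> S \<noteq> {}}"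
    then obtain x where x: "x \<in> cube h k" "x \<in> S" by blast
    have "k i \<in> {- ?N..?N}" for i
    proof -
      have "\<bar>x $ i / h\<bar> \<le> R / h"
        using divide_right_mono[OF order_trans[OF component_le_norm_cart R[OF x(2)]], of h i] h by simp
      moreover have "\<bar>x $ i / h - of_int (k i)\<bar> \<le> 1" using x(1) by (simp add: cube_def)
      ultimately have "\<bar>of_int (k i)\<bar> \<le> R / h + 1" by linarith
      then show ?thesis by (simp add: abs_le_iff) linarith
    qed
    then show "k \<in> PiE UNIV (\<lambda>i::'d. {- ?N..?N})" by auto
  qed
  then show ?thesis by (rule finite_subset) (intro finite_PiE; simp)
qed

lemma lattice_sum_support:
  fixes Y :: "real^'d::finite \<Rightarrow> real"
  assumes "cell_supported Y" "h > 0" "finite A"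
  shows "lattice_sum h A Y x \<noteq> 0 \<Longrightarrow> x \<in> (\<Union>k\<in>A. cube h k)"
    and "closure {x. lattice_sum h A Y x \<noteq> 0} \<subseteq> (\<Union>k\<in>A. cube h k)"
    and "compact (closure {x. lattice_sum h A Y x \<noteq> 0})"
proof -
  have *: "x \<in> (\<Union>k\<in>A. cube h k)" if nz: "lattice_sum h A Y x \<noteq> 0" for x
  proof -
    obtain k where k: "k \<in> A" "Y ((1 / h) *\<^sub>R x - lattice_point k) \<noteq> 0"
      by (rule sum.not_neutral_contains_not_neutral[OF nz[unfolded lattice_sum_def]])
    then have "\<forall>i. \<not> \<bar>((1 / h) *\<^sub>R x - lattice_point k) $ i\<bar> > 1"
      using assms(1) unfolding cell_supported_def by blast
    then have "x \<in> cube h k" by (simp add: cube_def not_less)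
    with k(1) show ?thesis by blast
  qed
  then show "lattice_sum h A Y x \<noteq> 0 \<Longrightarrow> x \<in> (\<Union>k\<in>A. cube h k)" .
  have K: "compact (\<Union>k\<in>A. cube h k)"
    using assms compact_cube by (intro compact_UN) auto
  have "{x. lattice_sum h A Y x \<noteq> 0} \<subseteq> (\<Union>k\<in>A. cube h k)"
    using * by blast
  then show 2: "closure {x. lattice_sum h A Y x \<noteq> 0} \<subseteq> (\<Union>k\<in>A. cube h k)"
    using K by (simp add: closure_minimal compact_imp_closed)
  then have "bounded (closure {x. lattice_sum h A Y x \<noteq> 0})"
    using K bounded_subset compact_imp_bounded by blast
  then show "compact (closure {x. lattice_sum h A Y x \<noteq> 0})"
    by (simp add: compact_eq_bounded_closed)
qed

lemma lattice_sum_cell_bump_eq_1: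
  fixes x :: "real^'d::finite"
  assumes "finite A" "\<And>k. x \<in> cube h k \<Longrightarrow> k \<in> A"
  shows "lattice_sum h A cell_bump x = 1"
  unfolding lattice_sum_def using assms by (intro sum_cell_bump) (auto simp: cube_def)

lemma lattice_sum_test_function:
  assumes "cell_supported Y" "h > 0" "finite A" "(\<Union>k\<in>A. cube h k) \<subseteq> \<Omega>"
  shows "lattice_sum h A Y \<in> test_functions \<Omega>"
  unfolding test_functions_iff
  using smooth_lattice_sum[OF assms(1)] lattice_sum_support(3)[OF assms(1-3)]
    subset_trans[OF lattice_sum_support(2)[OF assms(1-3)] assms(4)] by (intro conjI)

text \<open>The bounds are those of a function that rises from \<open>0\<close> to \<open>1\<close> over a distance comparable to \<open>h\<close>,
in a layer of that width along the boundary.  That the derivatives vanish off \<open>L\<close> is recorded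
separately from \<open>\<eta> = 1\<close>, because \<open>L\<close> need not be closed.\<close>

definition boundary_cutoff ::
    "(real^'d::finite) set \<Rightarrow> real \<Rightarrow> real \<Rightarrow> (real^'d \<Rightarrow> real) \<Rightarrow> (real^'d) set \<Rightarrow> bool" where
  "boundary_cutoff \<Omega> C h \<eta> L \<longleftrightarrow>
     \<eta> \<in> test_functions \<Omega> \<and> L \<in> lmeasurable \<and> L \<subseteq> \<Omega> \<and> measure lebesgue L \<le> C * h \<and>
     (\<forall>x. \<bar>\<eta> x\<bar> \<le> C) \<and> (\<forall>i x. \<bar>pdiff i \<eta> x\<bar> \<le> C / h) \<and>
     (\<forall>i j x. \<bar>pdiff j (pdiff i \<eta>) x\<bar> \<le> C / h\<^sup>2) \<and>
     (\<forall>x\<in>\<Omega> - L. \<eta> x = 1 \<and> (\<forall>i. pdiff i \<eta> x = 0) \<and> (\<forall>i j. pdiff j (pdiff i \<eta>) x = 0))"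

lemma boundary_cutoffD:
  assumes "boundary_cutoff \<Omega> C h \<eta> L"
  shows "smooth \<eta>" "\<eta> \<in> test_functions \<Omega>" "L \<in> lmeasurable" "L \<subseteq> \<Omega>" "measure lebesgue L \<le> C * h"
    "\<bar>\<eta> x\<bar> \<le> C" "\<bar>pdiff i \<eta> x\<bar> \<le> C / h" "\<bar>pdiff j (pdiff i \<eta>) x\<bar> \<le> C / h\<^sup>2"
    "x \<in> \<Omega> - L \<Longrightarrow> \<eta> x = 1" "x \<in> \<Omega> - L \<Longrightarrow> pdiff i \<eta> x = 0" "x \<in> \<Omega> - L \<Longrightarrow> pdiff j (pdiff i \<eta>) x = 0"
  using assms unfolding boundary_cutoff_def test_functions_iff by blast+

text \<open>The sum of those members of the partition of unity with mesh size \<open>h\<close> whose cubes lie in the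
domain.  It can only differ from \<open>1\<close> at points whose distance to the complement is \<open>O(h)\<close>, and
these form a set of measure \<open>O(h)\<close>.\<close>

lemma boundary_cutoff_exists:
  fixes \<Omega> :: "(real^'d::finite) set"
  assumes dom: "bounded_domain \<Omega>" and bd: "Ck_boundary (Suc m) \<Omega>"
  shows "\<exists>C\<ge>0. \<exists>h0>0. \<forall>h. 0 < h \<and> h \<le> h0 \<longrightarrow> (\<exists>\<eta> L. boundary_cutoff \<Omega> C h \<eta> L)"
proof -
  have \<Omega>: "open \<Omega>" "bounded \<Omega>" using dom by (auto simp: bounded_domain_def)
  obtain C0 h0 where C0: "C0 \<ge> 0" and h0: "h0 > 0"
    and layer: "\<And>h. 0 < h \<Longrightarrow> h \<le> h0 \<Longrightarrow> measure lebesgue {x \<in> \<Omega>. infdist x (- \<Omega>) \<le> h} \<le> C0 * h"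
    using layer_measure[OF dom bd] by blast
  obtain M0 where M0: "M0 \<ge> 0" "\<And>h A x. finite A \<Longrightarrow> \<bar>lattice_sum h A (cell_bump :: real^'d \<Rightarrow> real) x\<bar> \<le> M0"
    using lattice_sum_bounded[OF cell_supported_cell_bump] by blast
  have "\<forall>i. \<exists>M\<ge>0. \<forall>h A x. finite A \<longrightarrow> \<bar>lattice_sum h A (pdiff i (cell_bump :: real^'d \<Rightarrow> real)) x\<bar> \<le> M"
    by (intro allI lattice_sum_bounded cell_supported_pdiff cell_supported_cell_bump)
  from choice[OF this] obtain M1 where
    "\<forall>i. M1 i \<ge> 0 \<and> (\<forall>h A x. finite A \<longrightarrow> \<bar>lattice_sum h A (pdiff i (cell_bump :: real^'d \<Rightarrow> real)) x\<bar> \<le> M1 i)" ..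
  then have M1: "\<And>i. M1 i \<ge> 0"
    "\<And>i h A x. finite A \<Longrightarrow> \<bar>lattice_sum h A (pdiff i (cell_bump :: real^'d \<Rightarrow> real)) x\<bar> \<le> M1 i" by blast+
  have "\<forall>p. \<exists>M\<ge>0. \<forall>h A x. finite A \<longrightarrow> \<bar>lattice_sum h A (pdiff (snd p) (pdiff (fst p) (cell_bump :: real^'d \<Rightarrow> real))) x\<bar> \<le> M"
    by (intro allI lattice_sum_bounded cell_supported_pdiff cell_supported_cell_bump)
  from choice[OF this] obtain N where
    N: "\<forall>p. N p \<ge> 0 \<and> (\<forall>h A x. finite A \<longrightarrow> \<bar>lattice_sum h A (pdiff (snd p) (pdiff (fst p) (cell_bump :: real^'d \<Rightarrow> real))) x\<bar> \<le> N p)" ..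
  define M2 where "M2 i j = N (i, j)" for i j
  have M2: "M2 i j \<ge> 0"
    "finite A \<Longrightarrow> \<bar>lattice_sum h A (pdiff j (pdiff i (cell_bump :: real^'d \<Rightarrow> real))) x\<bar> \<le> M2 i j" for i j h A x
    using N[rule_format, of "(i, j)"] by (auto simp: M2_def)
  define d where "d = 2 * real CARD('d)"
  have d: "d > 0" by (simp add: d_def)
  define S1 where "S1 = (\<Sum>i\<in>UNIV. M1 i)"
  define S2 where "S2 = (\<Sum>i\<in>UNIV. \<Sum>j\<in>UNIV. M2 i j)"
  have M1S: "M1 i \<le> S1" for i
    unfolding S1_def using M1(1) by (intro member_le_sum) auto
  have M2S: "M2 i j \<le> S2" for i j
  proof -
    have "M2 i j \<le> (\<Sum>j\<in>UNIV. M2 i j)" using M2(1) by (intro member_le_sum) auto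
    also have "\<dots> \<le> S2" unfolding S2_def
      using M2(1) by (intro member_le_sum[of i UNIV "\<lambda>i. \<Sum>j\<in>UNIV. M2 i j"]) (auto intro: sum_nonneg)
    finally show ?thesis .
  qed
  have S: "S1 \<ge> 0" "S2 \<ge> 0" using M1(1) M2(1) by (auto simp: S1_def S2_def intro!: sum_nonneg)
  define C where "C = C0 * d + M0 + S1 + S2"
  have C: "C0 * d \<le> C" "M0 \<le> C" "S1 \<le> C" "S2 \<le> C" "C \<ge> 0"
    using S C0 M0(1) d by (auto simp: C_def)
  have "\<exists>\<eta> L. boundary_cutoff \<Omega> C h \<eta> L" if h: "0 < h" "h \<le> h0 / d" for h
  proof -
    have hd: "0 < d * h" "d * h \<le> h0" using h d by (auto simp: field_simps)
    define A where "A = {k. cube h k \<subseteq> \<Omega>}"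
    have ne: "cube h k \<noteq> {}" for k :: "'d \<Rightarrow> int"
      using h by (auto simp: cube_def intro!: exI[of _ "h *\<^sub>R lattice_point k"])
    have "A \<subseteq> {k. cube h k \<inter> \<Omega> \<noteq> {}}" using ne by (auto simp: A_def)
    then have A: "finite A" using finite_cubes_meeting[OF \<Omega>(2) h(1)] finite_subset by blast
    define \<eta> where "\<eta> = lattice_sum h A (cell_bump :: real^'d \<Rightarrow> real)"
    define L where "L = {x \<in> \<Omega>. infdist x (- \<Omega>) \<le> d * h}"
    have p1: "pdiff i \<eta> = (\<lambda>x. (1 / h) * lattice_sum h A (pdiff i cell_bump) x)" for i
      unfolding \<eta>_def by (rule pdiff_lattice_sum[OF cell_supported_cell_bump])
    have p2: "pdiff j (pdiff i \<eta>) = (\<lambda>x. (1 / h) * ((1 / h) * lattice_sum h A (pdiff j (pdiff i cell_bump)) x))" for i j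
    proof
      fix x
      let ?g = "lattice_sum h A (pdiff i (cell_bump :: real^'d \<Rightarrow> real))"
      have "smooth ?g" by (intro smooth_lattice_sum cell_supported_pdiff cell_supported_cell_bump)
      then have "((\<lambda>x. (1 / h) * ?g x) has_derivative (\<lambda>v. (1 / h) * frechet_derivative ?g (at x) v)) (at x)"
        by (intro has_derivative_mult_right smooth_has_derivative)
      then have "pdiff j (\<lambda>x. (1 / h) * ?g x) x = (1 / h) * pdiff j ?g x"
        unfolding pdiff_def by (simp flip: frechet_derivative_at)
      then show "pdiff j (pdiff i \<eta>) x = (1 / h) * ((1 / h) * lattice_sum h A (pdiff j (pdiff i cell_bump)) x)"
        unfolding p1 by (simp add: pdiff_lattice_sum[OF cell_supported_pdiff[OF cell_supported_cell_bump]])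
    qed
    \<comment> \<open>deep inside, every cube through the point has too small a diameter to leave the domain\<close>
    have one: "\<eta> x = 1" if "infdist x (- \<Omega>) > d * h" for x
      unfolding \<eta>_def
    proof (rule lattice_sum_cell_bump_eq_1[OF A])
      fix k assume k: "x \<in> cube h k"
      have "y \<in> \<Omega>" if "y \<in> cube h k" for y
      proof (rule ccontr)
        assume "y \<notin> \<Omega>"
        then have "infdist x (- \<Omega>) \<le> dist x y" by (intro infdist_le) auto
        also have "\<dots> \<le> d * h" using dist_cube[OF h(1) k that] by (simp add: d_def)
        finally show False using \<open>infdist x (- \<Omega>) > d * h\<close> by simp
      qed
      then show "k \<in> A" by (auto simp: A_def)
    qed
    \<comment> \<open>the derivatives vanish there because \<open>\<eta>\<close> is constant on an open set\<close>
    have op: "open {x. infdist x (- \<Omega>) > d * h}"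
      by (intro open_Collect_less continuous_intros)
    have z1: "pdiff i \<eta> x = 0" if "infdist x (- \<Omega>) > d * h" for i x
      unfolding pdiff_def using that one
      by (intro frechet_derivative_zero_on_open[OF op, where c=1]) auto
    have z2: "pdiff j (pdiff i \<eta>) x = 0" if "infdist x (- \<Omega>) > d * h" for i j x
      unfolding pdiff_def[of j] using that z1
      by (intro frechet_derivative_zero_on_open[OF op, where c=0]) auto
    have "(\<Union>k\<in>A. cube h k) \<subseteq> \<Omega>" by (auto simp: A_def)
    then have test: "\<eta> \<in> test_functions \<Omega>"
      unfolding \<eta>_def by (rule lattice_sum_test_function[OF cell_supported_cell_bump h(1) A])
    have L: "L \<in> lmeasurable" "L \<subseteq> \<Omega>"
      unfolding L_def by (auto intro: layer_measurable[OF \<Omega>])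
    have "measure lebesgue L \<le> C0 * (d * h)" unfolding L_def by (rule layer[OF hd])
    also have "\<dots> \<le> C * h" using C(1) h(1) by (simp flip: mult.assoc)
    finally have mL: "measure lebesgue L \<le> C * h" .
    have b0: "\<bar>\<eta> x\<bar> \<le> C" for x
      using M0(2)[OF A, of h x] C(2) unfolding \<eta>_def by linarith
    have b1: "\<bar>pdiff i \<eta> x\<bar> \<le> C / h" for i x
    proof -
      have "\<bar>lattice_sum h A (pdiff i cell_bump) x\<bar> \<le> C"
        using M1(2)[OF A, of h i x] M1S[of i] C(3) by linarith
      then show ?thesis using h(1) by (simp add: p1 abs_mult divide_right_mono)
    qed
    have b2: "\<bar>pdiff j (pdiff i \<eta>) x\<bar> \<le> C / h\<^sup>2" for i j x
    proof -
      have "\<bar>lattice_sum h A (pdiff j (pdiff i cell_bump)) x\<bar> \<le> C"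
        using M2(2)[OF A, of h j i x] M2S[of i j] C(4) by linarith
      then show ?thesis using h(1) by (simp add: p2 abs_mult power2_eq_square divide_right_mono)
    qed
    have "boundary_cutoff \<Omega> C h \<eta> L"
      unfolding boundary_cutoff_def using test L mL b0 b1 b2 one z1 z2
      by (auto simp: L_def not_le)
    then show ?thesis by blast
  qed
  moreover have "h0 / d > 0" using h0 d by simp
  ultimately show ?thesis using C(5) by blast
qed

text \<open>Smooth approximations of the indicator of \<open>K\<close>: the sum over the cubes that meet \<open>K\<close> is \<open>1\<close> on \<open>K\<close>
and vanishes away from the cubes, which shrink to \<open>K\<close> with the mesh size.\<close>

lemma compact_indicator_approx:
  fixes K \<Omega> :: "(real^'d::finite) set"
  assumes K: "compact K" "K \<subseteq> \<Omega>" and \<Omega>: "open \<Omega>"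
  obtains \<psi> :: "nat \<Rightarrow> real^'d \<Rightarrow> real" and M where
    "\<And>n. \<psi> n \<in> test_functions \<Omega>" "\<And>n x. \<bar>\<psi> n x\<bar> \<le> M"
    "\<And>x. (\<lambda>n. \<psi> n x) \<longlonglongrightarrow> indicat_real K x"
proof -
  obtain M where M: "\<And>h A x. finite A \<Longrightarrow> \<bar>lattice_sum h A (cell_bump :: real^'d \<Rightarrow> real) x\<bar> \<le> M"
    using lattice_sum_bounded[OF cell_supported_cell_bump] by blast
  define d where "d = 2 * real CARD('d)"
  have d: "d > 0" by (simp add: d_def)
  obtain e where e: "e > 0" "(\<Union>x\<in>K. ball x e) \<subseteq> \<Omega>"
    using compact_subset_open_imp_ball_epsilon_subset[OF K(1) \<Omega> K(2)] by metis
  \<comment> \<open>cubes of side \<open>2 * h n\<close> have diameter at most \<open>d * h n\<close>, which stays below \<open>e\<close> and tends to \<open>0\<close>\<close>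
  define h where "h = (\<lambda>n. e / (2 * d) * inverse (real (Suc n)))"
  have h: "h n > 0" for n using e d by (simp add: h_def)
  have dh: "d * h n = e / 2 * inverse (real (Suc n))" for n using d by (simp add: h_def)
  have he: "d * h n < e" for n
  proof -
    have "inverse (real (Suc n)) \<le> 1" by (simp add: inverse_le_1_iff)
    then have "e / 2 * inverse (real (Suc n)) \<le> e / 2 * 1" using e by (intro mult_left_mono) auto
    then show ?thesis using e(1) unfolding dh by linarith
  qed
  define A where "A = (\<lambda>n. {k. cube (h n) k \<inter> K \<noteq> {}})"
  have A: "finite (A n)" for n
    unfolding A_def using K(1) compact_imp_bounded h by (blast intro: finite_cubes_meeting)
  define \<psi> where "\<psi> = (\<lambda>n. lattice_sum (h n) (A n) (cell_bump :: real^'d \<Rightarrow> real))"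
  have near: "\<exists>y\<in>K. dist x y \<le> d * h n" if "x \<in> (\<Union>k\<in>A n. cube (h n) k)" for x n
  proof -
    from that obtain k y where y: "x \<in> cube (h n) k" "y \<in> cube (h n) k" "y \<in> K" unfolding A_def by blast
    have "dist x y \<le> d * h n" using dist_cube[OF h y(1,2)] by (simp add: d_def)
    with y(3) show ?thesis ..
  qed
  show thesis
  proof
    fix n
    have "(\<Union>k\<in>A n. cube (h n) k) \<subseteq> \<Omega>"
    proof
      fix x assume "x \<in> (\<Union>k\<in>A n. cube (h n) k)"
      then obtain y where "y \<in> K" "dist x y \<le> d * h n" using near by blast
      then have "x \<in> (\<Union>y\<in>K. ball y e)" using he[of n] by (intro UN_I[of y]) (auto simp: dist_commute)
      then show "x \<in> \<Omega>" using e(2) by blast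
    qed
    then show "\<psi> n \<in> test_functions \<Omega>"
      unfolding \<psi>_def by (rule lattice_sum_test_function[OF cell_supported_cell_bump h A])
    show "\<bar>\<psi> n x\<bar> \<le> M" for x unfolding \<psi>_def by (rule M[OF A])
  next
    fix x
    show "(\<lambda>n. \<psi> n x) \<longlonglongrightarrow> indicat_real K x"
    proof (cases "x \<in> K")
      case True
      then have "\<psi> n x = 1" for n
        unfolding \<psi>_def by (intro lattice_sum_cell_bump_eq_1 A) (auto simp: A_def)
      then show ?thesis using True by simp
    next
      case False
      obtain r where r: "r > 0" "ball x r \<subseteq> - K"
        using False K(1) by (metis compact_imp_closed Compl_iff open_Compl open_contains_ball)
      have "(\<lambda>n. e / 2 * inverse (real (Suc n))) \<longlonglongrightarrow> e / 2 * 0"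
        by (intro tendsto_intros LIMSEQ_inverse_real_of_nat)
      then have "(\<lambda>n. d * h n) \<longlonglongrightarrow> 0" by (simp add: dh)
      then have "\<forall>\<^sub>F n in sequentially. d * h n < r"
        using r(1) by (rule order_tendstoD(2))
      then have "\<forall>\<^sub>F n in sequentially. \<psi> n x = 0"
      proof eventually_elim
        case (elim n)
        show ?case
        proof (rule ccontr)
          assume "\<psi> n x \<noteq> 0"
          then have "x \<in> (\<Union>k\<in>A n. cube (h n) k)"
            unfolding \<psi>_def by (rule lattice_sum_support(1)[OF cell_supported_cell_bump h A])
          then obtain y where "y \<in> K" "dist x y \<le> d * h n" using near by blast
          then have "y \<in> ball x r" using elim by simp
          then show False using r(2) \<open>y \<in> K\<close> by blast
        qed
      qed
      then show ?thesis using False by (simp add: tendsto_eventually)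
    qed
  qed
qed


section \<open>Square-integrable functions\<close>

lemma measurable_lebesgue_on:
  "open \<Omega> \<Longrightarrow> continuous_on UNIV f \<Longrightarrow> f \<in> borel_measurable (lebesgue_on \<Omega>)"
  for \<Omega> :: "'a::euclidean_space set" and f :: "'a \<Rightarrow> 'b::{second_countable_topology,topological_space}"
  by (rule continuous_imp_measurable_on_sets_lebesgue[OF continuous_on_subset[of UNIV f]])
    (simp_all add: borel_open)

lemma finite_lebesgue_on:
  "open \<Omega> \<Longrightarrow> bounded \<Omega> \<Longrightarrow> finite_measure (lebesgue_on \<Omega>)" for \<Omega> :: "'a::euclidean_space set"
  by (intro finite_measure_lebesgue_on lmeasurable_open)

lemma continuous_bounded_on:
  fixes f :: "'a::euclidean_space \<Rightarrow> 'b::real_normed_vector"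
  assumes "bounded \<Omega>" "continuous_on UNIV f"
  shows "\<exists>B\<ge>0. \<forall>x\<in>\<Omega>. norm (f x) \<le> B"
proof -
  have "compact (f ` closure \<Omega>)"
    using assms by (intro compact_continuous_image) (auto intro: continuous_on_subset)
  then obtain B where B: "\<forall>y\<in>f ` closure \<Omega>. norm y \<le> B"
    using compact_imp_bounded bounded_iff by blast
  have "norm (f x) \<le> \<bar>B\<bar>" if "x \<in> \<Omega>" for x
    using B that closure_subset[of \<Omega>] by force
  then show ?thesis using abs_ge_zero by blast
qed

lemma continuous_L2:
  fixes f :: "'a::euclidean_space \<Rightarrow> 'b::euclidean_space"
  assumes \<Omega>: "open \<Omega>" "bounded \<Omega>" and f: "continuous_on UNIV f"
  shows "f \<in> L2 \<Omega>"
proof -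
  obtain B where B: "\<forall>x\<in>\<Omega>. norm (f x) \<le> B"
    using continuous_bounded_on[OF \<Omega>(2) f] by blast
  have m: "f \<in> borel_measurable (lebesgue_on \<Omega>)"
    by (rule measurable_lebesgue_on[OF \<Omega>(1) f])
  have "integrable (lebesgue_on \<Omega>) (\<lambda>x. (norm (f x))\<^sup>2)"
  proof (rule finite_measure.integrable_const_bound[OF finite_lebesgue_on[OF \<Omega>]])
    show "AE x in lebesgue_on \<Omega>. norm ((norm (f x))\<^sup>2) \<le> B\<^sup>2"
      using B by (intro AE_I2) (auto intro: power_mono)
    show "(\<lambda>x. (norm (f x))\<^sup>2) \<in> borel_measurable (lebesgue_on \<Omega>)"
      using m by measurable
  qed
  with m show ?thesis by (simp add: L2_def)
qed

lemma smooth_L2: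
  fixes f :: "'a::euclidean_space \<Rightarrow> 'b::euclidean_space"
  shows "open \<Omega> \<Longrightarrow> bounded \<Omega> \<Longrightarrow> smooth f \<Longrightarrow> f \<in> L2 \<Omega>"
  by (rule continuous_L2[OF _ _ smooth_continuous])

lemma L2_measurable: "f \<in> L2 \<Omega> \<Longrightarrow> f \<in> borel_measurable (lebesgue_on \<Omega>)"
  and L2_integrable_sq: "f \<in> L2 \<Omega> \<Longrightarrow> integrable (lebesgue_on \<Omega>) (\<lambda>x. (norm (f x))\<^sup>2)"
  by (auto simp: L2_def)

lemma L2_if_dominated:
  assumes "f \<in> borel_measurable (lebesgue_on \<Omega>)" "integrable (lebesgue_on \<Omega>) g"
    "\<And>x. (norm (f x))\<^sup>2 \<le> g x"
  shows "f \<in> L2 \<Omega>"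
proof -
  have "integrable (lebesgue_on \<Omega>) (\<lambda>x. (norm (f x))\<^sup>2)"
  proof (rule Bochner_Integration.integrable_bound[OF assms(2)])
    show "(\<lambda>x. (norm (f x))\<^sup>2) \<in> borel_measurable (lebesgue_on \<Omega>)"
      using assms(1) by measurable
    show "AE x in lebesgue_on \<Omega>. norm ((norm (f x))\<^sup>2) \<le> norm (g x)"
    proof (rule AE_I2)
      fix x show "norm ((norm (f x))\<^sup>2) \<le> norm (g x)"
        using order_trans[OF assms(3) abs_ge_self, of x] by (simp only: real_norm_def abs_power2)
    qed
  qed
  with assms(1) show ?thesis by (simp add: L2_def)
qed

lemma L2_add:
  assumes "f \<in> L2 \<Omega>" "g \<in> L2 \<Omega>"
  shows "(\<lambda>x. f x + g x) \<in> L2 \<Omega>"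
proof (rule L2_if_dominated)
  show "(\<lambda>x. f x + g x) \<in> borel_measurable (lebesgue_on \<Omega>)"
    using L2_measurable[OF assms(1)] L2_measurable[OF assms(2)] by measurable
  show "integrable (lebesgue_on \<Omega>) (\<lambda>x. 2 * (norm (f x))\<^sup>2 + 2 * (norm (g x))\<^sup>2)"
    using assms by (intro Bochner_Integration.integrable_add integrable_mult_right L2_integrable_sq)
  fix x
  have "(norm (f x + g x))\<^sup>2 \<le> (norm (f x) + norm (g x))\<^sup>2"
    by (intro power_mono norm_triangle_ineq norm_ge_zero)
  also have "\<dots> \<le> 2 * (norm (f x))\<^sup>2 + 2 * (norm (g x))\<^sup>2"
    using zero_le_power2[of "norm (f x) - norm (g x)"] by (simp add: power2_eq_square algebra_simps)
  finally show "(norm (f x + g x))\<^sup>2 \<le> 2 * (norm (f x))\<^sup>2 + 2 * (norm (g x))\<^sup>2" .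
qed

lemma L2_bounded_linear:
  assumes L: "bounded_linear L" and f: "f \<in> L2 \<Omega>"
  shows "(\<lambda>x. L (f x)) \<in> L2 \<Omega>"
proof -
  obtain K where K: "\<And>x. norm (L x) \<le> norm x * K"
    using bounded_linear.bounded[OF L] by blast
  show ?thesis
  proof (rule L2_if_dominated)
    have "L \<in> borel_measurable borel"
      by (intro borel_measurable_continuous_onI linear_continuous_on L)
    with L2_measurable[OF f] show "(\<lambda>x. L (f x)) \<in> borel_measurable (lebesgue_on \<Omega>)" by measurable
    show "integrable (lebesgue_on \<Omega>) (\<lambda>x. (norm (f x))\<^sup>2 * K\<^sup>2)"
      by (intro integrable_mult_left L2_integrable_sq f)
    show "(norm (L (f x)))\<^sup>2 \<le> (norm (f x))\<^sup>2 * K\<^sup>2" for x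
      using power_mono[OF K norm_ge_zero, of "f x" 2] by (simp add: power_mult_distrib)
  qed
qed

lemma L2_diff:
  assumes "f \<in> L2 \<Omega>" "g \<in> L2 \<Omega>"
  shows "(\<lambda>x. f x - g x) \<in> L2 \<Omega>"
  using L2_add[OF assms(1) L2_bounded_linear[OF bounded_linear_minus[OF bounded_linear_ident] assms(2)]]
  by simp

lemma L2_mult_left: "f \<in> L2 \<Omega> \<Longrightarrow> (\<lambda>x. c * f x) \<in> L2 \<Omega>" for c :: complex
  by (rule L2_bounded_linear[OF bounded_linear_mult_right])

lemma L2_nth: "f \<in> L2 \<Omega> \<Longrightarrow> (\<lambda>x. f x $ j) \<in> L2 \<Omega>"
  by (rule L2_bounded_linear[OF bounded_linear_vec_nth])

lemma L2_cnj: "f \<in> L2 \<Omega> \<Longrightarrow> (\<lambda>x. cnj (f x)) \<in> L2 \<Omega>"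
  by (rule L2_bounded_linear[OF bounded_linear_cnj])

lemma L2_norm_cnj: "L2_norm \<Omega> (\<lambda>x. cnj (f x)) = L2_norm \<Omega> f"
  by (simp add: L2_norm_def)

lemma L2_norm_mult_integrable:
  assumes "f \<in> L2 \<Omega>" "g \<in> L2 \<Omega>"
  shows "integrable (lebesgue_on \<Omega>) (\<lambda>x. norm (f x) * norm (g x))"
proof (rule Bochner_Integration.integrable_bound)
  show "integrable (lebesgue_on \<Omega>) (\<lambda>x. (norm (f x))\<^sup>2 + (norm (g x))\<^sup>2)"
    using assms by (intro Bochner_Integration.integrable_add L2_integrable_sq)
  show "(\<lambda>x. norm (f x) * norm (g x)) \<in> borel_measurable (lebesgue_on \<Omega>)"
    using L2_measurable[OF assms(1)] L2_measurable[OF assms(2)] by measurable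
  have "a * b \<le> a\<^sup>2 + b\<^sup>2" if "a \<ge> 0" "b \<ge> 0" for a b :: real
  proof -
    have "2 * (a * b) \<le> a\<^sup>2 + b\<^sup>2"
      using zero_le_power2[of "a - b"] by (simp add: power2_eq_square algebra_simps)
    then show ?thesis using mult_nonneg_nonneg[OF that] by linarith
  qed
  then show "AE x in lebesgue_on \<Omega>. norm (norm (f x) * norm (g x)) \<le> norm ((norm (f x))\<^sup>2 + (norm (g x))\<^sup>2)"
    by (intro AE_I2) (simp add: abs_mult)
qed

lemma L2_mult_integrable:
  fixes f g :: "'a::euclidean_space \<Rightarrow> complex"
  assumes "f \<in> L2 \<Omega>" "g \<in> L2 \<Omega>"
  shows "integrable (lebesgue_on \<Omega>) (\<lambda>x. f x * g x)"
proof (rule Bochner_Integration.integrable_bound[OF L2_norm_mult_integrable[OF assms]])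
  show "(\<lambda>x. f x * g x) \<in> borel_measurable (lebesgue_on \<Omega>)"
    using L2_measurable[OF assms(1)] L2_measurable[OF assms(2)] by measurable
qed (simp add: norm_mult)

lemma L2_integrable:
  fixes f :: "'a::euclidean_space \<Rightarrow> complex"
  assumes \<Omega>: "open \<Omega>" "bounded \<Omega>" and f: "f \<in> L2 \<Omega>"
  shows "integrable (lebesgue_on \<Omega>) f"
  using L2_mult_integrable[OF f continuous_L2[OF \<Omega>], of "\<lambda>x. 1"] by simp

lemma L2_norm_nonneg: "L2_norm \<Omega> f \<ge> 0"
  by (simp add: L2_norm_def)

lemma L2_norm_sq: "(L2_norm \<Omega> f)\<^sup>2 = (\<integral>x. (norm (f x))\<^sup>2 \<partial>lebesgue_on \<Omega>)"
  by (simp add: L2_norm_def)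

lemma geometric_mean_bound:
  fixes A B X :: real
  assumes "A \<ge> 0" "B \<ge> 0" and X: "\<And>t. t > 0 \<Longrightarrow> 2 * X \<le> t * A + B / t"
  shows "X \<le> sqrt A * sqrt B"
proof -
  have "X \<le> sqrt (A + e) * sqrt (B + e)" if e: "e > 0" for e
  proof -
    \<comment> \<open>the optimal parameter is \<open>sqrt B / sqrt A\<close>; adding \<open>e\<close> keeps it defined and positive\<close>
    define p q where "p = sqrt (A + e)" and "q = sqrt (B + e)"
    have pq: "p > 0" "q > 0" "p\<^sup>2 = A + e" "q\<^sup>2 = B + e" using assms(1,2) e by (auto simp: p_def q_def)
    have "2 * X \<le> (q / p) * A + B / (q / p)" using pq by (intro X) simp
    also have "\<dots> \<le> (q / p) * p\<^sup>2 + q\<^sup>2 / (q / p)"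
      using pq(1,2) e unfolding pq(3,4) by (intro add_mono mult_left_mono divide_right_mono) auto
    also have "\<dots> = 2 * (p * q)" using pq(1,2) by (simp add: power2_eq_square)
    finally show ?thesis by (simp add: p_def q_def)
  qed
  then have "\<forall>\<^sub>F e in at_right 0. X \<le> sqrt (A + e) * sqrt (B + e)"
    by (intro eventually_at_right_less[THEN eventually_mono])
  moreover have "((\<lambda>e. sqrt (A + e) * sqrt (B + e)) \<longlongrightarrow> sqrt (A + 0) * sqrt (B + 0)) (at_right 0)"
    by (intro tendsto_intros)
  ultimately show ?thesis
    by (intro tendsto_lowerbound[of _ "sqrt A * sqrt B"]) auto
qed

lemma L2_Cauchy_Schwarz:
  assumes "f \<in> L2 \<Omega>" "g \<in> L2 \<Omega>"
  shows "(\<integral>x. norm (f x) * norm (g x) \<partial>lebesgue_on \<Omega>) \<le> L2_norm \<Omega> f * L2_norm \<Omega> g"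
  unfolding L2_norm_def
proof (rule geometric_mean_bound)
  let ?M = "lebesgue_on \<Omega>"
  fix t :: real assume t: "t > 0"
  have "2 * (a * b) \<le> t * a\<^sup>2 + b\<^sup>2 / t" for a b :: real
  proof -
    have "0 \<le> (t * a - b)\<^sup>2 / t" using t by simp
    also have "\<dots> = t * a\<^sup>2 + b\<^sup>2 / t - 2 * (a * b)"
      using t by (simp add: power2_eq_square field_simps)
    finally show ?thesis by simp
  qed
  then have "(\<integral>x. 2 * (norm (f x) * norm (g x)) \<partial>?M) \<le> (\<integral>x. t * (norm (f x))\<^sup>2 + (norm (g x))\<^sup>2 / t \<partial>?M)"
    using assms by (intro integral_mono Bochner_Integration.integrable_add integrable_mult_right
        integrable_divide_zero L2_integrable_sq L2_norm_mult_integrable) auto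
  also have "\<dots> = t * (\<integral>x. (norm (f x))\<^sup>2 \<partial>?M) + (\<integral>x. (norm (g x))\<^sup>2 \<partial>?M) / t"
    using assms by (simp add: L2_integrable_sq)
  finally show "2 * (\<integral>x. norm (f x) * norm (g x) \<partial>?M)
      \<le> t * (\<integral>x. (norm (f x))\<^sup>2 \<partial>?M) + (\<integral>x. (norm (g x))\<^sup>2 \<partial>?M) / t" by simp
qed auto

lemma norm_integral_L2_le:
  fixes f g :: "'a::euclidean_space \<Rightarrow> complex"
  assumes "f \<in> L2 \<Omega>" "g \<in> L2 \<Omega>"
  shows "norm (\<integral>x. f x * g x \<partial>lebesgue_on \<Omega>) \<le> L2_norm \<Omega> f * L2_norm \<Omega> g"
  using integral_norm_bound[of "lebesgue_on \<Omega>" "\<lambda>x. f x * g x"] L2_Cauchy_Schwarz[OF assms]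
  by (simp add: norm_mult)

lemma L2_norm_mono:
  assumes "f \<in> borel_measurable (lebesgue_on \<Omega>)" "integrable (lebesgue_on \<Omega>) (\<lambda>x. (norm (g x))\<^sup>2)" "\<And>x. norm (f x) \<le> norm (g x)"
  shows "L2_norm \<Omega> f \<le> L2_norm \<Omega> g"
proof -
  have "f \<in> L2 \<Omega>" using assms(3) by (intro L2_if_dominated[OF assms(1,2)]) (auto intro: power_mono)
  then show ?thesis
    unfolding L2_norm_def
    by (intro real_sqrt_le_mono integral_mono[OF L2_integrable_sq assms(2)] power_mono assms(3)) simp_all
qed

text \<open>A hyperplane is a null set, but a nonempty open set is not.\<close>

lemma L2_norm_coordinate_pos:
  fixes \<Omega> :: "(real^'d::finite) set"
  assumes \<Omega>: "open \<Omega>" "\<Omega> \<noteq> {}" "bounded \<Omega>"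
  shows "L2_norm \<Omega> (\<lambda>x. complex_of_real (x $ a - m)) > 0"
proof (rule ccontr)
  let ?M = "lebesgue_on \<Omega>"
  assume "\<not> ?thesis"
  then have "L2_norm \<Omega> (\<lambda>x. complex_of_real (x $ a - m)) = 0"
    using L2_norm_nonneg[of \<Omega> "\<lambda>x. complex_of_real (x $ a - m)"] by linarith
  then have z: "(\<integral>x. (norm (complex_of_real (x $ a - m)))\<^sup>2 \<partial>?M) = 0"
    using L2_norm_sq[of \<Omega> "\<lambda>x. complex_of_real (x $ a - m)"] by simp
  have "smooth (\<lambda>x::real^'d. complex_of_real (x $ a - m))"
    by (intro smooth_bounded_linear[OF bounded_linear_of_real] smooth_diff smooth_coord smooth_const)
  then have "integrable ?M (\<lambda>x. (norm (complex_of_real (x $ a - m)))\<^sup>2)"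
    by (rule L2_integrable_sq[OF smooth_L2[OF \<Omega>(1,3)]])
  then have "AE x in ?M. (norm (complex_of_real (x $ a - m)))\<^sup>2 = 0"
    using z by (subst (asm) integral_nonneg_eq_0_iff_AE) auto
  then have "AE x in ?M. x $ a = m" by eventually_elim simp
  then have 1: "AE x in lebesgue. x \<in> \<Omega> \<longrightarrow> x $ a = m"
    using \<Omega>(1) by (subst (asm) AE_restrict_space_iff) (simp_all add: borel_open)
  have "negligible {x :: real^'d. axis a (1::real) \<bullet> x = m}"
    by (rule negligible_hyperplane) (simp add: axis_eq_0_iff)
  then have "{x::real^'d. x $ a = m} \<in> null_sets lebesgue"
    by (simp add: negligible_iff_null_sets inner_axis')
  then have "AE x in lebesgue. x \<notin> {x::real^'d. x $ a = m}" by (rule AE_not_in)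
  with 1 have "AE x in lebesgue. x \<notin> \<Omega>" by eventually_elim simp
  then have "negligible \<Omega>"
    using \<Omega>(1) by (simp add: negligible_iff_null_sets AE_iff_null_sets borel_open)
  then show False using open_not_negligible[OF \<Omega>(1,2)] by blast
qed


section \<open>The fundamental lemma of the calculus of variations\<close>

text \<open>Otherwise \<open>u\<close> would be positive on a set of positive measure; up to a null set that set is a
countable union of compact sets, and on each of these the integral of a positive function is \<open>0\<close>
only if the set is null.\<close>

lemma AE_le_0_if_compact_integrals_0:
  fixes u :: "'a::euclidean_space \<Rightarrow> real"
  assumes \<Omega>: "open \<Omega>" and u: "integrable (lebesgue_on \<Omega>) u"
    and z: "\<And>K. compact K \<Longrightarrow> K \<subseteq> \<Omega> \<Longrightarrow> (\<integral>x. indicator K x * u x \<partial>lebesgue_on \<Omega>) = 0"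
  shows "AE x in lebesgue_on \<Omega>. u x \<le> 0"
proof -
  let ?M = "lebesgue_on \<Omega>"
  have \<Omega>s: "\<Omega> \<in> sets lebesgue" using \<Omega> by (simp add: borel_open)
  have um: "u \<in> borel_measurable ?M" using u by auto
  define P where "P = {x \<in> space ?M. u x > 0}"
  have "P \<in> sets ?M" unfolding P_def using um by measurable
  then have P: "P \<in> sets lebesgue" "P \<subseteq> \<Omega>"
    using \<Omega>s by (auto simp: sets_restrict_space_iff P_def)
  obtain C T where CT: "fsigma C" "T \<in> null_sets lebesgue" "C \<union> T = P"
    by (rule lebesgue_set_almost_fsigma[OF P(1)])
  obtain F :: "nat \<Rightarrow> 'a set" where F: "range F \<subseteq> Collect compact" "C = \<Union>(range F)"
    using CT(1) by (meson fsigma_Union_compact)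
  have "F n \<in> null_sets ?M" for n
  proof (rule null_if_pos_func_has_zero_int[OF u])
    have FP: "F n \<subseteq> P" using F CT by auto
    have cpt: "compact (F n)" using F by auto
    show "F n \<in> sets ?M"
      using FP P(2) cpt \<Omega>s by (auto simp: sets_restrict_space_iff intro: closed_lebesgue compact_imp_closed)
    show "AE x\<in>F n in ?M. 0 < u x" using FP by (intro AE_I2) (auto simp: P_def)
    show "(LINT x:F n|?M. u x) = 0"
      using z[OF cpt] FP P(2) by (simp add: set_lebesgue_integral_def)
  qed
  then have "C \<in> null_sets ?M" unfolding F(2) by (rule null_sets_UN)
  moreover have "T \<in> null_sets ?M"
    using CT P(2) \<Omega>s by (subst null_sets_restrict_space) auto
  ultimately have "P \<in> null_sets ?M" using CT(3) null_sets.Un by metis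
  then have "AE x in ?M. x \<notin> P" by (rule AE_not_in)
  then show ?thesis by (rule AE_mp) (rule AE_I2, auto simp: P_def)
qed

lemma test_functions_of_real:
  "\<psi> \<in> test_functions \<Omega> \<Longrightarrow> (\<lambda>x. complex_of_real (\<psi> x)) \<in> test_functions \<Omega>"
  by (simp add: test_functions_iff smooth_bounded_linear[OF bounded_linear_of_real])

text \<open>The fundamental lemma of the calculus of variations.  By dominated convergence \<open>g\<close> is also
orthogonal to indicators of compact sets, so \<open>AE_le_0_if_compact_integrals_0\<close> applies to the real and imaginary
parts of \<open>g\<close> and of \<open>- g\<close>.\<close>

lemma AE_0_if_orthogonal_to_test_functions:
  fixes g :: "real^'d::finite \<Rightarrow> complex"
  assumes \<Omega>: "open \<Omega>" "bounded \<Omega>" and g: "g \<in> L2 \<Omega>"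
    and z: "\<And>\<psi>. \<psi> \<in> test_functions \<Omega> \<Longrightarrow> (\<integral>x. g x * \<psi> x \<partial>lebesgue_on \<Omega>) = 0"
  shows "AE x in lebesgue_on \<Omega>. g x = 0"
proof -
  let ?M = "lebesgue_on \<Omega>"
  have gi: "integrable ?M g" by (rule L2_integrable[OF \<Omega> g])
  have zK: "(\<integral>x. g x * of_real (indicat_real K x) \<partial>?M) = 0"
    and iK: "integrable ?M (\<lambda>x. g x * of_real (indicat_real K x))"
    if K: "compact K" "K \<subseteq> \<Omega>" for K
  proof -
    obtain \<psi> :: "nat \<Rightarrow> real^'d \<Rightarrow> real" and B where \<psi>: "\<And>n. \<psi> n \<in> test_functions \<Omega>" "\<And>n x. \<bar>\<psi> n x\<bar> \<le> B"
      "\<And>x. (\<lambda>n. \<psi> n x) \<longlonglongrightarrow> indicat_real K x"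
      using compact_indicator_approx[OF K \<Omega>(1)] by blast
    have m: "(\<lambda>x. g x * of_real (\<psi> n x)) \<in> borel_measurable ?M" for n
    proof -
      have "\<psi> n \<in> borel_measurable ?M"
        by (intro measurable_lebesgue_on \<Omega> smooth_continuous test_function_smooth[OF \<psi>(1)])
      with L2_measurable[OF g] show ?thesis by measurable
    qed
    have lim: "AE x in ?M. (\<lambda>n. g x * of_real (\<psi> n x)) \<longlonglongrightarrow> g x * of_real (indicat_real K x)"
      by (intro AE_I2 tendsto_mult[OF tendsto_const tendsto_of_real[OF \<psi>(3)]])
    have bd: "AE x in ?M. norm (g x * of_real (\<psi> n x)) \<le> norm (g x) * B" for n
      using \<psi>(2) by (intro AE_I2) (auto simp: norm_mult intro!: mult_left_mono)
    have w: "integrable ?M (\<lambda>x. norm (g x) * B)" using gi by simp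
    have mK: "(\<lambda>x. g x * of_real (indicat_real K x)) \<in> borel_measurable ?M"
      by (rule borel_measurable_LIMSEQ_metric[OF m tendsto_mult[OF tendsto_const tendsto_of_real[OF \<psi>(3)]]])
    have "(\<lambda>n. \<integral>x. g x * of_real (\<psi> n x) \<partial>?M) \<longlonglongrightarrow> (\<integral>x. g x * of_real (indicat_real K x) \<partial>?M)"
      by (rule integral_dominated_convergence[OF mK m w lim bd])
    moreover have "(\<integral>x. g x * of_real (\<psi> n x) \<partial>?M) = 0" for n
      by (intro z test_functions_of_real \<psi>(1))
    ultimately show "(\<integral>x. g x * of_real (indicat_real K x) \<partial>?M) = 0"
      using LIMSEQ_unique[OF _ tendsto_const] by simp
    show "integrable ?M (\<lambda>x. g x * of_real (indicat_real K x))"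
      by (rule integrable_dominated_convergence[OF mK m w lim bd])
  qed
  have Re0: "(\<integral>x. indicator K x * Re (g x) \<partial>?M) = 0" and Im0: "(\<integral>x. indicator K x * Im (g x) \<partial>?M) = 0"
    if "compact K" "K \<subseteq> \<Omega>" for K
    using arg_cong[OF zK[OF that], of Re] arg_cong[OF zK[OF that], of Im]
      integral_Re[OF iK[OF that]] integral_Im[OF iK[OF that]]
    by (simp_all add: mult.commute)
  have "AE x in ?M. Re (g x) \<le> 0"
    by (rule AE_le_0_if_compact_integrals_0[OF \<Omega>(1) integrable_Re[OF gi] Re0])
  moreover have "AE x in ?M. - Re (g x) \<le> 0"
    using gi Re0 by (intro AE_le_0_if_compact_integrals_0[OF \<Omega>(1)]) auto
  moreover have "AE x in ?M. Im (g x) \<le> 0"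
    by (rule AE_le_0_if_compact_integrals_0[OF \<Omega>(1) integrable_Im[OF gi] Im0])
  moreover have "AE x in ?M. - Im (g x) \<le> 0"
    using gi Im0 by (intro AE_le_0_if_compact_integrals_0[OF \<Omega>(1)]) auto
  ultimately show ?thesis
    by eventually_elim (simp add: complex_eq_iff)
qed


section \<open>Weak derivatives\<close>

lemma compact_closure_subset: "compact S \<Longrightarrow> closure A \<subseteq> S \<Longrightarrow> compact (closure A)"
  for S :: "'a::euclidean_space set"
  by (metis closed_closure compact_Int_closed inf.absorb_iff2)

lemma integrable_continuous_compact_support:
  fixes f :: "'a::euclidean_space \<Rightarrow> 'b::{banach,second_countable_topology}"
  assumes "continuous_on UNIV f" "compact S" "\<And>x. x \<notin> S \<Longrightarrow> f x = 0"
  shows "integrable lborel f"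
proof -
  have "integrable lborel (\<lambda>x. indicator S x *\<^sub>R f x)"
    using assms by (intro borel_integrable_compact) (auto intro: continuous_on_subset)
  moreover have "(\<lambda>x. indicator S x *\<^sub>R f x) = f"
    using assms(3) by (auto simp: fun_eq_iff indicator_def)
  ultimately show ?thesis by simp
qed

text \<open>By translation invariance all difference quotients of \<open>f\<close> have integral \<open>0\<close>, and they converge
to the derivative with a common integrable bound.\<close>

lemma integral_pdiff_eq_0_real:
  fixes f :: "real^'d::finite \<Rightarrow> real"
  assumes f: "smooth f" and supp: "compact (closure {x. f x \<noteq> 0})"
  shows "(\<integral>x. pdiff i f x \<partial>lborel) = 0"
proof -
  let ?v = "axis i 1 :: real^'d"
  let ?S = "closure {x. f x \<noteq> 0}"
  have f0: "f x = 0" if "x \<notin> ?S" for x using that closure_subset[of "{x. f x \<noteq> 0}"] by blast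
  have cont: "continuous_on UNIV f" "continuous_on UNIV (pdiff i f)"
    using f by (auto intro: smooth_continuous smooth_pdiff)
  obtain B where B: "B \<ge> 0" "\<forall>x\<in>?S. norm (pdiff i f x) \<le> B"
    using continuous_bounded_on[OF compact_imp_bounded[OF supp] cont(2)] by blast
  have bd: "\<bar>pdiff i f x\<bar> \<le> B" for x
    by (cases "x \<in> ?S") (use B pdiff_zero_outside_support[of x f i] in auto)
  obtain R where R: "\<And>x. x \<in> ?S \<Longrightarrow> norm x \<le> R"
    using compact_imp_bounded[OF supp] by (auto simp: bounded_iff)
  \<comment> \<open>step sizes of the difference quotients \<open>s n\<close>\<close>
  define t where "t n = inverse (real (Suc n))" for n
  have t: "t n > 0" "t n \<le> 1" for n by (auto simp: t_def inverse_le_1_iff)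
  define s where "s n x = (f (x + t n *\<^sub>R ?v) - f x) / t n" for n x
  have int_f: "integrable lborel f"
    by (rule integrable_continuous_compact_support[OF cont(1) supp f0])
  have shift: "integrable lborel (\<lambda>x. f (x + c))" "(\<integral>x. f (x + c) \<partial>lborel) = (\<integral>x. f x \<partial>lborel)" for c
  proof -
    have "distr lborel borel ((+) c) = lborel" by (rule lborel_distr_plus)
    moreover have "f \<in> borel_measurable borel" by (rule borel_measurable_continuous_onI[OF cont(1)])
    ultimately show "integrable lborel (\<lambda>x. f (x + c))" "(\<integral>x. f (x + c) \<partial>lborel) = (\<integral>x. f x \<partial>lborel)"
      using int_f integrable_distr_eq[of "(+) c" lborel borel f] integral_distr[of "(+) c" lborel borel f]
      by (simp_all add: add.commute)
  qed
  have int_s: "(\<integral>x. s n x \<partial>lborel) = 0" for n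
    unfolding s_def using shift int_f by (simp add: Bochner_Integration.integral_diff)
  \<comment> \<open>the mean value theorem gives an integrable bound, uniform in \<open>n\<close>\<close>
  have s_bound: "\<bar>s n x\<bar> \<le> indicator (cball 0 (R + 1)) x * B" for n x
  proof (cases "x \<in> cball 0 (R + 1)")
    case True
    obtain z where "f (x + t n *\<^sub>R ?v) - f (x + 0 *\<^sub>R ?v) = (t n - 0) * pdiff i f (x + z *\<^sub>R ?v)"
      using MVT2[OF t(1)[of n], of "\<lambda>u. f (x + u *\<^sub>R ?v)" "\<lambda>u. pdiff i f (x + u *\<^sub>R ?v)"]
        DERIV_along_axis[OF f] by blast
    then have "s n x = pdiff i f (x + z *\<^sub>R ?v)" using t(1)[of n] by (simp add: s_def)
    then show ?thesis using bd True by simp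
  next
    case False
    then have "norm x > R + 1" by simp
    moreover have "norm x \<le> norm (x + t n *\<^sub>R ?v) + norm (t n *\<^sub>R ?v)"
      using norm_triangle_ineq4[of "x + t n *\<^sub>R ?v" "t n *\<^sub>R ?v"] by simp
    moreover have "norm (t n *\<^sub>R ?v) \<le> 1" using t[of n] by simp
    ultimately have "x \<notin> ?S" "x + t n *\<^sub>R ?v \<notin> ?S" using R by force+
    from f0[OF this(1)] f0[OF this(2)] have "s n x = 0" by (simp add: s_def)
    then show ?thesis using B(1) by simp
  qed
  have lim: "(\<lambda>n. s n x) \<longlonglongrightarrow> pdiff i f x" for x
  proof -
    have "((\<lambda>h. (f (x + (0 + h) *\<^sub>R ?v) - f (x + 0 *\<^sub>R ?v)) / h) \<longlongrightarrow> pdiff i f (x + 0 *\<^sub>R ?v)) (at 0)"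
      using DERIV_along_axis[OF f, of x i 0] unfolding DERIV_def .
    moreover have "filterlim t (at 0) sequentially"
      unfolding filterlim_at using LIMSEQ_inverse_real_of_nat by (auto simp: t_def[abs_def])
    ultimately have "(\<lambda>n. (f (x + (0 + t n) *\<^sub>R ?v) - f (x + 0 *\<^sub>R ?v)) / t n)
        \<longlonglongrightarrow> pdiff i f (x + 0 *\<^sub>R ?v)"
      by (rule filterlim_compose)
    then show ?thesis by (simp add: s_def)
  qed
  have meas: "s n \<in> borel_measurable lborel" for n
  proof -
    have "continuous_on UNIV (\<lambda>x. f (x + t n *\<^sub>R ?v))"
      by (rule continuous_on_compose2[OF cont(1)]) (auto intro!: continuous_intros)
    then have "continuous_on UNIV (s n)"
      unfolding s_def[abs_def] using cont(1) t(1)[of n] by (intro continuous_intros) auto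
    then show ?thesis by (simp add: borel_measurable_continuous_onI)
  qed
  have w: "integrable lborel (\<lambda>x. indicator (cball 0 (R + 1)) x * B :: real)"
    using borel_integrable_compact[OF compact_cball continuous_on_const, of 0 "R + 1" B] by simp
  have gm: "pdiff i f \<in> borel_measurable lborel"
    using cont(2) by (simp add: borel_measurable_continuous_onI)
  have "(\<lambda>n. \<integral>x. s n x \<partial>lborel) \<longlonglongrightarrow> (\<integral>x. pdiff i f x \<partial>lborel)"
    by (rule integral_dominated_convergence[OF gm meas w AE_I2[OF lim] AE_I2]) (use s_bound in simp)
  then show ?thesis using LIMSEQ_unique[OF _ tendsto_const] by (simp add: int_s)
qed

lemma integral_pdiff_eq_0:
  fixes f :: "real^'d::finite \<Rightarrow> complex"
  assumes f: "smooth f" and supp: "compact (closure {x. f x \<noteq> 0})"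
  shows "(\<integral>x. pdiff i f x \<partial>lborel) = 0"
proof -
  have int: "integrable lborel (pdiff i f)"
    by (rule integrable_continuous_compact_support[OF smooth_continuous[OF smooth_pdiff[OF f]] supp
          pdiff_zero_outside_support])
  have zero: "(\<integral>x. pdiff i (\<lambda>x. L (f x)) x \<partial>lborel) = 0" if L: "bounded_linear L" for L :: "complex \<Rightarrow> real"
  proof (rule integral_pdiff_eq_0_real)
    show "smooth (\<lambda>x. L (f x))" by (rule smooth_bounded_linear[OF L f])
    have "closure {x. L (f x) \<noteq> 0} \<subseteq> closure {x. f x \<noteq> 0}"
      using linear_simps(3)[OF L] by (intro closure_mono) auto
    then show "compact (closure {x. L (f x) \<noteq> 0})"
      by (rule compact_closure_subset[OF supp])
  qed
  have "Re (\<integral>x. pdiff i f x \<partial>lborel) = 0" "Im (\<integral>x. pdiff i f x \<partial>lborel) = 0"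
    using zero[OF bounded_linear_Re] zero[OF bounded_linear_Im] integral_Re[OF int] integral_Im[OF int]
    by (simp_all add: pdiff_bounded_linear[OF bounded_linear_Re f] pdiff_bounded_linear[OF bounded_linear_Im f])
  then show ?thesis by (simp add: complex_eq_iff)
qed

lemma test_function_mult:
  fixes p \<psi> :: "real^'d::finite \<Rightarrow> complex"
  assumes "smooth p" "\<psi> \<in> test_functions \<Omega>"
  shows "(\<lambda>x. p x * \<psi> x) \<in> test_functions \<Omega>"
proof -
  have sub: "closure {x. p x * \<psi> x \<noteq> 0} \<subseteq> closure {x. \<psi> x \<noteq> 0}" by (intro closure_mono) auto
  have \<psi>: "smooth \<psi>" "compact (closure {x. \<psi> x \<noteq> 0})" "closure {x. \<psi> x \<noteq> 0} \<subseteq> \<Omega>"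
    using assms(2) by (auto simp: test_functions_iff)
  show ?thesis
    unfolding test_functions_iff
    using smooth_mult[OF assms(1) \<psi>(1)] compact_closure_subset[OF \<psi>(2) sub] order_trans[OF sub \<psi>(3)]
    by (intro conjI)
qed

lemma integral_pdiff_test_function:
  fixes f :: "real^'d::finite \<Rightarrow> complex"
  assumes "open \<Omega>" "f \<in> test_functions \<Omega>"
  shows "(\<integral>x. pdiff i f x \<partial>lebesgue_on \<Omega>) = 0"
proof -
  have f: "smooth f" "compact (closure {x. f x \<noteq> 0})" "closure {x. f x \<noteq> 0} \<subseteq> \<Omega>"
    using assms(2) by (auto simp: test_functions_iff)
  have "indicator \<Omega> x *\<^sub>R pdiff i f x = pdiff i f x" for x
    using pdiff_zero_outside_support[of x f i] f(3) by (auto simp: indicator_def)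
  then have "(\<integral>x. pdiff i f x \<partial>lebesgue_on \<Omega>) = (\<integral>x. pdiff i f x \<partial>lebesgue)"
    using assms(1) by (subst integral_restrict_space) (simp_all add: borel_open)
  also have "\<dots> = (\<integral>x. pdiff i f x \<partial>lborel)"
    by (rule integral_completion)
      (simp add: borel_measurable_continuous_onI smooth_continuous smooth_pdiff f(1))
  also have "\<dots> = 0" by (rule integral_pdiff_eq_0[OF f(1,2)])
  finally show ?thesis .
qed

lemma is_weak_partial_smooth:
  fixes f :: "real^'d::finite \<Rightarrow> complex"
  assumes \<Omega>: "open \<Omega>" "bounded \<Omega>" and f: "smooth f"
  shows "is_weak_partial \<Omega> i f (pdiff i f)"
  unfolding is_weak_partial_def classical_partial_eq
proof (intro conjI ballI)
  show L2: "f \<in> L2 \<Omega>" "pdiff i f \<in> L2 \<Omega>"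
    by (rule smooth_L2[OF \<Omega> f], rule smooth_L2[OF \<Omega> smooth_pdiff[OF f]])
  fix \<psi> :: "real^'d \<Rightarrow> complex" assume \<psi>: "\<psi> \<in> test_functions \<Omega>"
  have s: "smooth \<psi>" by (rule test_function_smooth[OF \<psi>])
  have L2\<psi>: "\<psi> \<in> L2 \<Omega>" "pdiff i \<psi> \<in> L2 \<Omega>"
    by (rule smooth_L2[OF \<Omega> s], rule smooth_L2[OF \<Omega> smooth_pdiff[OF s]])
  have "(\<integral>x. f x * pdiff i \<psi> x + pdiff i f x * \<psi> x \<partial>lebesgue_on \<Omega>) = 0"
    using integral_pdiff_test_function[OF \<Omega>(1) test_function_mult[OF f \<psi>], of i]
    by (simp add: pdiff_mult[OF f s])
  then show "(\<integral>x. f x * pdiff i \<psi> x \<partial>lebesgue_on \<Omega>) = - (\<integral>x. pdiff i f x * \<psi> x \<partial>lebesgue_on \<Omega>)"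
    using L2 L2\<psi> by (simp add: L2_mult_integrable add_eq_0_iff2)
qed

lemma is_weak_partial_add:
  assumes "open \<Omega>" "bounded \<Omega>" "is_weak_partial \<Omega> i f g" "is_weak_partial \<Omega> i f' g'"
  shows "is_weak_partial \<Omega> i (\<lambda>x. f x + f' x) (\<lambda>x. g x + g' x)"
  unfolding is_weak_partial_def classical_partial_eq
proof (intro conjI ballI)
  have L: "f \<in> L2 \<Omega>" "f' \<in> L2 \<Omega>" "g \<in> L2 \<Omega>" "g' \<in> L2 \<Omega>"
    using assms by (auto simp: is_weak_partial_def)
  then show "(\<lambda>x. f x + f' x) \<in> L2 \<Omega>" "(\<lambda>x. g x + g' x) \<in> L2 \<Omega>" by (auto intro: L2_add)
  fix \<psi> :: "real^'a \<Rightarrow> complex" assume \<psi>: "\<psi> \<in> test_functions \<Omega>"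
  have s: "smooth \<psi>" by (rule test_function_smooth[OF \<psi>])
  have "\<psi> \<in> L2 \<Omega>" "pdiff i \<psi> \<in> L2 \<Omega>"
    by (rule smooth_L2[OF assms(1,2) s], rule smooth_L2[OF assms(1,2) smooth_pdiff[OF s]])
  then show "(\<integral>x. (f x + f' x) * pdiff i \<psi> x \<partial>lebesgue_on \<Omega>) = - (\<integral>x. (g x + g' x) * \<psi> x \<partial>lebesgue_on \<Omega>)"
    using assms(3,4) \<psi> L by (simp add: distrib_right L2_mult_integrable is_weak_partial_def classical_partial_eq)
qed

lemma is_weak_partial_cmult:
  assumes "is_weak_partial \<Omega> i f g"
  shows "is_weak_partial \<Omega> i (\<lambda>x. c * f x) (\<lambda>x. c * g x)"
  using assms unfolding is_weak_partial_def
  by (auto intro: L2_mult_left simp: mult.assoc)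

lemma is_weak_partial_diff:
  assumes "open \<Omega>" "bounded \<Omega>" "is_weak_partial \<Omega> i f g" "is_weak_partial \<Omega> i f' g'"
  shows "is_weak_partial \<Omega> i (\<lambda>x. f x - f' x) (\<lambda>x. g x - g' x)"
  using is_weak_partial_add[OF assms(1-3) is_weak_partial_cmult[OF assms(4), of "-1"]] by simp

text \<open>This makes the particular choice of a representative in \<^const>\<open>weak_partial\<close> immaterial.\<close>

lemma is_weak_partial_unique:
  assumes "open \<Omega>" "bounded \<Omega>" "is_weak_partial \<Omega> i f g" "is_weak_partial \<Omega> i f g'"
  shows "AE x in lebesgue_on \<Omega>. g x = g' x"
proof -
  have "is_weak_partial \<Omega> i (\<lambda>x. f x - f x) (\<lambda>x. g x - g' x)"
    by (rule is_weak_partial_diff[OF assms])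
  then have "AE x in lebesgue_on \<Omega>. g x - g' x = 0"
    using assms(1,2) by (intro AE_0_if_orthogonal_to_test_functions) (auto simp: is_weak_partial_def)
  then show ?thesis by simp
qed

lemma weak_partial_is: "is_weak_partial \<Omega> i f g \<Longrightarrow> is_weak_partial \<Omega> i f (weak_partial \<Omega> i f)"
  unfolding weak_partial_def by (rule someI[of "is_weak_partial \<Omega> i f"])

lemma weak_partial_AE:
  assumes "open \<Omega>" "bounded \<Omega>" "is_weak_partial \<Omega> i f g"
  shows "AE x in lebesgue_on \<Omega>. weak_partial \<Omega> i f x = g x"
  by (rule is_weak_partial_unique[OF assms(1,2) weak_partial_is[OF assms(3)] assms(3)])


section \<open>Sobolev functions\<close>

lemma H1_weak_partial:
  assumes "v \<in> H1 \<Omega>"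
  shows "is_weak_partial \<Omega> i (\<lambda>x. v x $ j) (weak_partial \<Omega> i (\<lambda>x. v x $ j))"
  using assms weak_partial_is unfolding H1_def by blast

lemma weak_partial_L2: "v \<in> H1 \<Omega> \<Longrightarrow> weak_partial \<Omega> i (\<lambda>x. v x $ j) \<in> L2 \<Omega>"
  using H1_weak_partial[of v \<Omega> i j] by (simp add: is_weak_partial_def)

lemma H1_nth_L2: "v \<in> H1 \<Omega> \<Longrightarrow> (\<lambda>x. v x $ j) \<in> L2 \<Omega>"
  by (rule L2_nth) (simp add: H1_def)

lemma H10_H1: "v \<in> H10 \<Omega> \<Longrightarrow> v \<in> H1 \<Omega>"
  by (simp add: H10_def H1_closure_def)

lemma H1_add:
  assumes \<Omega>: "open \<Omega>" "bounded \<Omega>" and "u \<in> H1 \<Omega>" "v \<in> H1 \<Omega>"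
  shows "(\<lambda>x. u x + v x) \<in> H1 \<Omega>"
    and "AE x in lebesgue_on \<Omega>. weak_partial \<Omega> i (\<lambda>x. (u x + v x) $ j) x
      = weak_partial \<Omega> i (\<lambda>x. u x $ j) x + weak_partial \<Omega> i (\<lambda>x. v x $ j) x"
proof -
  have *: "is_weak_partial \<Omega> i (\<lambda>x. (u x + v x) $ j)
      (\<lambda>x. weak_partial \<Omega> i (\<lambda>x. u x $ j) x + weak_partial \<Omega> i (\<lambda>x. v x $ j) x)" for i j
    using is_weak_partial_add[OF \<Omega> H1_weak_partial[OF assms(3)] H1_weak_partial[OF assms(4)]] by simp
  show "(\<lambda>x. u x + v x) \<in> H1 \<Omega>"
    using assms(3,4) * unfolding H1_def by (auto intro: L2_add)
  show "AE x in lebesgue_on \<Omega>. weak_partial \<Omega> i (\<lambda>x. (u x + v x) $ j) x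
      = weak_partial \<Omega> i (\<lambda>x. u x $ j) x + weak_partial \<Omega> i (\<lambda>x. v x $ j) x"
    by (rule weak_partial_AE[OF \<Omega> *])
qed

lemma H1_diff:
  assumes \<Omega>: "open \<Omega>" "bounded \<Omega>" and "u \<in> H1 \<Omega>" "v \<in> H1 \<Omega>"
  shows "(\<lambda>x. u x - v x) \<in> H1 \<Omega>"
    and "AE x in lebesgue_on \<Omega>. weak_partial \<Omega> i (\<lambda>x. (u x - v x) $ j) x
      = weak_partial \<Omega> i (\<lambda>x. u x $ j) x - weak_partial \<Omega> i (\<lambda>x. v x $ j) x"
proof -
  have *: "is_weak_partial \<Omega> i (\<lambda>x. (u x - v x) $ j)
      (\<lambda>x. weak_partial \<Omega> i (\<lambda>x. u x $ j) x - weak_partial \<Omega> i (\<lambda>x. v x $ j) x)" for i j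
    using is_weak_partial_diff[OF \<Omega> H1_weak_partial[OF assms(3)] H1_weak_partial[OF assms(4)]] by simp
  show "(\<lambda>x. u x - v x) \<in> H1 \<Omega>"
    using assms(3,4) * unfolding H1_def by (auto intro: L2_diff)
  show "AE x in lebesgue_on \<Omega>. weak_partial \<Omega> i (\<lambda>x. (u x - v x) $ j) x
      = weak_partial \<Omega> i (\<lambda>x. u x $ j) x - weak_partial \<Omega> i (\<lambda>x. v x $ j) x"
    by (rule weak_partial_AE[OF \<Omega> *])
qed

lemma bounded_linear_smult_vec: "bounded_linear (\<lambda>v :: complex^'d::finite. c *s v)"
  unfolding linear_conv_bounded_linear[symmetric]
  by (rule linearI) (simp_all add: vec_eq_iff algebra_simps scaleR_conv_of_real)

lemma H1_cmult:
  assumes "u \<in> H1 \<Omega>"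
  shows "(\<lambda>x. c *s u x) \<in> H1 \<Omega>"
proof -
  have "is_weak_partial \<Omega> i (\<lambda>x. (c *s u x) $ j) (\<lambda>x. c * weak_partial \<Omega> i (\<lambda>x. u x $ j) x)" for i j
    using is_weak_partial_cmult[OF H1_weak_partial[OF assms]] by simp
  moreover have "(\<lambda>x. c *s u x) \<in> L2 \<Omega>"
    using assms by (intro L2_bounded_linear[OF bounded_linear_smult_vec]) (simp add: H1_def)
  ultimately show ?thesis unfolding H1_def by blast
qed

lemma H1_cmult_AE:
  assumes \<Omega>: "open \<Omega>" "bounded \<Omega>" and "u \<in> H1 \<Omega>"
  shows "AE x in lebesgue_on \<Omega>. weak_partial \<Omega> i (\<lambda>x. (c *s u x) $ j) x = c * weak_partial \<Omega> i (\<lambda>x. u x $ j) x"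
  using weak_partial_AE[OF \<Omega> is_weak_partial_cmult[OF H1_weak_partial[OF assms(3)]]] by simp

lemma smooth_weak_partial_AE:
  assumes \<Omega>: "open \<Omega>" "bounded \<Omega>" and "smooth u"
  shows "AE x in lebesgue_on \<Omega>. weak_partial \<Omega> i (\<lambda>x. u x $ j) x = pdiff i (\<lambda>x. u x $ j) x"
  by (rule weak_partial_AE[OF \<Omega> is_weak_partial_smooth[OF \<Omega> smooth_nth[OF assms(3)]]])

lemma smooth_H1:
  assumes \<Omega>: "open \<Omega>" "bounded \<Omega>" and "smooth u"
  shows "u \<in> H1 \<Omega>"
  using smooth_L2[OF assms] is_weak_partial_smooth[OF \<Omega> smooth_nth[OF assms(3)]]
  unfolding H1_def by blast

lemma norm_matrix_sq:
  fixes A :: "complex^'d^'d::finite"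
  shows "(norm A)\<^sup>2 = (\<Sum>j\<in>UNIV. \<Sum>i\<in>UNIV. (norm (A $ j $ i))\<^sup>2)"
  by (simp add: norm_vec_def L2_set_def sum_nonneg real_sqrt_pow2)

lemma norm_nth_le_matrix: "norm (A $ j $ i) \<le> norm A" for A :: "complex^'d^'d::finite"
  using order_trans[OF Finite_Cartesian_Product.norm_nth_le Finite_Cartesian_Product.norm_nth_le] by blast

lemma weak_grad_integrable_sq:
  assumes "v \<in> H1 \<Omega>"
  shows "integrable (lebesgue_on \<Omega>) (\<lambda>x. (norm (weak_grad \<Omega> v x))\<^sup>2)"
  unfolding norm_matrix_sq weak_grad_def
  using L2_integrable_sq[OF weak_partial_L2[OF assms]] by simp

lemma L2_norm_weak_partial_le:
  assumes "v \<in> H1 \<Omega>"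
  shows "L2_norm \<Omega> (weak_partial \<Omega> i (\<lambda>x. v x $ j)) \<le> H1_norm \<Omega> v"
proof -
  have "norm (weak_partial \<Omega> i (\<lambda>x. v x $ j) x) \<le> norm (weak_grad \<Omega> v x)" for x
    using norm_nth_le_matrix[of "weak_grad \<Omega> v x" j i] by (simp add: weak_grad_def)
  then have "L2_norm \<Omega> (weak_partial \<Omega> i (\<lambda>x. v x $ j)) \<le> L2_norm \<Omega> (weak_grad \<Omega> v)"
    by (intro L2_norm_mono L2_measurable weak_partial_L2 weak_grad_integrable_sq assms)
  also have "\<dots> \<le> H1_norm \<Omega> v"
    unfolding H1_norm_def by (rule real_le_rsqrt) simp
  finally show ?thesis .
qed

lemma L2_norm_nth_le:
  assumes "v \<in> H1 \<Omega>"
  shows "L2_norm \<Omega> (\<lambda>x. v x $ j) \<le> H1_norm \<Omega> v"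
proof -
  have "v \<in> L2 \<Omega>" using assms by (simp add: H1_def)
  then have "L2_norm \<Omega> (\<lambda>x. v x $ j) \<le> L2_norm \<Omega> v"
    by (intro L2_norm_mono L2_measurable L2_nth L2_integrable_sq Finite_Cartesian_Product.norm_nth_le)
  also have "\<dots> \<le> H1_norm \<Omega> v"
    unfolding H1_norm_def by (rule real_le_rsqrt) simp
  finally show ?thesis .
qed

lemma H1_norm_nonneg: "H1_norm \<Omega> v \<ge> 0"
  by (simp add: H1_norm_def)

lemma H1_norm_0:
  assumes \<Omega>: "open \<Omega>" "bounded (\<Omega> :: (real^'d::finite) set)"
  shows "H1_norm \<Omega> (\<lambda>x. 0) = 0"
proof -
  have "AE x in lebesgue_on \<Omega>. \<forall>j i. weak_partial \<Omega> i (\<lambda>x. (0::complex^'d) $ j) x = 0"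
  proof (intro eventually_all_finite)
    fix i j :: 'd
    have "pdiff i (\<lambda>x. (0::complex^'d) $ j) x = 0" for x by (simp add: pdiff_def)
    then show "AE x in lebesgue_on \<Omega>. weak_partial \<Omega> i (\<lambda>x. (0::complex^'d) $ j) x = 0"
      using smooth_weak_partial_AE[OF \<Omega> smooth_const[of 0], of i j] by simp
  qed
  then have "AE x in lebesgue_on \<Omega>. (norm (weak_grad \<Omega> (\<lambda>x. 0) x))\<^sup>2 = 0"
    by eventually_elim (simp add: norm_matrix_sq weak_grad_def)
  then have "(\<integral>x. (norm (weak_grad \<Omega> (\<lambda>x. 0) x))\<^sup>2 \<partial>lebesgue_on \<Omega>) = 0"
    by (rule integral_eq_zero_AE)
  then have "L2_norm \<Omega> (weak_grad \<Omega> (\<lambda>x. 0)) = 0" by (simp add: L2_norm_def)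
  moreover have "L2_norm \<Omega> (\<lambda>x. 0 :: complex^'d) = 0" by (simp add: L2_norm_def)
  ultimately show ?thesis by (simp add: H1_norm_def)
qed

text \<open>Although \<open>u\<close> approximates itself, this needs the uniqueness of weak derivatives: the seminorm of
the difference \<open>0\<close> refers to a chosen weak derivative of \<open>0\<close>.\<close>

lemma subset_H1_closure:
  assumes \<Omega>: "open \<Omega>" "bounded \<Omega>" and "u \<in> A" "smooth u"
  shows "u \<in> H1_closure \<Omega> A"
  unfolding H1_closure_def using assms H1_norm_0[OF \<Omega>]
  by (auto intro!: smooth_H1 bexI[of _ u])

text \<open>The boundary term vanishes because \<open>v\<close> does, whatever the boundary values of \<open>p\<close>.  For test functions
\<open>v\<close> it says that the classical derivative of \<open>p\<close> is a weak derivative, and both sides are continuous in the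
\<open>H\<^sup>1\<close> norm.\<close>

lemma H10_integration_by_parts:
  fixes p :: "real^'d::finite \<Rightarrow> complex"
  assumes \<Omega>: "open \<Omega>" "bounded \<Omega>" and p: "smooth p" and v: "v \<in> H10 \<Omega>"
  shows "(\<integral>x. p x * weak_partial \<Omega> i (\<lambda>x. v x $ j) x \<partial>lebesgue_on \<Omega>)
    = - (\<integral>x. pdiff i p x * v x $ j \<partial>lebesgue_on \<Omega>)"
proof -
  let ?M = "lebesgue_on \<Omega>"
  \<comment> \<open>the defect of the formula; it is bounded by the \<open>H\<^sup>1\<close> norm, so that it suffices to see it vanish on test functions\<close>
  define D where "D w = (\<integral>x. p x * weak_partial \<Omega> i (\<lambda>x. w x $ j) x \<partial>?M) + (\<integral>x. pdiff i p x * w x $ j \<partial>?M)"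
    for w :: "real^'d \<Rightarrow> complex^'d"
  have pL: "p \<in> L2 \<Omega>" "pdiff i p \<in> L2 \<Omega>"
    by (rule smooth_L2[OF \<Omega> p], rule smooth_L2[OF \<Omega> smooth_pdiff[OF p]])
  define C where "C = L2_norm \<Omega> p + L2_norm \<Omega> (pdiff i p)"
  have C: "C \<ge> 0" by (simp add: C_def L2_norm_nonneg)
  have bound: "norm (D w) \<le> C * H1_norm \<Omega> w" if w: "w \<in> H1 \<Omega>" for w
  proof -
    have "norm (D w) \<le> L2_norm \<Omega> p * L2_norm \<Omega> (weak_partial \<Omega> i (\<lambda>x. w x $ j))
        + L2_norm \<Omega> (pdiff i p) * L2_norm \<Omega> (\<lambda>x. w x $ j)"
      unfolding D_def using norm_integral_L2_le[OF pL(1) weak_partial_L2[OF w]]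
        norm_integral_L2_le[OF pL(2) H1_nth_L2[OF w]] by (intro norm_triangle_mono)
    also have "\<dots> \<le> L2_norm \<Omega> p * H1_norm \<Omega> w + L2_norm \<Omega> (pdiff i p) * H1_norm \<Omega> w"
      by (intro add_mono mult_left_mono L2_norm_weak_partial_le L2_norm_nth_le w L2_norm_nonneg)
    finally show ?thesis by (simp add: C_def distrib_right)
  qed
  have test: "D \<phi> = 0" if \<phi>: "\<phi> \<in> test_functions \<Omega>" for \<phi>
  proof -
    have s: "smooth \<phi>" by (rule test_function_smooth[OF \<phi>])
    have sub: "closure {x. \<phi> x $ j \<noteq> 0} \<subseteq> closure {x. \<phi> x \<noteq> 0}" by (intro closure_mono) auto
    have \<phi>j: "(\<lambda>x. \<phi> x $ j) \<in> test_functions \<Omega>"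
      using \<phi> smooth_nth[OF s, of j] compact_closure_subset[OF _ sub] order_trans[OF sub]
      by (simp add: test_functions_iff)
    have ae: "AE x in ?M. weak_partial \<Omega> i (\<lambda>x. \<phi> x $ j) x = pdiff i (\<lambda>x. \<phi> x $ j) x"
      by (rule smooth_weak_partial_AE[OF \<Omega> s])
    have m: "(\<lambda>x. p x * weak_partial \<Omega> i (\<lambda>x. \<phi> x $ j) x) \<in> borel_measurable ?M"
      "(\<lambda>x. p x * pdiff i (\<lambda>x. \<phi> x $ j) x) \<in> borel_measurable ?M"
      using borel_measurable_integrable[OF L2_mult_integrable[OF pL(1) weak_partial_L2[OF smooth_H1[OF \<Omega> s]]]]
        borel_measurable_integrable[OF L2_mult_integrable[OF pL(1) smooth_L2[OF \<Omega> smooth_pdiff[OF smooth_nth[OF s]]]]]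
      by simp_all
    have "(\<integral>x. p x * weak_partial \<Omega> i (\<lambda>x. \<phi> x $ j) x \<partial>?M) = (\<integral>x. p x * pdiff i (\<lambda>x. \<phi> x $ j) x \<partial>?M)"
      by (rule integral_cong_AE[OF m]) (use ae in eventually_elim, simp)
    also have "\<dots> = - (\<integral>x. pdiff i p x * \<phi> x $ j \<partial>?M)"
      using is_weak_partial_smooth[OF \<Omega> p, of i] \<phi>j
      by (simp add: is_weak_partial_def classical_partial_eq)
    finally show ?thesis by (simp add: D_def)
  qed
  have diff: "D (\<lambda>x. v x - \<phi> x) = D v - D \<phi>" if \<phi>: "\<phi> \<in> H1 \<Omega>" for \<phi>
  proof -
    note v1 = H10_H1[OF v]
    note d = H1_diff[OF \<Omega> v1 \<phi>]
    have i: "integrable ?M (\<lambda>x. p x * weak_partial \<Omega> i (\<lambda>x. w x $ j) x)"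
      "integrable ?M (\<lambda>x. pdiff i p x * w x $ j)" if "w \<in> H1 \<Omega>" for w
      by (rule L2_mult_integrable[OF pL(1) weak_partial_L2[OF that]], rule L2_mult_integrable[OF pL(2) H1_nth_L2[OF that]])
    have "(\<integral>x. p x * weak_partial \<Omega> i (\<lambda>x. (v x - \<phi> x) $ j) x \<partial>?M)
        = (\<integral>x. p x * weak_partial \<Omega> i (\<lambda>x. v x $ j) x - p x * weak_partial \<Omega> i (\<lambda>x. \<phi> x $ j) x \<partial>?M)"
    proof (rule integral_cong_AE)
      show "AE x in ?M. p x * weak_partial \<Omega> i (\<lambda>x. (v x - \<phi> x) $ j) x
          = p x * weak_partial \<Omega> i (\<lambda>x. v x $ j) x - p x * weak_partial \<Omega> i (\<lambda>x. \<phi> x $ j) x"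
        using d(2)[of i j] by eventually_elim (simp add: right_diff_distrib)
    qed (intro borel_measurable_integrable Bochner_Integration.integrable_diff i v1 \<phi> d(1))+
    then show ?thesis
      using i[OF v1] i[OF \<phi>] by (simp add: D_def right_diff_distrib)
  qed
  have "norm (D v) \<le> e" if e: "e > 0" for e
  proof -
    have "e / (C + 1) > 0" using e C by simp
    then obtain \<phi> where \<phi>: "\<phi> \<in> test_functions \<Omega>" "H1_norm \<Omega> (\<lambda>x. v x - \<phi> x) < e / (C + 1)"
      using v unfolding H10_def H1_closure_def by blast
    have \<phi>1: "\<phi> \<in> H1 \<Omega>" by (rule smooth_H1[OF \<Omega> test_function_smooth[OF \<phi>(1)]])
    have "norm (D v) = norm (D (\<lambda>x. v x - \<phi> x))" using diff[OF \<phi>1] test[OF \<phi>(1)] by simp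
    also have "\<dots> \<le> C * H1_norm \<Omega> (\<lambda>x. v x - \<phi> x)"
      by (rule bound[OF H1_diff(1)[OF \<Omega> H10_H1[OF v] \<phi>1]])
    also have "\<dots> \<le> (C + 1) * (e / (C + 1))"
      using \<phi>(2) C by (intro mult_mono) (auto simp: H1_norm_nonneg)
    also have "\<dots> = e" using C by simp
    finally show ?thesis .
  qed
  then have "norm (D v) \<le> 0" by (rule field_le_epsilon[of _ 0, simplified])
  then have "D v = 0" by simp
  then show ?thesis by (simp add: D_def add_eq_0_iff2)
qed


section \<open>Functionals in divergence form\<close>

text \<open>The functional \<open>- div G\<close> in weak form, for a matrix field \<open>G\<close>.\<close>

definition grad_functional ::
    "(real^'d) set \<Rightarrow> ('d \<Rightarrow> 'd \<Rightarrow> real^'d \<Rightarrow> complex) \<Rightarrow> (real^'d \<Rightarrow> complex^'d::finite) \<Rightarrow> complex" where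
  "grad_functional \<Omega> G v =
     (\<integral>x. (\<Sum>j\<in>UNIV. \<Sum>i\<in>UNIV. G j i x * cnj (weak_grad \<Omega> v x $ j $ i)) \<partial>lebesgue_on \<Omega>)"

lemma grad_functional_eq:
  assumes "\<And>j i. G j i \<in> L2 \<Omega>" "v \<in> H1 \<Omega>"
  shows "grad_functional \<Omega> G v =
    (\<Sum>j\<in>UNIV. \<Sum>i\<in>UNIV. \<integral>x. G j i x * cnj (weak_partial \<Omega> i (\<lambda>x. v x $ j) x) \<partial>lebesgue_on \<Omega>)"
proof -
  have "integrable (lebesgue_on \<Omega>) (\<lambda>x. G j i x * cnj (weak_partial \<Omega> i (\<lambda>x. v x $ j) x))" for j i
    by (rule L2_mult_integrable[OF assms(1) L2_cnj[OF weak_partial_L2[OF assms(2)]]])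
  then show ?thesis
    unfolding grad_functional_def weak_grad_def by (simp add: Bochner_Integration.integral_sum)
qed

lemma grad_functional_bound:
  assumes G: "\<And>j i. G j i \<in> L2 \<Omega>" and v: "v \<in> H1 \<Omega>"
  shows "norm (grad_functional \<Omega> G v) \<le> (\<Sum>j\<in>UNIV. \<Sum>i\<in>UNIV. L2_norm \<Omega> (G j i)) * H1_norm \<Omega> v"
proof -
  have "norm (\<integral>x. G j i x * cnj (weak_partial \<Omega> i (\<lambda>x. v x $ j) x) \<partial>lebesgue_on \<Omega>) \<le> L2_norm \<Omega> (G j i) * H1_norm \<Omega> v" for j i
    using norm_integral_L2_le[OF G L2_cnj[OF weak_partial_L2[OF v, of i j]], of j i]
      mult_left_mono[OF L2_norm_weak_partial_le[OF v, of i j] L2_norm_nonneg[of \<Omega> "G j i"]]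
    unfolding L2_norm_cnj by linarith
  then show ?thesis
    unfolding grad_functional_eq[OF G v] sum_distrib_right
    by (intro order_trans[OF norm_sum] sum_mono)
qed

lemma grad_functional_Hneg1:
  assumes \<Omega>: "open \<Omega>" "bounded \<Omega>" and G: "\<And>j i. G j i \<in> L2 \<Omega>"
  shows "grad_functional \<Omega> G \<in> Hneg1 \<Omega>"
proof -
  let ?M = "lebesgue_on \<Omega>"
  have int: "integrable ?M (\<lambda>x. G j i x * cnj (weak_partial \<Omega> i (\<lambda>x. v x $ j) x))" if "v \<in> H1 \<Omega>" for v j i
    by (rule L2_mult_integrable[OF G L2_cnj[OF weak_partial_L2[OF that]]])
  have add: "grad_functional \<Omega> G (\<lambda>x. u x + v x) = grad_functional \<Omega> G u + grad_functional \<Omega> G v"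
    if u: "u \<in> H1 \<Omega>" and v: "v \<in> H1 \<Omega>" for u v
  proof -
    note s = H1_add[OF \<Omega> u v]
    have "(\<integral>x. G j i x * cnj (weak_partial \<Omega> i (\<lambda>x. (u x + v x) $ j) x) \<partial>?M)
      = (\<integral>x. G j i x * cnj (weak_partial \<Omega> i (\<lambda>x. u x $ j) x) + G j i x * cnj (weak_partial \<Omega> i (\<lambda>x. v x $ j) x) \<partial>?M)" for j i
    proof (rule integral_cong_AE)
      show "AE x in ?M. G j i x * cnj (weak_partial \<Omega> i (\<lambda>x. (u x + v x) $ j) x)
        = G j i x * cnj (weak_partial \<Omega> i (\<lambda>x. u x $ j) x) + G j i x * cnj (weak_partial \<Omega> i (\<lambda>x. v x $ j) x)"
        using s(2)[of i j] by eventually_elim (simp add: distrib_left)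
    qed (intro borel_measurable_integrable Bochner_Integration.integrable_add int u v s(1))+
    then show ?thesis
      using int[OF u] int[OF v]
      by (simp add: grad_functional_eq[OF G s(1)] grad_functional_eq[OF G u] grad_functional_eq[OF G v] sum.distrib)
  qed
  have scale: "grad_functional \<Omega> G (\<lambda>x. c *s u x) = cnj c * grad_functional \<Omega> G u" if u: "u \<in> H1 \<Omega>" for c u
  proof -
    have "(\<integral>x. G j i x * cnj (weak_partial \<Omega> i (\<lambda>x. (c *s u x) $ j) x) \<partial>?M)
      = (\<integral>x. cnj c * (G j i x * cnj (weak_partial \<Omega> i (\<lambda>x. u x $ j) x)) \<partial>?M)" for j i
    proof (rule integral_cong_AE)
      show "AE x in ?M. G j i x * cnj (weak_partial \<Omega> i (\<lambda>x. (c *s u x) $ j) x)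
        = cnj c * (G j i x * cnj (weak_partial \<Omega> i (\<lambda>x. u x $ j) x))"
        using H1_cmult_AE[OF \<Omega> u, of i c j] by eventually_elim simp
    qed (intro borel_measurable_integrable integrable_mult_right int u H1_cmult)+
    then show ?thesis
      by (simp add: grad_functional_eq[OF G H1_cmult[OF u]] grad_functional_eq[OF G u] sum_distrib_left)
  qed
  show ?thesis
    unfolding Hneg1_def mem_Collect_eq
  proof (intro conjI ballI allI)
    show "\<exists>C. \<forall>u\<in>H10 \<Omega>. norm (grad_functional \<Omega> G u) \<le> C * H1_norm \<Omega> u"
      by (intro exI[of _ "\<Sum>j\<in>UNIV. \<Sum>i\<in>UNIV. L2_norm \<Omega> (G j i)"] ballI grad_functional_bound[OF G] H10_H1)
  qed (intro add scale H10_H1; assumption)+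
qed

lemma grad_functional_norm:
  fixes \<Omega> :: "(real^'d::finite) set"
  assumes \<Omega>: "open \<Omega>" "bounded \<Omega>" and G: "\<And>j i. G j i \<in> L2 \<Omega>"
  shows "Hneg1_norm \<Omega> (grad_functional \<Omega> G) \<le> (\<Sum>j\<in>UNIV. \<Sum>i\<in>UNIV. L2_norm \<Omega> (G j i))"
  unfolding Hneg1_norm_def
proof (rule cSUP_least)
  have "(\<lambda>x. 0) \<in> H10 \<Omega>"
    unfolding H10_def by (intro subset_H1_closure \<Omega>) (simp_all add: test_functions_iff smooth_const)
  then show "{v \<in> H10 \<Omega>. H1_norm \<Omega> v \<le> 1} \<noteq> {}" using H1_norm_0[OF \<Omega>] by force
  fix v assume v: "v \<in> {v \<in> H10 \<Omega>. H1_norm \<Omega> v \<le> 1}"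
  let ?S = "\<Sum>j\<in>UNIV. \<Sum>i\<in>UNIV. L2_norm \<Omega> (G j i)"
  have "norm (grad_functional \<Omega> G v) \<le> ?S * H1_norm \<Omega> v"
    using v by (intro grad_functional_bound G H10_H1) simp
  also have "\<dots> \<le> ?S * 1"
    using v by (intro mult_left_mono sum_nonneg L2_norm_nonneg) simp
  finally show "norm (grad_functional \<Omega> G v) \<le> ?S" by simp
qed


section \<open>A boundary layer flow with large pressure\<close>

definition stream_function :: "(real^'d::finite \<Rightarrow> real) \<Rightarrow> 'd \<Rightarrow> real^'d \<Rightarrow> real" where
  "stream_function \<eta> b x = \<eta> x * x $ b"

text \<open>The components of \<open>1 / s\<close> times the rotated gradient \<open>(d\<^sub>b, - d\<^sub>a)\<close>, in the plane of the coordinates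
\<open>a\<close> and \<open>b\<close>, of the stream function.  On open sets where \<open>\<eta> = 1\<close> this is the constant field \<open>e\<^sub>a / s\<close>.\<close>

definition layer_velocity :: "real \<Rightarrow> (real^'d::finite \<Rightarrow> real) \<Rightarrow> 'd \<Rightarrow> 'd \<Rightarrow> 'd \<Rightarrow> real^'d \<Rightarrow> real" where
  "layer_velocity s \<eta> a b j x =
     (if j = a then pdiff b (stream_function \<eta> b) x / s else if j = b then - (pdiff a (stream_function \<eta> b) x / s) else 0)"

text \<open>A matrix field \<open>G\<close> with \<open>- div G = s\<^sup>2 u - \<Delta> u + \<nabla> \<phi>\<close> for \<open>u\<close> the layer velocity and
\<open>\<phi> = - s x\<^sub>a\<close>.  The second summand is, up to sign, an antisymmetric primitive of \<open>s\<^sup>2 u + \<nabla> \<phi>\<close>, the rotated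
gradient of \<open>s (\<eta> - 1) x\<^sub>b\<close>: passing to it gains a factor of the layer width \<open>1 / s\<close>.\<close>

definition layer_flux :: "real \<Rightarrow> (real^'d::finite \<Rightarrow> real) \<Rightarrow> 'd \<Rightarrow> 'd \<Rightarrow> 'd \<Rightarrow> 'd \<Rightarrow> real^'d \<Rightarrow> real" where
  "layer_flux s \<eta> a b j i x = pdiff i (layer_velocity s \<eta> a b j) x
     + ((if j = a \<and> i = b then - s * (stream_function \<eta> b x - x $ b) else 0)
      + (if j = b \<and> i = a then s * (stream_function \<eta> b x - x $ b) else 0))"

lemma smooth_stream_function: "smooth \<eta> \<Longrightarrow> smooth (stream_function \<eta> b)"
  unfolding stream_function_def[abs_def] by (intro smooth_mult smooth_coord)

lemma layer_velocity_cases: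
  "layer_velocity s \<eta> a b a = (\<lambda>x. (1 / s) * pdiff b (stream_function \<eta> b) x)"
  "a \<noteq> b \<Longrightarrow> layer_velocity s \<eta> a b b = (\<lambda>x. (- (1 / s)) * pdiff a (stream_function \<eta> b) x)"
  "j \<noteq> a \<Longrightarrow> j \<noteq> b \<Longrightarrow> layer_velocity s \<eta> a b j = (\<lambda>x. 0)"
  by (auto simp: layer_velocity_def fun_eq_iff)

lemma smooth_layer_velocity:
  assumes "smooth \<eta>" "a \<noteq> b"
  shows "smooth (layer_velocity s \<eta> a b j)"
proof -
  consider "j = a" | "j = b" | "j \<noteq> a" "j \<noteq> b" by blast
  then show ?thesis
    by cases (simp_all only: layer_velocity_cases assms(2) smooth_const smooth_cmult smooth_pdiff smooth_stream_function assms(1) not_False_eq_True)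
qed

lemma smooth_layer_flux:
  assumes "smooth \<eta>" "a \<noteq> b"
  shows "smooth (layer_flux s \<eta> a b j i)"
proof -
  have p: "smooth (\<lambda>x. c * (stream_function \<eta> b x - x $ b))" for c
    by (intro smooth_cmult smooth_diff smooth_stream_function smooth_coord assms(1))
  have q: "smooth (\<lambda>x. if P then c * (stream_function \<eta> b x - x $ b) else 0)" for P c
    using p[of c] by (cases P) (simp_all add: smooth_const)
  have "smooth (\<lambda>x. pdiff i (layer_velocity s \<eta> a b j) x
     + ((if j = a \<and> i = b then - s * (stream_function \<eta> b x - x $ b) else 0)
      + (if j = b \<and> i = a then s * (stream_function \<eta> b x - x $ b) else 0)))"
    by (intro smooth_add smooth_pdiff smooth_layer_velocity assms q)
  then show ?thesis by (simp add: layer_flux_def[abs_def])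
qed

lemma pdiff_stream_function:
  assumes "smooth \<eta>"
  shows "pdiff i (stream_function \<eta> b) x = \<eta> x * (if i = b then 1 else 0) + pdiff i \<eta> x * x $ b"
  unfolding stream_function_def[abs_def] by (simp add: pdiff_mult[OF assms smooth_coord] pdiff_nth)

lemma pdiff_pdiff_stream_function:
  assumes \<eta>: "smooth \<eta>"
  shows "pdiff k (pdiff i (stream_function \<eta> b)) x = pdiff k \<eta> x * (if i = b then 1 else 0)
    + (pdiff i \<eta> x * (if k = b then 1 else 0) + pdiff k (pdiff i \<eta>) x * x $ b)"
proof -
  let ?c = "if i = b then 1 else 0 :: real"
  have "pdiff i (stream_function \<eta> b) = (\<lambda>x. \<eta> x * ?c + pdiff i \<eta> x * x $ b)"
    by (rule ext) (rule pdiff_stream_function[OF \<eta>])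
  then have "pdiff k (pdiff i (stream_function \<eta> b)) x = pdiff k (\<lambda>x. \<eta> x * ?c) x + pdiff k (\<lambda>x. pdiff i \<eta> x * x $ b) x"
    by (simp only: pdiff_add[OF smooth_mult[OF \<eta> smooth_const] smooth_mult[OF smooth_pdiff[OF \<eta>] smooth_coord]])
  also have "pdiff k (\<lambda>x. \<eta> x * ?c) x = pdiff k \<eta> x * ?c"
    by (simp only: pdiff_mult[OF \<eta> smooth_const] pdiff_const mult_zero_right add_0)
  also have "pdiff k (\<lambda>x. pdiff i \<eta> x * x $ b) x = pdiff i \<eta> x * (if k = b then 1 else 0) + pdiff k (pdiff i \<eta>) x * x $ b"
    by (simp only: pdiff_mult[OF smooth_pdiff[OF \<eta>] smooth_coord] pdiff_nth)
  finally show ?thesis .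
qed

text \<open>Off \<open>L\<close> the velocity is constant, and \<open>s\<^sup>2\<close> times it cancels the pressure gradient.  On \<open>L\<close> the velocity gradient is
\<open>1 / s\<close> times second derivatives of size \<open>s\<^sup>2\<close>, and the antisymmetric part is \<open>s\<close> times a bounded
function.\<close>

lemma layer_flux_bound:
  assumes \<eta>: "boundary_cutoff \<Omega> C (1 / s) \<eta> L" and s: "s \<ge> 1" and C: "C \<ge> 0" and ab: "a \<noteq> b"
    and R: "\<And>x. x \<in> \<Omega> \<Longrightarrow> norm x \<le> R" "R \<ge> 0" and x: "x \<in> \<Omega>"
  shows "\<bar>layer_flux s \<eta> a b j i x\<bar> \<le> (C * (2 + R) + (C + 1) * R) * s * indicator L x"
proof -
  note \<eta> = boundary_cutoffD[OF \<eta>]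
  note sm = \<eta>(1)
  have xb: "\<bar>x $ b\<bar> \<le> R" using R(1)[OF x] component_le_norm_cart[of x b] by linarith
  have vel: "pdiff i (layer_velocity s \<eta> a b j) x = (if j = a then (1 / s) * pdiff i (pdiff b (stream_function \<eta> b)) x
      else if j = b then - (1 / s) * pdiff i (pdiff a (stream_function \<eta> b)) x else 0)"
  proof -
    have m: "pdiff i (\<lambda>x. c * pdiff k (stream_function \<eta> b) x) x = c * pdiff i (pdiff k (stream_function \<eta> b)) x" for c k
      by (rule pdiff_bounded_linear[OF bounded_linear_mult_right smooth_pdiff[OF smooth_stream_function[OF sm]]])
    consider "j = a" | "j = b" | "j \<noteq> a" "j \<noteq> b" by blast
    then show ?thesis
      by cases (simp_all only: ab ab[symmetric] layer_velocity_cases m pdiff_const if_True if_False refl not_False_eq_True)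
  qed
  show ?thesis
  proof (cases "x \<in> L")
    case False
    with x have xL: "x \<in> \<Omega> - L" by blast
    note z = \<eta>(9-11)[OF xL]
    have "pdiff l (pdiff k (stream_function \<eta> b)) x = 0" for k l
      unfolding pdiff_pdiff_stream_function[OF sm] z by simp
    then have v0: "pdiff i (layer_velocity s \<eta> a b j) x = 0" unfolding vel by simp
    have p0: "stream_function \<eta> b x - x $ b = 0" unfolding stream_function_def z by simp
    have "layer_flux s \<eta> a b j i x = 0"
      by (simp only: layer_flux_def v0 p0 mult_zero_right if_cancel add_0)
    then show ?thesis using False by simp
  next
    case True
    have b0: "\<bar>\<eta> x\<bar> \<le> C" and b1: "\<bar>pdiff k \<eta> x\<bar> \<le> C * s" and b2: "\<bar>pdiff l (pdiff k \<eta>) x\<bar> \<le> C * s\<^sup>2" for k l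
      using \<eta>(6)[of x] \<eta>(7)[of k x] \<eta>(8)[of l k x] by (simp_all add: power_divide)
    \<comment> \<open>as \<open>s \<ge> 1\<close>, first derivatives of \<open>\<eta>\<close> are absorbed by the bound for second derivatives\<close>
    have ss: "s \<le> s\<^sup>2" using s by (simp add: power2_eq_square)
    have second: "\<bar>pdiff l (pdiff k (stream_function \<eta> b)) x\<bar> \<le> C * (2 + R) * s\<^sup>2" for l k
    proof -
      have "\<bar>pdiff l \<eta> x * (if k = b then 1 else 0)\<bar> \<le> C * s\<^sup>2" "\<bar>pdiff k \<eta> x * (if l = b then 1 else 0)\<bar> \<le> C * s\<^sup>2"
        using b1[of l] b1[of k] mult_left_mono[OF ss C] by auto
      moreover have "\<bar>pdiff l (pdiff k \<eta>) x * x $ b\<bar> \<le> (C * s\<^sup>2) * R"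
        unfolding abs_mult using b2 xb C by (intro mult_mono) auto
      ultimately have "\<bar>pdiff l (pdiff k (stream_function \<eta> b)) x\<bar> \<le> C * s\<^sup>2 + (C * s\<^sup>2 + (C * s\<^sup>2) * R)"
        unfolding pdiff_pdiff_stream_function[OF sm] by linarith
      then show ?thesis by (simp add: algebra_simps)
    qed
    have vb: "\<bar>pdiff i (layer_velocity s \<eta> a b j) x\<bar> \<le> C * (2 + R) * s"
    proof -
      have "\<bar>(1 / s) * pdiff i (pdiff k (stream_function \<eta> b)) x\<bar> \<le> C * (2 + R) * s" for k
        using mult_left_mono[OF second[of i k], of "1 / s"] s by (simp add: abs_mult power2_eq_square)
      then show ?thesis using C R(2) s by (auto simp: vel)
    qed
    have "\<bar>\<eta> x - 1\<bar> \<le> C + 1" using b0 by linarith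
    then have "\<bar>(\<eta> x - 1) * x $ b\<bar> \<le> (C + 1) * R"
      unfolding abs_mult using xb C by (intro mult_mono) auto
    moreover have "stream_function \<eta> b x - x $ b = (\<eta> x - 1) * x $ b" by (simp add: stream_function_def algebra_simps)
    ultimately have pb: "\<bar>s * (stream_function \<eta> b x - x $ b)\<bar> \<le> (C + 1) * R * s"
      using s by (simp add: abs_mult mult.commute mult_left_mono)
    have pos: "(C + 1) * R * s \<ge> 0" using C R(2) s by simp
    have "\<bar>layer_flux s \<eta> a b j i x\<bar> \<le> C * (2 + R) * s + (C + 1) * R * s"
    proof -
      let ?e = "(if j = a \<and> i = b then - s * (stream_function \<eta> b x - x $ b) else 0)
        + (if j = b \<and> i = a then s * (stream_function \<eta> b x - x $ b) else 0)"
      have "\<bar>?e\<bar> \<le> (C + 1) * R * s" using pb pos ab by auto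
      then show ?thesis unfolding layer_flux_def using vb by linarith
    qed
    then show ?thesis using True by (simp add: algebra_simps)
  qed
qed

text \<open>A field of size \<open>O(s)\<close> on a set of measure \<open>O(1 / s)\<close>.\<close>

lemma layer_flux_L2_norm:
  fixes \<Omega> :: "(real^'d::finite) set"
  assumes \<Omega>: "open \<Omega>" "bounded \<Omega>"
    and \<eta>: "boundary_cutoff \<Omega> C (1 / s) \<eta> L" and s: "s \<ge> 1" and C: "C \<ge> 0" and ab: "a \<noteq> b"
    and R: "\<And>x. x \<in> \<Omega> \<Longrightarrow> norm x \<le> R" "R \<ge> 0"
  shows "L2_norm \<Omega> (\<lambda>x. complex_of_real (layer_flux s \<eta> a b j i x))
    \<le> (C * (2 + R) + (C + 1) * R) * sqrt C * sqrt s"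
proof -
  let ?M = "lebesgue_on \<Omega>"
  define B where "B = C * (2 + R) + (C + 1) * R"
  have B: "B \<ge> 0" using C R(2) by (simp add: B_def)
  have sm: "smooth \<eta>" and L: "L \<in> lmeasurable" "L \<subseteq> \<Omega>" "measure lebesgue L \<le> C / s"
    using boundary_cutoffD(1,3-5)[OF \<eta>] by simp_all
  have \<Omega>s: "\<Omega> \<in> sets lebesgue" using \<Omega>(1) by (simp add: borel_open)
  have LM: "L \<in> sets ?M" using L \<Omega>s by (auto simp: sets_restrict_space_iff fmeasurableD)
  have mL: "measure ?M L = measure lebesgue L" using L \<Omega>s by (intro measure_restrict_space) auto
  have fin: "emeasure ?M L < \<infinity>"
    using finite_measure.emeasure_finite[OF finite_lebesgue_on[OF \<Omega>], of L] by (simp add: top.not_eq_extremum)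
  have int: "integrable ?M (\<lambda>x. (B * s)\<^sup>2 * indicator L x)"
    using LM fin by (intro integrable_mult_right integrable_real_indicator)
  have f: "(\<lambda>x. complex_of_real (layer_flux s \<eta> a b j i x)) \<in> L2 \<Omega>"
    by (intro smooth_L2 \<Omega> smooth_bounded_linear[OF bounded_linear_of_real] smooth_layer_flux sm ab)
  have "(\<integral>x. (norm (complex_of_real (layer_flux s \<eta> a b j i x)))\<^sup>2 \<partial>?M) \<le> (\<integral>x. (B * s)\<^sup>2 * indicator L x \<partial>?M)"
  proof (rule integral_mono[OF L2_integrable_sq[OF f] int])
    fix x assume "x \<in> space ?M"
    then have x: "x \<in> \<Omega>" by simp
    have "\<bar>layer_flux s \<eta> a b j i x\<bar>\<^sup>2 \<le> (B * s * indicator L x)\<^sup>2"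
      using layer_flux_bound[OF \<eta> s C ab R x, of j i] unfolding B_def by (intro power_mono) auto
    then show "(norm (complex_of_real (layer_flux s \<eta> a b j i x)))\<^sup>2 \<le> (B * s)\<^sup>2 * indicator L x"
      by (cases "x \<in> L") auto
  qed
  also have "\<dots> = (B * s)\<^sup>2 * measure lebesgue L" using LM fin by (simp add: mL Int_absorb2[OF L(2)])
  also have "\<dots> \<le> (B * s)\<^sup>2 * (C / s)" using L(3) by (intro mult_left_mono) auto
  also have "\<dots> = B\<^sup>2 * C * s" using s by (simp add: power2_eq_square)
  finally have "L2_norm \<Omega> (\<lambda>x. complex_of_real (layer_flux s \<eta> a b j i x)) \<le> sqrt (B\<^sup>2 * C * s)"
    unfolding L2_norm_def by (rule real_sqrt_le_mono)
  then show ?thesis using B by (simp add: real_sqrt_mult B_def)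
qed

lemma stream_function_support:
  assumes "\<eta> \<in> test_functions \<Omega>"
  shows "{x. \<exists>i. pdiff i (stream_function \<eta> b) x \<noteq> 0} \<subseteq> closure {x. \<eta> x \<noteq> 0}"
proof clarify
  fix x i assume "pdiff i (stream_function \<eta> b) x \<noteq> 0"
  then have "x \<in> closure {x. stream_function \<eta> b x \<noteq> 0}" using pdiff_zero_outside_support by blast
  also have "\<dots> \<subseteq> closure {x. \<eta> x \<noteq> 0}" by (intro closure_mono) (auto simp: stream_function_def)
  finally show "x \<in> closure {x. \<eta> x \<noteq> 0}" .
qed

lemma layer_velocity_solenoidal:
  fixes \<Omega> :: "(real^'d::finite) set"
  assumes \<Omega>: "open \<Omega>" "bounded \<Omega>" and \<eta>: "\<eta> \<in> test_functions \<Omega>" and ab: "a \<noteq> b"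
  shows "(\<lambda>x. \<chi> j. complex_of_real (layer_velocity s \<eta> a b j x)) \<in> H10_solenoidal \<Omega>"
    (is "?u \<in> _")
proof -
  have sm: "smooth \<eta>" by (rule test_function_smooth[OF \<eta>])
  have su: "smooth ?u"
    by (rule smooth_vec) (simp add: smooth_bounded_linear[OF bounded_linear_of_real smooth_layer_velocity[OF sm ab]])
  have "layer_velocity s \<eta> a b j x = 0" if "\<And>i. pdiff i (stream_function \<eta> b) x = 0" for j x
    by (simp add: layer_velocity_def that)
  then have "{x. ?u x \<noteq> 0} \<subseteq> {x. \<exists>i. pdiff i (stream_function \<eta> b) x \<noteq> 0}" by (auto simp: vec_eq_iff)
  then have sub: "closure {x. ?u x \<noteq> 0} \<subseteq> closure {x. \<eta> x \<noteq> 0}"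
    using stream_function_support[OF \<eta>] by (intro closure_minimal closed_closure) (rule order_trans)
  have test: "?u \<in> test_functions \<Omega>"
    using su \<eta> compact_closure_subset[OF _ sub] order_trans[OF sub] by (simp add: test_functions_iff)
  have "(\<Sum>i\<in>UNIV. classical_partial i (\<lambda>y. ?u y $ i) x) = 0" for x
  proof -
    have m: "pdiff i (\<lambda>x. c * pdiff k (stream_function \<eta> b) x) x = c * pdiff i (pdiff k (stream_function \<eta> b)) x" for i c k
      by (rule pdiff_bounded_linear[OF bounded_linear_mult_right smooth_pdiff[OF smooth_stream_function[OF sm]]])
    have r: "pdiff i (\<lambda>y. complex_of_real (layer_velocity s \<eta> a b i y)) x
        = complex_of_real (pdiff i (layer_velocity s \<eta> a b i) x)" for i
      by (rule pdiff_bounded_linear[OF bounded_linear_of_real smooth_layer_velocity[OF sm ab]])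
    have "(\<Sum>i\<in>UNIV. pdiff i (layer_velocity s \<eta> a b i) x) = (\<Sum>i\<in>{a, b}. pdiff i (layer_velocity s \<eta> a b i) x)"
      by (rule sum.mono_neutral_right) (simp_all add: layer_velocity_cases pdiff_const)
    also have "\<dots> = (1 / s) * pdiff a (pdiff b (stream_function \<eta> b)) x + - (1 / s) * pdiff b (pdiff a (stream_function \<eta> b)) x"
      using ab by (simp only: sum.insert sum.empty finite.intros insert_iff empty_iff simp_thms
          layer_velocity_cases m add_0_right)
    \<comment> \<open>the two mixed second derivatives of the stream function cancel\<close>
    also have "\<dots> = 0" by (simp add: pdiff_commute[OF smooth_stream_function[OF sm], of a b])
    finally show ?thesis
      by (simp add: classical_partial_eq r flip: of_real_sum)
  qed
  then show ?thesis
    unfolding H10_solenoidal_def by (intro subset_H1_closure \<Omega> su) (simp add: test)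
qed

lemma sum_single_entry: "(\<Sum>j\<in>UNIV. \<Sum>i\<in>UNIV. if j = a \<and> i = b then X else 0) = (X :: complex)"
  for a b :: "'d::finite"
proof -
  have "(\<Sum>i\<in>UNIV. if j = a \<and> i = b then X else 0) = (if j = a then X else 0)" for j
    by (cases "j = a") simp_all
  then show ?thesis by simp
qed

text \<open>All terms are integrals of real smooth functions against conjugates of \<open>v\<close> or of its weak
derivatives.  Integration by parts moves the derivatives off \<open>v\<close>, after which both sides are the same
combination of integrals.\<close>

lemma layer_stokes_solution:
  fixes \<Omega> :: "(real^'d::finite) set"
  assumes \<Omega>: "open \<Omega>" "bounded \<Omega>" and \<eta>: "\<eta> \<in> test_functions \<Omega>" and ab: "a \<noteq> b" and s: "s > 0"
    and m: "(\<integral>x. complex_of_real (x $ a - m) \<partial>lebesgue_on \<Omega>) = 0"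
  shows "stokes_solution \<Omega> (complex_of_real (s\<^sup>2))
    (grad_functional \<Omega> (\<lambda>j i x. complex_of_real (layer_flux s \<eta> a b j i x)))
    (\<lambda>x. \<chi> j. complex_of_real (layer_velocity s \<eta> a b j x))
    (\<lambda>x. complex_of_real (- s * (x $ a - m)))"
    (is "stokes_solution _ _ ?F ?u ?\<phi>")
proof -
  let ?M = "lebesgue_on \<Omega>"
  have sm: "smooth \<eta>" by (rule test_function_smooth[OF \<eta>])
  have su: "smooth (layer_velocity s \<eta> a b j)" for j by (rule smooth_layer_velocity[OF sm ab])
  have suc: "smooth ?u"
    by (rule smooth_vec) (simp add: smooth_bounded_linear[OF bounded_linear_of_real su])
  have cL2: "(\<lambda>x. complex_of_real (q x)) \<in> L2 \<Omega>" if "smooth q" for q :: "real^'d \<Rightarrow> real"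
    by (rule smooth_L2[OF \<Omega> smooth_bounded_linear[OF bounded_linear_of_real that]])
  have sq: "smooth (\<lambda>x. - s * (x $ a - m))"
    by (intro smooth_cmult smooth_diff smooth_coord smooth_const)
  have "(\<integral>x. ?\<phi> x \<partial>?M) = (\<integral>x. - complex_of_real s * complex_of_real (x $ a - m) \<partial>?M)"
    by simp
  also have "\<dots> = 0" using m by (simp only: integral_mult_right_zero mult_zero_right)
  finally have \<phi>: "?\<phi> \<in> L2_mean0 \<Omega>" using cL2[OF sq] by (simp add: L2_mean0_def)
  have "complex_of_real (s\<^sup>2) * (\<integral>x. (\<Sum>j\<in>UNIV. ?u x $ j * cnj (v x $ j)) \<partial>?M)
        + (\<integral>x. (\<Sum>j\<in>UNIV. \<Sum>i\<in>UNIV. weak_grad \<Omega> ?u x $ j $ i * cnj (weak_grad \<Omega> v x $ j $ i)) \<partial>?M)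
        - (\<integral>x. ?\<phi> x * cnj (weak_div \<Omega> v x) \<partial>?M) = ?F v" if v: "v \<in> H10 \<Omega>" for v
  proof -
    note v1 = H10_H1[OF v]
    define I where "I q i j = (\<integral>x. complex_of_real (q x) * cnj (weak_partial \<Omega> i (\<lambda>x. v x $ j) x) \<partial>?M)" for q i j
    define J where "J q j = (\<integral>x. complex_of_real (q x) * cnj (v x $ j) \<partial>?M)" for q j
    have intI: "integrable ?M (\<lambda>x. complex_of_real (q x) * cnj (weak_partial \<Omega> i (\<lambda>x. v x $ j) x))" if "smooth q" for q i j
      by (rule L2_mult_integrable[OF cL2[OF that] L2_cnj[OF weak_partial_L2[OF v1]]])
    have intJ: "integrable ?M (\<lambda>x. complex_of_real (q x) * cnj (v x $ j))" if "smooth q" for q j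
      by (rule L2_mult_integrable[OF cL2[OF that] L2_cnj[OF H1_nth_L2[OF v1]]])
    have green: "I q i j = - J (pdiff i q) j" if q: "smooth q" for q i j
    proof -
      have r: "pdiff i (\<lambda>x. complex_of_real (q x)) x = complex_of_real (pdiff i q x)" for x
        by (rule pdiff_bounded_linear[OF bounded_linear_of_real q])
      have c: "(\<integral>x. complex_of_real (q' x) * cnj (w x) \<partial>?M) = cnj (\<integral>x. complex_of_real (q' x) * w x \<partial>?M)" for q' w
        by (subst Bochner_Integration.integral_cnj[symmetric]) (simp only: complex_cnj_mult complex_cnj_complex_of_real)
      show ?thesis
        unfolding I_def J_def c
        using H10_integration_by_parts[OF \<Omega> smooth_bounded_linear[OF bounded_linear_of_real q] v, of i j]
        by (simp only: r complex_cnj_minus)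
    qed
    have I_add: "I (\<lambda>x. q x + q' x) i j = I q i j + I q' i j" if "smooth q" "smooth q'" for q q' i j
      using intI[OF that(1)] intI[OF that(2)] by (simp add: I_def distrib_right)
    have I_mult: "I (\<lambda>x. c * q x) i j = complex_of_real c * I q i j" for c q i j
      by (simp add: I_def mult.assoc)
    have J_mult: "J (\<lambda>x. c * q x) j = complex_of_real c * J q j" for c q j
      by (simp add: J_def mult.assoc)
    have J_diff: "J (\<lambda>x. q x - q' x) j = J q j - J q' j" if "smooth q" "smooth q'" for q q' j
      using intJ[OF that(1)] intJ[OF that(2)] by (simp add: J_def left_diff_distrib)
    \<comment> \<open>\<open>p\<close> lives in the layer; \<open>s * (d\<^sub>b p) e\<^sub>a - s * (d\<^sub>a p) e\<^sub>b\<close> is the sum of mass term and pressure gradient\<close>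
    define p where "p x = stream_function \<eta> b x - x $ b" for x
    have sp: "smooth p" unfolding p_def[abs_def] by (intro smooth_diff smooth_stream_function[OF sm] smooth_coord)
    have ss: "smooth (pdiff k (stream_function \<eta> b))" for k by (intro smooth_pdiff smooth_stream_function sm)
    have "(\<integral>x. (\<Sum>j\<in>UNIV. ?u x $ j * cnj (v x $ j)) \<partial>?M) = (\<Sum>j\<in>UNIV. J (layer_velocity s \<eta> a b j) j)"
      using intJ[OF su] by (simp add: J_def)
    also have "\<dots> = (\<Sum>j\<in>{a, b}. J (layer_velocity s \<eta> a b j) j)"
      by (rule sum.mono_neutral_right) (simp_all add: layer_velocity_cases J_def)
    also have "\<dots> = J (layer_velocity s \<eta> a b a) a + J (layer_velocity s \<eta> a b b) b" using ab by simp
    also have "\<dots> = complex_of_real (1 / s) * J (pdiff b (stream_function \<eta> b)) a + complex_of_real (- (1 / s)) * J (pdiff a (stream_function \<eta> b)) b"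
      by (simp only: layer_velocity_cases(1) layer_velocity_cases(2)[OF ab] J_mult)
    finally have mass: "(\<integral>x. (\<Sum>j\<in>UNIV. ?u x $ j * cnj (v x $ j)) \<partial>?M)
        = complex_of_real (1 / s) * J (pdiff b (stream_function \<eta> b)) a + complex_of_real (- (1 / s)) * J (pdiff a (stream_function \<eta> b)) b" .
    have "complex_of_real (s\<^sup>2) * (complex_of_real (1 / s) * A + complex_of_real (- (1 / s)) * B)
        = complex_of_real s * A - complex_of_real s * B" for A B
      using s by (simp add: power2_eq_square field_simps)
    then have T1: "complex_of_real (s\<^sup>2) * (\<integral>x. (\<Sum>j\<in>UNIV. ?u x $ j * cnj (v x $ j)) \<partial>?M)
        = complex_of_real s * J (pdiff b (stream_function \<eta> b)) a - complex_of_real s * J (pdiff a (stream_function \<eta> b)) b"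
      unfolding mass .
    have gr: "AE x in ?M. \<forall>j i. weak_partial \<Omega> i (\<lambda>y. ?u y $ j) x = complex_of_real (pdiff i (layer_velocity s \<eta> a b j) x)"
    proof (intro eventually_all_finite)
      fix j i
      have "pdiff i (\<lambda>x. complex_of_real (layer_velocity s \<eta> a b j x)) x = complex_of_real (pdiff i (layer_velocity s \<eta> a b j) x)" for x
        by (rule pdiff_bounded_linear[OF bounded_linear_of_real su])
      then show "AE x in ?M. weak_partial \<Omega> i (\<lambda>y. ?u y $ j) x = complex_of_real (pdiff i (layer_velocity s \<eta> a b j) x)"
        using smooth_weak_partial_AE[OF \<Omega> suc, of i j] by simp
    qed
    have T2: "(\<integral>x. (\<Sum>j\<in>UNIV. \<Sum>i\<in>UNIV. weak_grad \<Omega> ?u x $ j $ i * cnj (weak_grad \<Omega> v x $ j $ i)) \<partial>?M)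
        = (\<Sum>j\<in>UNIV. \<Sum>i\<in>UNIV. I (pdiff i (layer_velocity s \<eta> a b j)) i j)"
    proof -
      have "(\<integral>x. (\<Sum>j\<in>UNIV. \<Sum>i\<in>UNIV. weak_grad \<Omega> ?u x $ j $ i * cnj (weak_grad \<Omega> v x $ j $ i)) \<partial>?M)
        = (\<integral>x. (\<Sum>j\<in>UNIV. \<Sum>i\<in>UNIV. complex_of_real (pdiff i (layer_velocity s \<eta> a b j) x)
              * cnj (weak_partial \<Omega> i (\<lambda>x. v x $ j) x)) \<partial>?M)"
      proof (rule integral_cong_AE)
        show "AE x in ?M. (\<Sum>j\<in>UNIV. \<Sum>i\<in>UNIV. weak_grad \<Omega> ?u x $ j $ i * cnj (weak_grad \<Omega> v x $ j $ i))
          = (\<Sum>j\<in>UNIV. \<Sum>i\<in>UNIV. complex_of_real (pdiff i (layer_velocity s \<eta> a b j) x)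
              * cnj (weak_partial \<Omega> i (\<lambda>x. v x $ j) x))"
          using gr by eventually_elim (simp add: weak_grad_def)
        have "integrable ?M (\<lambda>x. weak_partial \<Omega> i (\<lambda>y. ?u y $ j) x * cnj (weak_partial \<Omega> i (\<lambda>x. v x $ j) x))" for i j
          by (rule L2_mult_integrable[OF weak_partial_L2[OF smooth_H1[OF \<Omega> suc]] L2_cnj[OF weak_partial_L2[OF v1]]])
        then show "(\<lambda>x. \<Sum>j\<in>UNIV. \<Sum>i\<in>UNIV. weak_grad \<Omega> ?u x $ j $ i * cnj (weak_grad \<Omega> v x $ j $ i)) \<in> borel_measurable ?M"
          unfolding weak_grad_def vec_lambda_beta
          by (intro borel_measurable_integrable Bochner_Integration.integrable_sum)
        show "(\<lambda>x. \<Sum>j\<in>UNIV. \<Sum>i\<in>UNIV. complex_of_real (pdiff i (layer_velocity s \<eta> a b j) x)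
              * cnj (weak_partial \<Omega> i (\<lambda>x. v x $ j) x)) \<in> borel_measurable ?M"
          by (intro borel_measurable_integrable Bochner_Integration.integrable_sum intI smooth_pdiff su)
      qed
      also have "\<dots> = (\<Sum>j\<in>UNIV. \<Sum>i\<in>UNIV. I (pdiff i (layer_velocity s \<eta> a b j)) i j)"
        using intI[OF smooth_pdiff[OF su]] by (simp add: I_def)
      finally show ?thesis .
    qed
    \<comment> \<open>the pressure is affine with gradient \<open>- s * e\<^sub>a\<close>, so the pressure term is an integral of \<open>v $ a\<close>\<close>
    have T3: "(\<integral>x. ?\<phi> x * cnj (weak_div \<Omega> v x) \<partial>?M) = complex_of_real s * J (\<lambda>x. 1) a"
    proof -
      have "pdiff i (\<lambda>x. - s * (x $ a - m)) x = - s * (if i = a then 1 else 0)" for i and x :: "real^'d"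
      proof -
        have "pdiff i (\<lambda>x::real^'d. - s * (x $ a - m)) x = - s * pdiff i (\<lambda>x. x $ a - m) x"
          by (rule pdiff_bounded_linear[OF bounded_linear_mult_right smooth_diff[OF smooth_coord smooth_const]])
        also have "pdiff i (\<lambda>x. x $ a - m) x = (if i = a then 1 else 0)"
          by (simp only: pdiff_diff[OF smooth_coord smooth_const] pdiff_nth pdiff_const diff_0_right)
        finally show ?thesis .
      qed
      then have d: "pdiff i (\<lambda>x::real^'d. - s * (x $ a - m)) = (\<lambda>x. (- s * (if i = a then 1 else 0)) * 1)" for i
        by (simp add: fun_eq_iff)
      have "(\<integral>x. ?\<phi> x * cnj (weak_div \<Omega> v x) \<partial>?M) = (\<Sum>i\<in>UNIV. I (\<lambda>x. - s * (x $ a - m)) i i)"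
        using intI[OF sq] unfolding I_def weak_div_def cnj_sum sum_distrib_left
        by (intro Bochner_Integration.integral_sum)
      also have "\<dots> = (\<Sum>i\<in>UNIV. if i = a then complex_of_real s * J (\<lambda>x. 1) a else 0)"
        unfolding green[OF sq] d J_mult by (intro sum.cong) auto
      finally show ?thesis by simp
    qed
    have I0: "I (\<lambda>x. 0) i j = 0" for i j by (simp add: I_def)
    have flux: "I (layer_flux s \<eta> a b j i) i j = I (pdiff i (layer_velocity s \<eta> a b j)) i j
        + ((if j = a \<and> i = b then complex_of_real (- s) * I p b a else 0)
         + (if j = b \<and> i = a then complex_of_real s * I p a b else 0))" for i j
    proof -
      have c: "smooth (\<lambda>x. if P then c * p x else 0)" "I (\<lambda>x. if P then c * p x else 0) i j = (if P then complex_of_real c * I p i j else 0)" for P c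
        using smooth_cmult[OF sp, of c] by (cases P; simp add: smooth_const I_mult I0)+
      have "I (layer_flux s \<eta> a b j i) i j = I (\<lambda>x. pdiff i (layer_velocity s \<eta> a b j) x
          + ((if j = a \<and> i = b then - s * p x else 0) + (if j = b \<and> i = a then s * p x else 0))) i j"
        by (simp only: layer_flux_def[abs_def] p_def)
      also have "\<dots> = I (pdiff i (layer_velocity s \<eta> a b j)) i j
        + ((if j = a \<and> i = b then complex_of_real (- s) * I p i j else 0)
         + (if j = b \<and> i = a then complex_of_real s * I p i j else 0))"
        by (subst I_add[OF smooth_pdiff[OF su] smooth_add[OF c(1) c(1)]], subst I_add[OF c(1) c(1)]) (simp only: c(2))
      also have "(if j = a \<and> i = b then complex_of_real (- s) * I p i j else 0) = (if j = a \<and> i = b then complex_of_real (- s) * I p b a else 0)"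
        by (rule if_cong) auto
      also have "(if j = b \<and> i = a then complex_of_real s * I p i j else 0) = (if j = b \<and> i = a then complex_of_real s * I p a b else 0)"
        by (rule if_cong) auto
      finally show ?thesis .
    qed
    have "?F v = (\<Sum>j\<in>UNIV. \<Sum>i\<in>UNIV. I (layer_flux s \<eta> a b j i) i j)"
      unfolding I_def by (rule grad_functional_eq[OF cL2[OF smooth_layer_flux[OF sm ab]] v1])
    also have "\<dots> = (\<Sum>j\<in>UNIV. \<Sum>i\<in>UNIV. I (pdiff i (layer_velocity s \<eta> a b j)) i j)
        + (complex_of_real (- s) * I p b a + complex_of_real s * I p a b)"
      unfolding flux sum.distrib sum_single_entry ..
    finally have T4: "?F v = (\<Sum>j\<in>UNIV. \<Sum>i\<in>UNIV. I (pdiff i (layer_velocity s \<eta> a b j)) i j)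
        + complex_of_real s * J (pdiff b p) a - complex_of_real s * J (pdiff a p) b"
      by (simp add: green[OF sp])
    have dp: "pdiff k p = (\<lambda>x. pdiff k (stream_function \<eta> b) x - (if k = b then 1 else 0))" for k
      unfolding p_def[abs_def] by (rule ext) (simp only: pdiff_diff[OF smooth_stream_function[OF sm] smooth_coord] pdiff_nth)
    have Jp: "J (pdiff b p) a = J (pdiff b (stream_function \<eta> b)) a - J (\<lambda>x. 1) a" "J (pdiff a p) b = J (pdiff a (stream_function \<eta> b)) b"
      using ab by (simp_all add: dp J_diff[OF ss smooth_const])
    show ?thesis unfolding T1 T2 T3 T4 Jp by (simp add: algebra_simps)
  qed
  then show ?thesis
    unfolding stokes_solution_def
    using layer_velocity_solenoidal[OF \<Omega> \<eta> ab, of s] \<phi> by (intro conjI ballI)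
qed

lemma sector_of_real: "0 < t \<Longrightarrow> 0 < \<theta> \<Longrightarrow> complex_of_real t \<in> sector \<theta>"
  by (simp add: sector_def)

theorem proposition3p7:
  fixes \<Omega> :: "(real^'d::finite) set" and \<theta> \<alpha> :: real
  assumes "CARD('d) \<ge> 2"
    and "bounded_domain \<Omega>" and "Ck_boundary 4 \<Omega>"
    and "pi / 2 < \<theta>" and "\<theta> < pi"
    and "0 \<le> \<alpha>" and "\<alpha> < 1 / 4"
  shows "\<forall>n::nat. \<exists>F\<in>Hneg1 \<Omega>. \<exists>\<mu>\<in>sector \<theta>. norm \<mu> \<ge> 1 \<and>
    (\<exists>\<phi>. associated_pressure \<Omega> \<mu> F \<phi> \<and>
      L2_norm \<Omega> \<phi> > real n * norm \<mu> powr \<alpha> * Hneg1_norm \<Omega> F)"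
proof
  fix n :: nat
  have \<Omega>: "open \<Omega>" "bounded \<Omega>" "\<Omega> \<noteq> {}" using assms(2) by (auto simp: bounded_domain_def)
  obtain a b :: 'd where ab: "a \<noteq> b"
  proof -
    have "\<not> card (UNIV :: 'd set) \<le> 1" using assms(1) by simp
    then show thesis using that by (auto simp: card_le_Suc0_iff_eq)
  qed
  have "Ck_boundary (Suc 3) \<Omega>" using assms(3) by (simp add: numeral_eq_Suc)
  from boundary_cutoff_exists[OF assms(2) this] obtain C h0 where C: "C \<ge> 0" and h0: "h0 > 0"
    and cut: "\<And>h. 0 < h \<Longrightarrow> h \<le> h0 \<Longrightarrow> \<exists>\<eta> L. boundary_cutoff \<Omega> C h \<eta> L" by blast
  obtain R where R: "\<And>x. x \<in> \<Omega> \<Longrightarrow> norm x \<le> R" "R \<ge> 0"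
    using continuous_bounded_on[OF \<Omega>(2) continuous_on_id] by auto
  let ?M = "lebesgue_on \<Omega>"
  define m where "m = (\<integral>x. x $ a \<partial>?M) / measure ?M \<Omega>"
  define K where "K = L2_norm \<Omega> (\<lambda>x. complex_of_real (x $ a - m))"
  have K: "K > 0" unfolding K_def by (rule L2_norm_coordinate_pos[OF \<Omega>(1,3,2)])
  have m: "(\<integral>x. complex_of_real (x $ a - m) \<partial>?M) = 0"
  proof -
    have \<Omega>s: "\<Omega> \<in> sets lebesgue" using \<Omega>(1) by (simp add: borel_open)
    interpret finite_measure ?M by (rule finite_lebesgue_on[OF \<Omega>(1,2)])
    have "measure ?M \<Omega> \<noteq> 0"
    proof
      assume "measure ?M \<Omega> = 0"
      then have "measure lebesgue \<Omega> = 0" using \<Omega>s by (simp add: measure_restrict_space)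
      then have "negligible \<Omega>"
        using lmeasurable_open[OF \<Omega>(2,1)] by (simp add: negligible_iff_measure)
      then show False using open_not_negligible[OF \<Omega>(1,3)] by blast
    qed
    moreover have "integrable ?M (\<lambda>x. x $ a)"
    proof -
      have "integrable ?M (\<lambda>x. complex_of_real (x $ a))"
        by (intro L2_integrable smooth_L2 \<Omega> smooth_bounded_linear[OF bounded_linear_of_real] smooth_coord)
      then show ?thesis by (rule integrable_Re[where f="\<lambda>x. complex_of_real (x $ a)", simplified])
    qed
    ultimately have "(\<integral>x. x $ a - m \<partial>?M) = 0"
      by (simp add: m_def)
    then show ?thesis by (simp only: integral_complex_of_real of_real_0)
  qed
  define D where "D = real CARD('d) * (real CARD('d) * ((C * (2 + R) + (C + 1) * R) * sqrt C))"
  have D: "D \<ge> 0" using C R(2) by (simp add: D_def)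
  \<comment> \<open>\<open>\<beta>\<close> is what remains of the gain \<open>s powr (1 / 2)\<close> after paying \<open>norm \<mu> powr \<alpha> = s powr (2 * \<alpha>)\<close>\<close>
  define \<beta> where "\<beta> = 1 / 2 - 2 * \<alpha>"
  have \<beta>: "\<beta> > 0" using assms(7) by (simp add: \<beta>_def)
  define Q where "Q = (real n * D + 1) / K"
  have Q: "Q > 0" using D K by (simp add: Q_def add_nonneg_pos)
  \<comment> \<open>\<open>s\<close> is the square root of the resolvent parameter; the layer has width comparable to \<open>1 / s\<close>\<close>
  define s where "s = max (max 1 (1 / h0)) (Q powr (1 / \<beta>))"
  have s: "s \<ge> 1" "1 / h0 \<le> s" "Q powr (1 / \<beta>) \<le> s" by (auto simp: s_def)
  have "1 / s \<le> h0" using s(1,2) h0 by (simp add: field_simps)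
  then obtain \<eta> L where \<eta>: "boundary_cutoff \<Omega> C (1 / s) \<eta> L" using cut[of "1 / s"] s(1) by auto
  let ?G = "\<lambda>j i x. complex_of_real (layer_flux s \<eta> a b j i x)"
  let ?F = "grad_functional \<Omega> ?G"
  let ?\<phi> = "\<lambda>x. complex_of_real (- s * (x $ a - m))"
  let ?\<mu> = "complex_of_real (s\<^sup>2)"
  have G: "?G j i \<in> L2 \<Omega>" for j i
    by (intro smooth_L2 \<Omega> smooth_bounded_linear[OF bounded_linear_of_real] smooth_layer_flux boundary_cutoffD(1)[OF \<eta>] ab)
  have "Hneg1_norm \<Omega> ?F \<le> (\<Sum>j\<in>UNIV. \<Sum>i\<in>UNIV. L2_norm \<Omega> (?G j i))"
    by (rule grad_functional_norm[OF \<Omega>(1,2) G])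
  also have "\<dots> \<le> (\<Sum>j\<in>(UNIV::'d set). \<Sum>i\<in>(UNIV::'d set). (C * (2 + R) + (C + 1) * R) * sqrt C * sqrt s)"
    by (intro sum_mono layer_flux_L2_norm[OF \<Omega>(1,2) \<eta> s(1) C ab R])
  also have "\<dots> = D * sqrt s" by (simp add: D_def)
  finally have normF: "Hneg1_norm \<Omega> ?F \<le> D * sqrt s" .
  have "L2_norm \<Omega> ?\<phi> = s * K"
  proof -
    have "(norm (?\<phi> x))\<^sup>2 = s\<^sup>2 * (norm (complex_of_real (x $ a - m)))\<^sup>2" for x
      using s(1) by (simp add: norm_mult power_mult_distrib del: of_real_diff)
    then show ?thesis
      using s(1) by (simp add: K_def L2_norm_def real_sqrt_mult del: of_real_diff)
  qed
  moreover have "real n * norm ?\<mu> powr \<alpha> * Hneg1_norm \<Omega> ?F < s * K"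
  proof -
    have "Q = (Q powr (1 / \<beta>)) powr \<beta>" using Q \<beta> by (simp add: powr_powr)
    also have "\<dots> \<le> s powr \<beta>" using s(3) \<beta> by (intro powr_mono2) auto
    finally have "real n * D + 1 \<le> s powr \<beta> * K" using K by (simp add: Q_def field_simps)
    then have nD: "real n * D < s powr \<beta> * K" by simp
    have "norm ?\<mu> powr \<alpha> = s powr (2 * \<alpha>)"
      using s(1) by (simp add: norm_power powr_powr flip: powr_numeral)
    moreover have "sqrt s = s powr (1 / 2)" using s(1) by (simp add: powr_half_sqrt)
    ultimately have "real n * norm ?\<mu> powr \<alpha> * Hneg1_norm \<Omega> ?F \<le> real n * s powr (2 * \<alpha>) * (D * s powr (1 / 2))"
      using normF by (simp add: mult_left_mono)
    also have "\<dots> = (real n * D) * s powr (2 * \<alpha> + 1 / 2)" by (simp add: powr_add)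
    also have "\<dots> < (s powr \<beta> * K) * s powr (2 * \<alpha> + 1 / 2)"
      using nD s(1) by (intro mult_strict_right_mono) auto
    also have "\<dots> = K * s powr (\<beta> + (2 * \<alpha> + 1 / 2))" by (simp only: powr_add mult_ac)
    also have "\<beta> + (2 * \<alpha> + 1 / 2) = 1" by (simp add: \<beta>_def)
    also have "K * s powr 1 = s * K" using s(1) by simp
    finally show ?thesis .
  qed
  ultimately have big: "real n * norm ?\<mu> powr \<alpha> * Hneg1_norm \<Omega> ?F < L2_norm \<Omega> ?\<phi>" by simp
  have "s > 0" using s(1) by linarith
  have press: "associated_pressure \<Omega> ?\<mu> ?F ?\<phi>"
    unfolding associated_pressure_def
    by (rule exI, rule layer_stokes_solution[OF \<Omega>(1,2) boundary_cutoffD(2)[OF \<eta>] ab \<open>s > 0\<close> m])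
  show "\<exists>F\<in>Hneg1 \<Omega>. \<exists>\<mu>\<in>sector \<theta>. norm \<mu> \<ge> 1 \<and>
    (\<exists>\<phi>. associated_pressure \<Omega> \<mu> F \<phi> \<and>
      L2_norm \<Omega> \<phi> > real n * norm \<mu> powr \<alpha> * Hneg1_norm \<Omega> F)"
  proof (intro bexI[of _ ?F] bexI[of _ ?\<mu>] conjI exI[of _ ?\<phi>])
    show "1 \<le> norm ?\<mu>" using s(1) by (simp add: norm_power one_le_power)
    show "?\<mu> \<in> sector \<theta>" using s(1) assms(4) pi_gt_zero by (intro sector_of_real) (auto simp del: pi_gt_zero)
    show "?F \<in> Hneg1 \<Omega>" by (rule grad_functional_Hneg1[OF \<Omega>(1,2) G])
  qed (use press big in auto)
qed

end
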